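(* Let $\mathbb F$ be a field of characteristic $0$, and let $V$ be a vector superspace over $\mathbb F$ with an even endomorphism $\partial$ and an increasing exhaustive filtration $0=F^0V\subset F^1V\subset F^2V\subset\cdots\subset V=\bigcup_qF^qV$ by $\mathbb F[\partial]$-submodules of finite rank (i.e. finitely generated), compatible with the $\mathbb Z/2\mathbb Z$-grading. The superspaces $\widetilde{\mathcal Chom}(\Pi V)(n)$, $n\ge0$, with the $\mathbb F[\partial]$-module structures, the actions of $S_n$, the $\circ^i_\lambda$-products and the projective systems $(\widetilde{\mathcal Chom}(\Pi V)_q(n))_{q\ge0}$ defined in the context, form a pro-conformal pseudo operad.
   Context: $\Pi V$ is $V$ with reversed parity $\bar p=1-p$. $\widetilde{\mathcal Chom}(\Pi V)(n)$ is the superspace of all linear maps $f_{\lambda_1,\dots,\lambda_n}:(\Pi V)^{\otimes n}\to\Pi V[\lambda_1,\dots,\lambda_n]$ such that $$f_{\lambda_1,\dots,\lambda_n}(v_1\otimes\cdots\partial v_i\cdots\otimes v_n)=-\lambda_if_{\lambda_1,\dots,\lambda_n}(v_1\otimes\cdots\otimes v_n),\quad i=1,\dots,n$$ (so $\widetilde{\mathcal Chom}(\Pi V)(0)=\Pi V$), with the parity induced by $\bar p$. $\mathbb F[\partial]$-module structure: $(\partial f)_{\lambda_1,\dots,\lambda_n}=(\partial+\lambda_1+\dots+\lambda_n)f_{\lambda_1,\dots,\lambda_n}$. Right $S_n$-action: $(f^\sigma)_{\lambda_1,\dots,\lambda_n}(v_1\otimes\cdots\otimes v_n)=\epsilon_v(\sigma)f_{\lambda_{\sigma^{-1}(1)},\dots,\lambda_{\sigma^{-1}(n)}}(v_{\sigma^{-1}(1)}\otimes\cdots\otimes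 v_{\sigma^{-1}(n)})$, $\epsilon_v(\sigma)=\prod_{i<j,\sigma(i)>\sigma(j)}(-1)^{\bar p(v_i)\bar p(v_j)}$. Products: for $f\in\widetilde{\mathcal Chom}(\Pi V)(n)$, $g\in\widetilde{\mathcal Chom}(\Pi V)(m)$, $1\le i\le n$, $$(f\circ^i_\lambda g)_{\mu_1,\dots,\mu_{m+n-1}}(v_1\otimes\cdots\otimes v_{m+n-1})=\pm f_{\mu_1,\dots,\mu_{i-1},\,\lambda+\mu_i+\dots+\mu_{i+m-1},\,\mu_{i+m},\dots,\mu_{m+n-1}}\big(v_1\otimes\cdots\otimes v_{i-1}\otimes g_{\mu_i,\dots,\mu_{i+m-1}}(v_i\otimes\cdots\otimes v_{i+m-1})\otimes v_{i+m}\otimes\cdots\otimes v_{m+n-1}\big),$$ with $\pm=(-1)^{\bar p(g)(\bar p(v_1)+\dots+\bar p(v_{i-1}))}$, regarded as a power series in $\lambda$ with coefficients in $\widetilde{\mathcal Chom}(\Pi V)(m+n-1)$. Projective system: $\widetilde{\mathcal Chom}(\Pi V)_q(n)$ is the space of linear maps $(\Pi F^qV)^{\otimes n}\to\Pi V[\lambda_1,\dots,\lambda_n]$ satisfying the same sesquilinearity conditions, with the same formulas for the $\partial$- and $S_n$-actions; the maps $\pi_{q+1,q}:\widetilde{\mathcal Chom}(\Pi V)_{q+1}(n)\to\widetilde{\mathcal Chom}(\Pi V)_q(n)$ and $\pi_q:\widetilde{\mathcal Chom}(\Pi V)(n)\to\widetilde{\mathcal Chom}(\Pi V)_q(n)$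 are restrictions. A pro-conformal pseudo operad is a collection of superspaces $\widetilde{\mathscr P}(n)$, $n\ge0$, with parity $p$, an even endomorphism $\partial$, a parity preserving right action $f\mapsto f^\sigma$ of $S_n$ commuting with $\partial$, and parity preserving bilinear products $\circ^i_\lambda:\widetilde{\mathscr P}(n)\otimes\widetilde{\mathscr P}(m)\to\widetilde{\mathscr P}(m+n-1)[[\lambda]]$, $1\le i\le n$, satisfying ($f\in\widetilde{\mathscr P}(n)$, $g\in\widetilde{\mathscr P}(m)$, $h\in\widetilde{\mathscr P}(\ell)$, $\sigma\in S_n$, $\tau\in S_m$): - $(\partial f)\circ^i_\lambda g=(\lambda+\partial)(f\circ^i_\lambda g)$, $f\circ^i_\lambda(\partial g)=-\lambda f\circ^i_\lambda g$; - $(f\circ^i_\lambda g)\circ^j_\mu h=(-1)^{p(g)p(h)}(f\circ^j_\mu h)\circ^{\ell+i-1}_\lambda g$ if $1\le j<i$; $(f\circ^i_\lambda g)\circ^j_\mu h=f\circ^i_{\lambda+\mu}(g\circ^{j-i+1}_\mu h)$ if $i\le j<i+m$; - $f^\sigma\circ^i_\lambda g^\tau=(f\circ^{\sigma(i)}_\lambda g)^{\sigma\circ_i\tau}$, where $\sigma\circ_i\tau\in S_{n+m-1}$ acts on $v_1\otimes\cdots\otimes v_{n+m-1}$ by first applying $\tau$ to $v_i\otimes\cdots\otimes v_{i+m-1}$ and then $\sigma$ to the result viewed as a tensor product of $n$ factors ($\sigma$ acting on tensors by $\sigma(v_1\otimes\cdots\otimes v_n)=\pm v_{\sigma^{-1}(1)}\otimes\cdots\otimes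 v_{\sigma^{-1}(n)}$, Koszul sign); and such that each $\widetilde{\mathscr P}(n)=\varprojlim\widetilde{\mathscr P}_q(n)$ is the projective limit of a projective system $(\widetilde{\mathscr P}_q(n))_{q\ge0}$ in the category of superspaces with commuting parity preserving left $\mathbb F[\partial]$- and right $S_n$-actions (morphisms: parity preserving equivariant linear maps), and $\pi_q(f\circ^i_\lambda g)\in\widetilde{\mathscr P}_q(m+n-1)[\lambda]$ for all $q,i,f,g$. *)

theory Defs
  imports
    Complex_Main
    "HOL-Library.Z2"
    "HOL-Library.FuncSet"
    "HOL-Library.Function_Algebras"
    "HOL-Library.Poly_Mapping"
    "HOL-Combinatorics.Permutations"
begin

section \<open>Superspaces with an even endomorphism and an action of a symmetric group\<close>

text \<open>
  The parity group \<open>\<int>/2\<int>\<close> is the type \<^typ>\<open>bit\<close>. A superspace is carried by a subspace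
  \<open>carr X = part X 0 \<oplus> part X 1\<close> of a vector space whose vectors form a whole type.
  The symmetric group \<open>S_n\<close> is \<open>{\<sigma>. \<sigma> permutes {1..n}}\<close>; \<open>act X x \<sigma>\<close> stands for \<open>x\<^sup>\<sigma>\<close>.
\<close>

record ('k, 'a) d_space =
  smult :: "'k \<Rightarrow> 'a \<Rightarrow> 'a"
  carr :: "'a set"
  part :: "bit \<Rightarrow> 'a set"
  der :: "'a \<Rightarrow> 'a"

record ('k, 'a) dS_space = "('k, 'a) d_space" +
  act :: "'a \<Rightarrow> (nat \<Rightarrow> nat) \<Rightarrow> 'a"

definition superspace :: "('k::field, 'a::ab_group_add, 'z) d_space_scheme \<Rightarrow> bool" where
  "superspace X \<longleftrightarrow>
     vector_space (smult X) \<and>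
     (\<forall>a. module.subspace (smult X) (part X a)) \<and>
     part X 0 \<inter> part X 1 = {0} \<and>
     carr X = {x + y | x y. x \<in> part X 0 \<and> y \<in> part X 1}"

definition linear_between ::
  "('k::field, 'a::ab_group_add, 'z) d_space_scheme \<Rightarrow> ('k, 'b::ab_group_add, 'y) d_space_scheme \<Rightarrow>
   ('a \<Rightarrow> 'b) \<Rightarrow> bool" where
  "linear_between X Y h \<longleftrightarrow>
     (\<forall>x\<in>carr X. h x \<in> carr Y) \<and>
     (\<forall>x\<in>carr X. \<forall>y\<in>carr X. h (x + y) = h x + h y) \<and>
     (\<forall>c. \<forall>x\<in>carr X. h (smult X c x) = smult Y c (h x))"

definition even_linear ::
  "('k::field, 'a::ab_group_add, 'z) d_space_scheme \<Rightarrow> ('k, 'b::ab_group_add, 'y) d_space_scheme \<Rightarrow>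
   ('a \<Rightarrow> 'b) \<Rightarrow> bool" where
  "even_linear X Y h \<longleftrightarrow>
     linear_between X Y h \<and> (\<forall>a. \<forall>x\<in>part X a. h x \<in> part Y a)"

definition d_superspace :: "('k::field, 'a::ab_group_add, 'z) d_space_scheme \<Rightarrow> bool" where
  "d_superspace X \<longleftrightarrow> superspace X \<and> even_linear X X (der X)"

text \<open>Superspaces with commuting parity preserving left \<open>\<F>[\<partial>]\<close>- and right \<open>S_n\<close>-actions.\<close>

definition dS_superspace :: "nat \<Rightarrow> ('k::field, 'a::ab_group_add) dS_space \<Rightarrow> bool" where
  "dS_superspace n X \<longleftrightarrow>
     d_superspace X \<and>
     (\<forall>\<sigma>. \<sigma> permutes {1..n} \<longrightarrow> even_linear X X (\<lambda>x. act X x \<sigma>)) \<and>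
     (\<forall>x\<in>carr X. act X x id = x) \<and>
     (\<forall>x\<in>carr X. \<forall>\<sigma> \<tau>. \<sigma> permutes {1..n} \<longrightarrow> \<tau> permutes {1..n} \<longrightarrow>
        act X (act X x \<sigma>) \<tau> = act X x (\<sigma> \<circ> \<tau>)) \<and>
     (\<forall>x\<in>carr X. \<forall>\<sigma>. \<sigma> permutes {1..n} \<longrightarrow> act X (der X x) \<sigma> = der X (act X x \<sigma>))"

definition dS_morphism ::
  "nat \<Rightarrow> ('k::field, 'a::ab_group_add) dS_space \<Rightarrow> ('k, 'b::ab_group_add) dS_space \<Rightarrow>
   ('a \<Rightarrow> 'b) \<Rightarrow> bool" where
  "dS_morphism n X Y h \<longleftrightarrow>
     even_linear X Y h \<and>
     (\<forall>x\<in>carr X. h (der X x) = der Y (h x)) \<and>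
     (\<forall>x\<in>carr X. \<forall>\<sigma>. \<sigma> permutes {1..n} \<longrightarrow> h (act X x \<sigma>) = act Y (h x) \<sigma>)"


section \<open>Projective limits\<close>

text \<open>\<open>t q\<close> is the transition map from \<open>Q (Suc q)\<close> to \<open>Q q\<close>.\<close>

definition projective_system ::
  "nat \<Rightarrow> (nat \<Rightarrow> ('k::field, 'r::ab_group_add) dS_space) \<Rightarrow> (nat \<Rightarrow> 'r \<Rightarrow> 'r) \<Rightarrow> bool" where
  "projective_system n Q t \<longleftrightarrow>
     (\<forall>q. dS_superspace n (Q q)) \<and> (\<forall>q. dS_morphism n (Q (Suc q)) (Q q) (t q))"

definition projective_cone ::
  "nat \<Rightarrow> (nat \<Rightarrow> ('k::field, 'r::ab_group_add) dS_space) \<Rightarrow> (nat \<Rightarrow> 'r \<Rightarrow> 'r) \<Rightarrow>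
   ('k, 'a::ab_group_add) dS_space \<Rightarrow> (nat \<Rightarrow> 'a \<Rightarrow> 'r) \<Rightarrow> bool" where
  "projective_cone n Q t X \<phi> \<longleftrightarrow>
     dS_superspace n X \<and>
     (\<forall>q. dS_morphism n X (Q q) (\<phi> q)) \<and>
     (\<forall>q. \<forall>x\<in>carr X. t q (\<phi> (Suc q) x) = \<phi> q x)"

text \<open>
  The universal property quantifies over all objects of the category. A quantifier over types
  is not available inside a definition, so the type \<open>'w\<close> of the test objects is a parameter; in a
  theorem in which \<open>'w\<close> is a free type variable the test objects are arbitrary.
\<close>

definition is_projective_limit ::
  "'w::ab_group_add itself \<Rightarrow> nat \<Rightarrow> (nat \<Rightarrow> ('k::field, 'r::ab_group_add) dS_space) \<Rightarrow> (nat \<Rightarrow> 'r \<Rightarrow> 'r) \<Rightarrow>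
   ('k, 'p::ab_group_add) dS_space \<Rightarrow> (nat \<Rightarrow> 'p \<Rightarrow> 'r) \<Rightarrow> bool" where
  "is_projective_limit (_ :: 'w itself) n Q t P \<pi> \<longleftrightarrow>
     projective_cone n Q t P \<pi> \<and>
     (\<forall>(W :: ('k, 'w) dS_space) \<phi>. projective_cone n Q t W \<phi> \<longrightarrow>
        (\<exists>h. dS_morphism n W P h \<and> (\<forall>q. \<forall>x\<in>carr W. \<pi> q (h x) = \<phi> q x) \<and>
             (\<forall>h'. dS_morphism n W P h' \<and> (\<forall>q. \<forall>x\<in>carr W. \<pi> q (h' x) = \<phi> q x) \<longrightarrow>
                (\<forall>x\<in>carr W. h' x = h x))))"


section \<open>Pro-conformal pseudo operads\<close>

definition parity_sign :: "bit \<Rightarrow> 'k::field" where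
  "parity_sign a = (if a = 0 then 1 else - 1)"

text \<open>
  \<open>block_perm m i \<sigma>\<close> permutes blocks by \<open>\<sigma>\<close>, the \<open>i\<close>-th block having length \<open>m\<close> and the others
  length \<open>1\<close>. A permutation \<open>\<rho>\<close> acts on tensors by moving the factor in position \<open>k\<close> to position
  \<open>\<rho> k\<close>; hence \<open>perm_comp m i \<sigma> \<tau>\<close>, for \<open>\<sigma> \<in> S_n\<close> and \<open>\<tau> \<in> S_m\<close>, is \<open>\<sigma> \<circ>\<^sub>i \<tau> \<in> S_(n+m-1)\<close>.
\<close>

definition block_perm :: "nat \<Rightarrow> nat \<Rightarrow> (nat \<Rightarrow> nat) \<Rightarrow> nat \<Rightarrow> nat" where
  "block_perm m i \<sigma> k =
     (if i \<le> k \<and> k < i + m then \<sigma> i + (k - i)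
      else let b = (if k < i then k else k + 1 - m)
           in if \<sigma> b < \<sigma> i then \<sigma> b else \<sigma> b + m - 1)"

definition inner_perm :: "nat \<Rightarrow> nat \<Rightarrow> (nat \<Rightarrow> nat) \<Rightarrow> nat \<Rightarrow> nat" where
  "inner_perm m i \<tau> k = (if i \<le> k \<and> k < i + m then i + \<tau> (k + 1 - i) - 1 else k)"

definition perm_comp :: "nat \<Rightarrow> nat \<Rightarrow> (nat \<Rightarrow> nat) \<Rightarrow> (nat \<Rightarrow> nat) \<Rightarrow> nat \<Rightarrow> nat" where
  "perm_comp m i \<sigma> \<tau> = block_perm m i \<sigma> \<circ> inner_perm m i \<tau>"

text \<open>
  \<open>pr n m i f g k\<close> is the coefficient of \<open>\<lambda>^k\<close> in \<open>f \<circ>\<^sup>i\<^sub>\<lambda> g\<close>, for \<open>f \<in> P n\<close>, \<open>g \<in> P m\<close>. The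
  identities between power series are written coefficientwise: those of sesquilinearity and
  equivariance at \<open>\<lambda>^k\<close>, those of associativity at \<open>\<lambda>^a \<mu>^b\<close>. In the nested associativity identity
  the coefficient of \<open>\<lambda>^a \<mu>^(b-s)\<close> in \<open>(\<lambda>+\<mu>)^r\<close>, \<open>r = a+b-s\<close>, is a binomial coefficient.
\<close>

definition series_times_var :: "(nat \<Rightarrow> 'a::zero) \<Rightarrow> nat \<Rightarrow> 'a" where
  "series_times_var u k = (if k = 0 then 0 else u (k - 1))"

definition pro_conformal_pseudo_operad ::
  "'w::ab_group_add itself \<Rightarrow>
   (nat \<Rightarrow> ('k::field, 'p::ab_group_add) dS_space) \<Rightarrow>
   (nat \<Rightarrow> nat \<Rightarrow> nat \<Rightarrow> 'p \<Rightarrow> 'p \<Rightarrow> nat \<Rightarrow> 'p) \<Rightarrow>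
   (nat \<Rightarrow> nat \<Rightarrow> ('k, 'r::ab_group_add) dS_space) \<Rightarrow>
   (nat \<Rightarrow> nat \<Rightarrow> 'r \<Rightarrow> 'r) \<Rightarrow>
   (nat \<Rightarrow> nat \<Rightarrow> 'p \<Rightarrow> 'r) \<Rightarrow> bool" where
  "pro_conformal_pseudo_operad W P pr Q t \<pi> \<longleftrightarrow>
     (\<comment> \<open>superspaces with commuting actions\<close>
      \<forall>n. dS_superspace n (P n)) \<and>
     (\<comment> \<open>the products are bilinear and parity preserving\<close>
      \<forall>n m i k. 1 \<le> i \<and> i \<le> n \<longrightarrow>
        (\<forall>f\<in>carr (P n). linear_between (P m) (P (m + n - 1)) (\<lambda>g. pr n m i f g k)) \<and>
        (\<forall>g\<in>carr (P m). linear_between (P n) (P (m + n - 1)) (\<lambda>f. pr n m i f g k)) \<and>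
        (\<forall>a b. \<forall>f\<in>part (P n) a. \<forall>g\<in>part (P m) b.
           pr n m i f g k \<in> part (P (m + n - 1)) (a + b))) \<and>
     (\<comment> \<open>sesquilinearity\<close>
      \<forall>n m i k. 1 \<le> i \<and> i \<le> n \<longrightarrow>
        (\<forall>f\<in>carr (P n). \<forall>g\<in>carr (P m).
           pr n m i (der (P n) f) g k =
             series_times_var (pr n m i f g) k + der (P (m + n - 1)) (pr n m i f g k) \<and>
           pr n m i f (der (P m) g) k = - series_times_var (pr n m i f g) k)) \<and>
     (\<comment> \<open>associativity, disjoint case\<close>
      \<forall>n m l i j a b. 1 \<le> j \<and> j < i \<and> i \<le> n \<longrightarrow>
        (\<forall>c d. \<forall>f\<in>carr (P n). \<forall>g\<in>part (P m) c. \<forall>h\<in>part (P l) d.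
           pr (m + n - 1) l j (pr n m i f g a) h b =
             smult (P (m + n - 1 + l - 1)) (parity_sign (c * d))
               (pr (l + n - 1) m (l + i - 1) (pr n l j f h b) g a))) \<and>
     (\<comment> \<open>associativity, nested case\<close>
      \<forall>n m l i j a b. 1 \<le> i \<and> i \<le> n \<and> i \<le> j \<and> j < i + m \<longrightarrow>
        (\<forall>f\<in>carr (P n). \<forall>g\<in>carr (P m). \<forall>h\<in>carr (P l).
           pr (m + n - 1) l j (pr n m i f g a) h b =
             (\<Sum>s\<le>b. smult (P (m + n - 1 + l - 1)) (of_nat ((a + b - s) choose a))
                (pr n (l + m - 1) i f (pr m l (j - i + 1) g h s) (a + b - s))))) \<and>
     (\<comment> \<open>equivariance\<close>
      \<forall>n m i k \<sigma> \<tau>. 1 \<le> i \<and> i \<le> n \<and> \<sigma> permutes {1..n} \<and> \<tau> permutes {1..m} \<longrightarrow>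
        (\<forall>f\<in>carr (P n). \<forall>g\<in>carr (P m).
           pr n m i (act (P n) f \<sigma>) (act (P m) g \<tau>) k =
             act (P (m + n - 1)) (pr n m (\<sigma> i) f g k) (perm_comp m i \<sigma> \<tau>))) \<and>
     (\<comment> \<open>projective limits\<close>
      \<forall>n. projective_system n (\<lambda>q. Q q n) (\<lambda>q. t q n) \<and>
          is_projective_limit W n (\<lambda>q. Q q n) (\<lambda>q. t q n) (P n) (\<lambda>q. \<pi> q n)) \<and>
     (\<comment> \<open>the products become polynomial in the variable at each finite level\<close>
      \<forall>n m i q. 1 \<le> i \<and> i \<le> n \<longrightarrow>
        (\<forall>f\<in>carr (P n). \<forall>g\<in>carr (P m). finite {k. \<pi> q (m + n - 1) (pr n m i f g k) \<noteq> 0}))"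


section \<open>Polynomials with coefficients in a vector space\<close>

text \<open>
  A polynomial is a finitely supported function on exponent vectors, which are themselves finitely
  supported functions from variable indices. The variables \<open>\<lambda>\<^sub>j\<close>, \<open>\<mu>\<^sub>j\<close> have index \<open>j \<ge> 1\<close>; the
  distinguished variable \<open>\<lambda>\<close> of the products has index \<open>0\<close>.
\<close>

type_synonym 'a mpol = "(nat \<Rightarrow>\<^sub>0 nat) \<Rightarrow>\<^sub>0 'a"

definition var :: "nat \<Rightarrow> 'k::field mpol" where
  "var j = Poly_Mapping.single (Poly_Mapping.single j 1) 1"

definition pol_smult ::
  "('k::field \<Rightarrow> 'v::ab_group_add \<Rightarrow> 'v) \<Rightarrow> 'k mpol \<Rightarrow> 'v mpol \<Rightarrow> 'v mpol" where
  "pol_smult sc c p =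
     (\<Sum>s\<in>Poly_Mapping.keys c. \<Sum>t\<in>Poly_Mapping.keys p.
        Poly_Mapping.single (s + t) (sc (Poly_Mapping.lookup c s) (Poly_Mapping.lookup p t)))"

definition pol_subst ::
  "('k::field \<Rightarrow> 'v::ab_group_add \<Rightarrow> 'v) \<Rightarrow> (nat \<Rightarrow> 'k mpol) \<Rightarrow> 'v mpol \<Rightarrow> 'v mpol" where
  "pol_subst sc L p =
     (\<Sum>t\<in>Poly_Mapping.keys p.
        pol_smult sc (\<Prod>j\<in>Poly_Mapping.keys t. L j ^ Poly_Mapping.lookup t j)
          (Poly_Mapping.single 0 (Poly_Mapping.lookup p t)))"

text \<open>The extension of a linear map \<open>\<phi>\<close> on the coefficients to a map linear over the polynomial ring.\<close>

definition pol_extend ::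
  "('k::field \<Rightarrow> 'v::ab_group_add \<Rightarrow> 'v) \<Rightarrow> ('v \<Rightarrow> 'v mpol) \<Rightarrow> 'v mpol \<Rightarrow> 'v mpol" where
  "pol_extend sc \<phi> p =
     (\<Sum>t\<in>Poly_Mapping.keys p.
        pol_smult sc (Poly_Mapping.single t 1) (\<phi> (Poly_Mapping.lookup p t)))"

text \<open>The coefficient of \<open>\<lambda>^k\<close>, a polynomial in the remaining variables.\<close>

definition var0_coeff :: "nat \<Rightarrow> 'v::ab_group_add mpol \<Rightarrow> 'v mpol" where
  "var0_coeff k p =
     (\<Sum>t\<in>{t \<in> Poly_Mapping.keys p. Poly_Mapping.lookup t 0 = k}.
        Poly_Mapping.single (t - Poly_Mapping.single 0 k) (Poly_Mapping.lookup p t))"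


section \<open>The spaces of sesquilinear maps\<close>

definition parity_reversal :: "('k, 'v) d_space \<Rightarrow> ('k, 'v) d_space" where
  "parity_reversal V = V\<lparr>part := (\<lambda>a. part V (1 - a))\<rparr>"

text \<open>The component of parity \<open>a\<close> of a vector.\<close>

definition hcomp :: "('k, 'a::ab_group_add, 'z) d_space_scheme \<Rightarrow> bit \<Rightarrow> 'a \<Rightarrow> 'a" where
  "hcomp X a x = (THE y. y \<in> part X a \<and> x - y \<in> part X (1 - a))"

text \<open>
  Below \<open>A\<close> is a superspace with even endomorphism whose carrier is the whole type (it is \<open>\<Pi>V\<close> in the
  end) and \<open>U\<close> is a graded submodule. A linear map \<open>U\<^bsup>\<otimes>n\<^esup> \<rightarrow> A[\<lambda>\<^sub>1,\<dots>,\<lambda>\<^sub>n]\<close> is encoded as the corresponding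
  multilinear map in \<open>v\<^sub>1,\<dots>,v\<^sub>n\<close>. Its argument is a sequence \<open>v :: nat \<Rightarrow> 'v\<close> of which only the entries
  \<open>v 1,\<dots>,v n\<close> matter; outside \<open>U\<close> the value is \<open>0\<close>, so that equality of maps is equality of functions.
  Vector space operations on such maps are pointwise.
\<close>

definition args_in :: "'v set \<Rightarrow> nat \<Rightarrow> (nat \<Rightarrow> 'v) \<Rightarrow> bool" where
  "args_in U n v \<longleftrightarrow> (\<forall>j\<in>{1..n}. v j \<in> U)"

definition restrict_to ::
  "'v set \<Rightarrow> nat \<Rightarrow> ((nat \<Rightarrow> 'v::ab_group_add) \<Rightarrow> 'v mpol) \<Rightarrow> (nat \<Rightarrow> 'v) \<Rightarrow> 'v mpol" where
  "restrict_to U n f v = (if args_in U n v then f v else 0)"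

definition chom_carr ::
  "('k::field, 'v::ab_group_add) d_space \<Rightarrow> 'v set \<Rightarrow> nat \<Rightarrow> ((nat \<Rightarrow> 'v) \<Rightarrow> 'v mpol) set" where
  "chom_carr A U n = {f.
     (\<forall>u v. (\<forall>j\<in>{1..n}. u j = v j) \<longrightarrow> f u = f v) \<and>
     (\<forall>v. \<not> args_in U n v \<longrightarrow> f v = 0) \<and>
     (\<forall>v. \<forall>t\<in>Poly_Mapping.keys (f v). Poly_Mapping.keys t \<subseteq> {1..n}) \<and>
     (\<forall>v. args_in U n v \<longrightarrow> (\<forall>i\<in>{1..n}.
        (\<forall>x\<in>U. \<forall>y\<in>U. f (v(i := x + y)) = f (v(i := x)) + f (v(i := y))) \<and>
        (\<forall>c. \<forall>x\<in>U. f (v(i := smult A c x)) = Poly_Mapping.map (smult A c) (f (v(i := x)))) \<and>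
        f (v(i := der A (v i))) = - pol_smult (smult A) (var i) (f v)))}"

definition chom_part ::
  "('k::field, 'v::ab_group_add) d_space \<Rightarrow> 'v set \<Rightarrow> nat \<Rightarrow> bit \<Rightarrow> ((nat \<Rightarrow> 'v) \<Rightarrow> 'v mpol) set" where
  "chom_part A U n a = {f \<in> chom_carr A U n.
     \<forall>d v. (\<forall>j\<in>{1..n}. v j \<in> U \<inter> part A (d j)) \<longrightarrow>
       (\<forall>t. Poly_Mapping.lookup (f v) t \<in> part A (a + (\<Sum>j\<in>{1..n}. d j)))}"

definition chom_der ::
  "('k::field, 'v::ab_group_add) d_space \<Rightarrow> nat \<Rightarrow>
   ((nat \<Rightarrow> 'v) \<Rightarrow> 'v mpol) \<Rightarrow> (nat \<Rightarrow> 'v) \<Rightarrow> 'v mpol" where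
  "chom_der A n f v =
     Poly_Mapping.map (der A) (f v) + (\<Sum>j\<in>{1..n}. pol_smult (smult A) (var j) (f v))"

text \<open>
  The formulas for the \<open>S_n\<close>-action and for the products involve the parities of the arguments and of
  \<open>g\<close>. They are prescribed on homogeneous elements and extended multilinearly by summing over the
  homogeneous components; \<open>d j\<close> is the parity of the component of \<open>v j\<close>, and \<open>e\<close> that of \<open>g\<close>.
\<close>

definition koszul_sign :: "nat \<Rightarrow> (nat \<Rightarrow> bit) \<Rightarrow> (nat \<Rightarrow> nat) \<Rightarrow> 'k::field" where
  "koszul_sign n d \<sigma> =
     (\<Prod>(i, j)\<in>{(i, j). 1 \<le> i \<and> i < j \<and> j \<le> n \<and> \<sigma> j < \<sigma> i}. parity_sign (d i * d j))"

definition chom_act ::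
  "('k::field, 'v::ab_group_add) d_space \<Rightarrow> 'v set \<Rightarrow> nat \<Rightarrow>
   ((nat \<Rightarrow> 'v) \<Rightarrow> 'v mpol) \<Rightarrow> (nat \<Rightarrow> nat) \<Rightarrow> (nat \<Rightarrow> 'v) \<Rightarrow> 'v mpol" where
  "chom_act A U n f \<sigma> = restrict_to U n (\<lambda>v.
     \<Sum>d\<in>{1..n} \<rightarrow>\<^sub>E {0, 1}.
       let w = (\<lambda>j. hcomp A (d j) (v j))
       in Poly_Mapping.map (smult A (koszul_sign n d \<sigma>))
            (pol_subst (smult A) (\<lambda>j. var (inv \<sigma> j)) (f (\<lambda>j. w (inv \<sigma> j)))))"

definition chom ::
  "('k::field, 'v::ab_group_add) d_space \<Rightarrow> 'v set \<Rightarrow> nat \<Rightarrow>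
   ('k, (nat \<Rightarrow> 'v) \<Rightarrow> 'v mpol) dS_space" where
  "chom A U n =
     \<lparr>smult = (\<lambda>c f v. Poly_Mapping.map (smult A c) (f v)),
      carr = chom_carr A U n,
      part = chom_part A U n,
      der = chom_der A n,
      act = chom_act A U n\<rparr>"

text \<open>
  \<open>chom_insert A i m f g w\<close> is, without sign,
  \<open>f\<^bsub>\<mu>\<^sub>1,\<dots>,\<mu>\<^bsub>i-1\<^esub>,\<lambda>+\<mu>\<^sub>i+\<dots>+\<mu>\<^bsub>i+m-1\<^esub>,\<mu>\<^bsub>i+m\<^esub>,\<dots>\<^esub>(w\<^sub>1 \<otimes> \<dots> \<otimes> g\<^bsub>\<mu>\<^sub>i,\<dots>,\<mu>\<^bsub>i+m-1\<^esub>\<^esub>(w\<^sub>i \<otimes> \<dots> \<otimes> w\<^bsub>i+m-1\<^esub>) \<otimes> w\<^bsub>i+m\<^esub> \<otimes> \<dots>)\<close>.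
\<close>

definition chom_insert ::
  "('k::field, 'v::ab_group_add) d_space \<Rightarrow> nat \<Rightarrow> nat \<Rightarrow>
   ((nat \<Rightarrow> 'v) \<Rightarrow> 'v mpol) \<Rightarrow> ((nat \<Rightarrow> 'v) \<Rightarrow> 'v mpol) \<Rightarrow> (nat \<Rightarrow> 'v) \<Rightarrow> 'v mpol" where
  "chom_insert A i m f g w =
     pol_extend (smult A)
       (\<lambda>x. pol_subst (smult A)
              (\<lambda>j. if j < i then var j
                   else if j = i then var 0 + (\<Sum>s\<in>{i..<i + m}. var s)
                   else var (j + m - 1))
              (f (\<lambda>j. if j < i then w j else if j = i then x else w (j + m - 1))))
       (pol_subst (smult A) (\<lambda>j. var (j + i - 1)) (g (\<lambda>j. w (j + i - 1))))"

definition chom_prod ::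
  "('k::field, 'v::ab_group_add) d_space \<Rightarrow> nat \<Rightarrow> nat \<Rightarrow> nat \<Rightarrow>
   ((nat \<Rightarrow> 'v) \<Rightarrow> 'v mpol) \<Rightarrow> ((nat \<Rightarrow> 'v) \<Rightarrow> 'v mpol) \<Rightarrow> nat \<Rightarrow> (nat \<Rightarrow> 'v) \<Rightarrow> 'v mpol" where
  "chom_prod A n m i f g k v =
     (\<Sum>e\<in>{0, 1}. \<Sum>d\<in>{1..m + n - 1} \<rightarrow>\<^sub>E {0, 1}.
        Poly_Mapping.map (smult A (parity_sign (e * (\<Sum>j\<in>{1..<i}. d j))))
          (var0_coeff k
            (chom_insert A i m f (hcomp (chom A UNIV m) e g) (\<lambda>j. hcomp A (d j) (v j)))))"


section \<open>Filtrations\<close>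

definition finite_rank_filtration ::
  "('k::field, 'v::ab_group_add) d_space \<Rightarrow> (nat \<Rightarrow> 'v set) \<Rightarrow> bool" where
  "finite_rank_filtration V F \<longleftrightarrow>
     F 0 = {0} \<and>
     (\<forall>q. F q \<subseteq> F (Suc q)) \<and>
     (\<Union>q. F q) = carr V \<and>
     (\<forall>q. module.subspace (smult V) (F q) \<and>
          (\<forall>x\<in>F q. der V x \<in> F q) \<and>
          (\<exists>S. finite S \<and> F q = module.span (smult V) {(der V ^^ k) s | k s. s \<in> S}) \<and>
          F q = {x + y | x y. x \<in> F q \<inter> part V 0 \<and> y \<in> F q \<inter> part V 1})"

end

theory Submission
  imports Defs
begin

text \<open>
  Up to signs and variables, each axiom is a familiar property of the composition of multilinear maps.
  The difficulty is bookkeeping: polynomials in the variables \<open>\<lambda>\<^sub>1, \<dots>, \<lambda>\<^sub>n\<close> with vector coefficients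
  get substituted into each other, Koszul signs depend on the parities of the arguments, and the
  products are power series. Three reductions make every axiom a short computation.

  First, the field is infinite, so a polynomial with coefficients in a vector space is determined
  by its values at points (\<open>monomials_independent\<close>, \<open>mpol_eqI\<close>). After evaluation at a point
  \<open>a\<close>, a substitution of polynomials only moves the point, and a map in \<open>Chom(n)\<close> becomes a family of
  multilinear maps \<open>\<Phi> : \<Pi>V\<^sup>n \<rightarrow> \<Pi>V\<close>, one for each \<open>a\<close>, with \<open>\<Phi>(\<dots>, \<partial>v\<^sub>i, \<dots>) = - a\<^sub>i \<Phi>(v)\<close>. This is the predicate
  \<open>sesqui\<close>, and \<open>chom_carr_iff\<close> is the translation.

  Second, a multilinear map is determined by its values on homogeneous arguments (\<open>chom_eqI\<close>), and
  there the sum over homogeneous components that encodes the signs has a single nonzero term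
  (\<open>polarize_homog\<close>). On such arguments the action and the products are given by the formulas of the
  definition, with an explicit sign.

  Third, an identity between coefficients of powers of \<open>\<lambda>\<close> and \<open>\<mu>\<close> follows from the identity between
  the polynomial functions of \<open>\<lambda>\<close> and \<open>\<mu>\<close> that have these coefficients, because such a function has
  only one sequence of coefficients (\<open>power_coeffs_unique\<close>, \<open>double_coeffs_unique\<close>). By
  \<open>prod_coeffs_homog\<close> the function belonging to \<open>f \<circ>\<^sup>i\<^sub>\<lambda> g\<close> is, up to a sign,
  \<open>f(v\<^sub>1, \<dots>, g(\<dots>), \<dots>)\<close> evaluated at the point with \<open>i\<close>-th coordinate \<open>\<lambda> + \<mu>\<^sub>i + \<dots> + \<mu>\<^sub>i\<^sub>+\<^sub>m\<^sub>-\<^sub>1\<close>.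

  With these reductions, sesquilinearity of the products follows from the sesquilinearity of \<open>f\<close> in its
  \<open>i\<close>-th argument and from the sum of the coordinates of the point, the associativity laws say that successive insertions can be reordered or regrouped
  (\<open>insert_eval_commute\<close>, \<open>insert_eval_nested\<close>), the binomial coefficients of the nested law coming
  from the substitution \<open>\<lambda> + \<mu>\<close>, and equivariance becomes an identity modulo 2 between sums over
  inversions (\<open>inversion_sum_perm_comp\<close>). The limit property holds because every tuple of vectors
  lies in some step of the filtration, so that a compatible family of maps glues
  (\<open>chom_glue\<close>). Finally, on a step of the filtration a sesquilinear map is determined by its values on
  tuples of generators, of which there are finitely many; each involves finitely many powers of
  \<open>\<lambda>\<close>, whence polynomiality (\<open>finite_restrict_prod\<close>).
\<close>

text \<open>
  Addition and multiplication modulo 2 are kept as ring operations, so that ring laws apply to parities.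
\<close>

declare add_bit_eq_xor [simp del] mult_bit_eq_and [simp del]

section \<open>Evaluation of polynomials at points\<close>

definition monom_val :: "(nat \<Rightarrow> 'k::field) \<Rightarrow> (nat \<Rightarrow>\<^sub>0 nat) \<Rightarrow> 'k" where
  "monom_val a t = (\<Prod>j\<in>Poly_Mapping.keys t. a j ^ Poly_Mapping.lookup t j)"

lemma monom_val_superset:
  assumes "finite K" "Poly_Mapping.keys t \<subseteq> K"
  shows "monom_val a t = (\<Prod>j\<in>K. a j ^ Poly_Mapping.lookup t j)"
  unfolding monom_val_def
  by (rule prod.mono_neutral_left) (use assms in \<open>auto simp: in_keys_iff\<close>)

lemma monom_val_0 [simp]: "monom_val a 0 = 1"
  by (simp add: monom_val_def)

lemma monom_val_single [simp]: "monom_val a (Poly_Mapping.single j n) = a j ^ n"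
  by (subst monom_val_superset[of "{j}"]) auto

lemma monom_val_add: "monom_val a (s + t) = monom_val a s * monom_val a t"
proof -
  let ?K = "Poly_Mapping.keys s \<union> Poly_Mapping.keys t"
  show ?thesis
    using monom_val_superset[of ?K "s + t" a] monom_val_superset[of ?K s a]
      monom_val_superset[of ?K t a] Poly_Mapping.keys_add[of s t]
    by (simp add: lookup_add power_add prod.distrib)
qed

lemma monom_val_mult: "monom_val (\<lambda>j. a j * b j) t = monom_val a t * monom_val b t"
  by (simp add: monom_val_def power_mult_distrib prod.distrib)

lemma monom_val_cong:
  "(\<And>j. j \<in> Poly_Mapping.keys t \<Longrightarrow> a j = b j) \<Longrightarrow> monom_val a t = monom_val b t"
  unfolding monom_val_def by (intro prod.cong) auto

lemma monom_val_eq_0: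
  "j \<in> Poly_Mapping.keys t \<Longrightarrow> a j = 0 \<Longrightarrow> monom_val a t = 0"
  unfolding monom_val_def by (rule prod_zero) (auto simp: in_keys_iff intro!: bexI[of _ j])

definition pol_val :: "(nat \<Rightarrow> 'k::field) \<Rightarrow> 'k mpol \<Rightarrow> 'k" where
  "pol_val a c = (\<Sum>s\<in>Poly_Mapping.keys c. monom_val a s * Poly_Mapping.lookup c s)"

lemma pol_val_superset:
  assumes "finite K" "Poly_Mapping.keys c \<subseteq> K"
  shows "pol_val a c = (\<Sum>s\<in>K. monom_val a s * Poly_Mapping.lookup c s)"
  unfolding pol_val_def
  by (rule sum.mono_neutral_left) (use assms in \<open>auto simp: in_keys_iff\<close>)

lemma pol_val_single [simp]: "pol_val a (Poly_Mapping.single t c) = monom_val a t * c"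
  by (subst pol_val_superset[of "{t}"]) auto

lemma pol_val_add [simp]: "pol_val a (c + d) = pol_val a c + pol_val a d"
proof -
  let ?K = "Poly_Mapping.keys c \<union> Poly_Mapping.keys d"
  show ?thesis
    using pol_val_superset[of ?K "c + d" a] pol_val_superset[of ?K c a]
      pol_val_superset[of ?K d a] Poly_Mapping.keys_add[of c d]
    by (simp add: lookup_add ring_distribs sum.distrib)
qed

lemma pol_val_0 [simp]: "pol_val a 0 = 0"
  by (simp add: pol_val_def)

lemma pol_val_sum [simp]: "pol_val a (\<Sum>i\<in>I. c i) = (\<Sum>i\<in>I. pol_val a (c i))"
  by (induction I rule: infinite_finite_induct) auto

lemma pol_val_1 [simp]: "pol_val a 1 = 1"
  using pol_val_single[of a 0 1] by simp

lemma poly_mapping_as_sum: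
  "p = (\<Sum>t\<in>Poly_Mapping.keys p. Poly_Mapping.single t (Poly_Mapping.lookup p t))"
  by (rule poly_mapping_eqI) (auto simp: lookup_sum lookup_single when_def in_keys_iff)

lemma pol_val_mult [simp]: "pol_val a (c * d) = pol_val a c * pol_val a d"
proof -
  have "c * d = (\<Sum>s\<in>Poly_Mapping.keys c. \<Sum>t\<in>Poly_Mapping.keys d.
      Poly_Mapping.single (s + t) (Poly_Mapping.lookup c s * Poly_Mapping.lookup d t))"
    by (subst poly_mapping_as_sum[of c], subst poly_mapping_as_sum[of d])
       (simp add: sum_product mult_single)
  then have "pol_val a (c * d) = (\<Sum>s\<in>Poly_Mapping.keys c. \<Sum>t\<in>Poly_Mapping.keys d.
      (monom_val a s * Poly_Mapping.lookup c s) * (monom_val a t * Poly_Mapping.lookup d t))"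
    by (simp add: monom_val_add mult_ac)
  then show ?thesis
    by (simp add: pol_val_def sum_product)
qed

lemma pol_val_power [simp]: "pol_val a (c ^ n) = pol_val a c ^ n"
  by (induction n) auto

lemma pol_val_prod [simp]: "pol_val a (\<Prod>i\<in>I. c i) = (\<Prod>i\<in>I. pol_val a (c i))"
  by (induction I rule: infinite_finite_induct) auto

lemma pol_val_var [simp]: "pol_val a (var j) = a j"
  by (simp add: var_def)

lemma lookup_map_zero:
  "h 0 = 0 \<Longrightarrow> Poly_Mapping.lookup (Poly_Mapping.map h p) t = h (Poly_Mapping.lookup p t)"
  by (simp add: Poly_Mapping.map.rep_eq when_def)

locale vector_space_char_0 = vector_space scale
  for scale :: "'k::field_char_0 \<Rightarrow> 'v::ab_group_add \<Rightarrow> 'v" (infixr \<open>*s\<close> 75)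
begin

definition eval :: "(nat \<Rightarrow> 'k) \<Rightarrow> 'v mpol \<Rightarrow> 'v" where
  "eval a p = (\<Sum>t\<in>Poly_Mapping.keys p. monom_val a t *s Poly_Mapping.lookup p t)"

lemma eval_superset:
  assumes "finite K" "Poly_Mapping.keys p \<subseteq> K"
  shows "eval a p = (\<Sum>t\<in>K. monom_val a t *s Poly_Mapping.lookup p t)"
  unfolding eval_def
  by (rule sum.mono_neutral_left) (use assms in \<open>auto simp: in_keys_iff\<close>)

lemma eval_single [simp]: "eval a (Poly_Mapping.single t x) = monom_val a t *s x"
  by (subst eval_superset[of "{t}"]) auto

lemma eval_0 [simp]: "eval a 0 = 0"
  by (simp add: eval_def)

lemma eval_add [simp]: "eval a (p + q) = eval a p + eval a q"
proof -
  let ?K = "Poly_Mapping.keys p \<union> Poly_Mapping.keys q"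
  show ?thesis
    using eval_superset[of ?K "p + q" a] eval_superset[of ?K p a]
      eval_superset[of ?K q a] Poly_Mapping.keys_add[of p q]
    by (simp add: lookup_add scale_right_distrib sum.distrib)
qed

lemma eval_uminus [simp]: "eval a (- p) = - eval a p"
  using eval_add[of a p "- p"] by (simp add: eq_neg_iff_add_eq_0 add.commute)

lemma eval_diff [simp]: "eval a (p - q) = eval a p - eval a q"
  using eval_add[of a p "- q"] by simp

lemma eval_sum [simp]: "eval a (\<Sum>i\<in>I. p i) = (\<Sum>i\<in>I. eval a (p i))"
  by (induction I rule: infinite_finite_induct) auto

lemma eval_map:
  assumes "\<And>x y. h (x + y) = h x + h y" "\<And>c x. h (c *s x) = c *s h x"
  shows "eval a (Poly_Mapping.map h p) = h (eval a p)"
proof -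
  have h0: "h 0 = 0"
    using assms(1)[of 0 0] by simp
  have hsum: "h (\<Sum>t\<in>I. x t) = (\<Sum>t\<in>I. h (x t))" for I and x :: "(nat \<Rightarrow>\<^sub>0 nat) \<Rightarrow> 'v"
    by (induction I rule: infinite_finite_induct) (auto simp: h0 assms)
  have "Poly_Mapping.keys (Poly_Mapping.map h p) \<subseteq> Poly_Mapping.keys p"
    by (auto simp: in_keys_iff lookup_map_zero h0)
  then show ?thesis
    using eval_superset[of "Poly_Mapping.keys p" "Poly_Mapping.map h p" a]
    by (simp add: eval_def hsum assms lookup_map_zero h0)
qed

lemma eval_scale [simp]: "eval a (Poly_Mapping.map (scale c) p) = c *s eval a p"
  by (rule eval_map) (auto simp: scale_right_distrib)

lemma eval_pol_smult [simp]: "eval a (pol_smult scale c p) = pol_val a c *s eval a p"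
proof -
  have "eval a (pol_smult scale c p) =
      (\<Sum>s\<in>Poly_Mapping.keys c. (monom_val a s * Poly_Mapping.lookup c s) *s eval a p)"
    by (simp add: pol_smult_def) (simp add: eval_def monom_val_add scale_sum_right mult_ac)
  then show ?thesis
    by (simp add: pol_val_def scale_sum_left)
qed

lemma eval_pol_subst [simp]:
  "eval a (pol_subst scale L p) = eval (\<lambda>j. pol_val a (L j)) p"
  by (simp add: pol_subst_def) (simp add: eval_def monom_val_def)

text \<open>A polynomial whose coefficients are fed into a linear map may be evaluated before or after.\<close>

lemma eval_pol_extend:
  assumes add: "\<And>x y. eval a (\<phi> (x + y)) = eval a (\<phi> x) + eval a (\<phi> y)"
    and scale: "\<And>c x. eval a (\<phi> (c *s x)) = c *s eval a (\<phi> x)"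
  shows "eval a (pol_extend scale \<phi> p) = eval a (\<phi> (eval a p))"
proof -
  have zero: "eval a (\<phi> 0) = 0"
    using add[of 0 0] by simp
  have hsum: "eval a (\<phi> (\<Sum>t\<in>I. x t)) = (\<Sum>t\<in>I. eval a (\<phi> (x t)))"
    for I and x :: "(nat \<Rightarrow>\<^sub>0 nat) \<Rightarrow> 'v"
    by (induction I rule: infinite_finite_induct) (auto simp: zero add)
  show ?thesis
    by (subst (2) eval_def) (simp add: pol_extend_def hsum scale)
qed

text \<open>
  Distinct monomials are linearly independent functions of the point, also modulo a subspace. To
  remove one monomial \<open>s\<close> from a relation, compare the relation at the point \<open>a b\<close> with \<open>b\<^sup>s\<close> times
  the relation at \<open>a\<close>; in characteristic \<open>0\<close> the point \<open>b = (1, \<dots>, 1, 2, 1, \<dots>)\<close> separates two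
  exponent vectors that differ in the position of the entry \<open>2\<close>.
\<close>

lemma monomials_independent:
  assumes "subspace S" "finite K" "\<And>a. (\<Sum>t\<in>K. monom_val a t *s x t) \<in> S" "t \<in> K"
  shows "x t \<in> S"
  using assms(2-4)
proof (induction K arbitrary: x t rule: finite_induct)
  case empty
  then show ?case by simp
next
  case (insert s K)
  have two: "(2::'k) ^ m = 2 ^ n \<longleftrightarrow> m = n" for m n
  proof -
    have "(of_nat (2 ^ m) :: 'k) = of_nat (2 ^ n) \<longleftrightarrow> (2::nat) ^ m = 2 ^ n"
      by (rule of_nat_eq_iff)
    then show ?thesis by simp
  qed
  have step: "x t \<in> S" if t: "t \<in> K" for t
  proof -
    have "s \<noteq> t" using t insert.hyps by auto
    then obtain j where j: "Poly_Mapping.lookup s j \<noteq> Poly_Mapping.lookup t j"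
      by (meson poly_mapping_eqI)
    define b :: "nat \<Rightarrow> 'k" where "b = (\<lambda>i. if i = j then 2 else 1)"
    have b: "monom_val b u = 2 ^ Poly_Mapping.lookup u j" for u
      by (subst monom_val_superset[of "insert j (Poly_Mapping.keys u)"])
         (auto simp: b_def prod.insert_remove intro!: prod.neutral)
    have "(\<Sum>u\<in>K. monom_val a u *s ((monom_val b u - monom_val b s) *s x u)) \<in> S" for a
    proof -
      have "(\<Sum>u\<in>insert s K. monom_val (\<lambda>i. a i * b i) u *s x u) -
          monom_val b s *s (\<Sum>u\<in>insert s K. monom_val a u *s x u) \<in> S"
        using insert.prems(1) \<open>subspace S\<close> by (intro subspace_diff subspace_scale) auto
      also have "(\<Sum>u\<in>insert s K. monom_val (\<lambda>i. a i * b i) u *s x u) -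
          monom_val b s *s (\<Sum>u\<in>insert s K. monom_val a u *s x u) =
          (\<Sum>u\<in>insert s K. monom_val a u *s ((monom_val b u - monom_val b s) *s x u))"
        by (simp only: scale_sum_right sum_subtractf[symmetric] monom_val_mult)
           (simp add: scale_left_diff_distrib algebra_simps)
      finally show ?thesis
        using insert.hyps by simp
    qed
    then have "(monom_val b t - monom_val b s) *s x t \<in> S"
      using insert.IH[of "\<lambda>u. (monom_val b u - monom_val b s) *s x u" t] t by blast
    then have "inverse (monom_val b t - monom_val b s) *s (monom_val b t - monom_val b s) *s x t \<in> S"
      by (rule subspace_scale[OF \<open>subspace S\<close>])
    moreover have "monom_val b t - monom_val b s \<noteq> 0"
      using j by (simp add: b two)
    ultimately show ?thesis by simp
  qed
  have "(\<Sum>u\<in>insert s K. x u) \<in> S"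
    using insert.prems(1)[of "\<lambda>_. 1"] by (simp add: monom_val_def)
  moreover have "(\<Sum>u\<in>K. x u) \<in> S"
    using step by (intro subspace_sum[OF \<open>subspace S\<close>]) auto
  ultimately have "(\<Sum>u\<in>insert s K. x u) - (\<Sum>u\<in>K. x u) \<in> S"
    by (rule subspace_diff[OF \<open>subspace S\<close>])
  then have "x s \<in> S"
    using insert.hyps by simp
  then show ?case
    using step insert.prems by auto
qed

text \<open>
  The converse of \<open>eval_in_subspace\<close>. Taking \<open>{0}\<close> for the subspace gives the injectivity of
  evaluation, taking a homogeneous part shows that parities can be read off from values.
\<close>

lemma lookup_in_subspace:
  assumes "subspace S" "\<And>a. eval a p \<in> S"
  shows "Poly_Mapping.lookup p t \<in> S"
proof (cases "t \<in> Poly_Mapping.keys p")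
  case True
  show ?thesis
    by (rule monomials_independent[where K = "Poly_Mapping.keys p"])
       (use assms True in \<open>auto simp: eval_def\<close>)
next
  case False
  then show ?thesis
    using subspace_0[OF assms(1)] by (simp add: in_keys_iff)
qed

lemma mpol_eqI:
  assumes "\<And>a. eval a p = eval a q"
  shows "p = q"
proof -
  have "Poly_Mapping.lookup (p - q) t \<in> {0}" for t
    by (rule lookup_in_subspace) (use assms in \<open>auto simp: subspace_single_0\<close>)
  then show ?thesis
    by (intro poly_mapping_eqI) (simp add: lookup_minus)
qed

lemma eval_in_subspace:
  assumes "subspace S" "\<And>t. Poly_Mapping.lookup p t \<in> S"
  shows "eval a p \<in> S"
  unfolding eval_def using assms by (intro subspace_sum subspace_scale) auto

text \<open>
  The condition on the variables of a polynomial, expressed by its values; this form is stable under all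
  constructions below without any computation of supports.
\<close>

lemma keys_subset_iff:
  "(\<forall>t\<in>Poly_Mapping.keys p. Poly_Mapping.keys t \<subseteq> J) \<longleftrightarrow>
   (\<forall>a b. (\<forall>j\<in>J. a j = b j) \<longrightarrow> eval a p = eval b p)"
proof (intro iffI allI impI ballI)
  fix a b :: "nat \<Rightarrow> 'k"
  assume "\<forall>t\<in>Poly_Mapping.keys p. Poly_Mapping.keys t \<subseteq> J" "\<forall>j\<in>J. a j = b j"
  then show "eval a p = eval b p"
    unfolding eval_def by (intro sum.cong refl arg_cong2[where f = scale] monom_val_cong) auto
next
  fix t assume indep: "\<forall>a b. (\<forall>j\<in>J. a j = b j) \<longrightarrow> eval a p = eval b p"
    and t: "t \<in> Poly_Mapping.keys p"
  \<comment> \<open>Setting the variables outside \<open>J\<close> to \<open>0\<close> leaves the sum of the terms that avoid them.\<close>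
  define q where "q = (\<Sum>t\<in>{t\<in>Poly_Mapping.keys p. Poly_Mapping.keys t \<subseteq> J}.
      Poly_Mapping.single t (Poly_Mapping.lookup p t))"
  have "p = q"
  proof (rule mpol_eqI)
    fix a :: "nat \<Rightarrow> 'k"
    define b where "b = (\<lambda>j. if j \<in> J then a j else 0)"
    have "eval a p = eval b p"
      using indep by (auto simp: b_def)
    also have "\<dots> = (\<Sum>t\<in>{t\<in>Poly_Mapping.keys p. Poly_Mapping.keys t \<subseteq> J}.
        monom_val b t *s Poly_Mapping.lookup p t)"
      unfolding eval_def
      by (rule sum.mono_neutral_right) (auto simp: b_def intro: monom_val_eq_0)
    also have "\<dots> = eval a q"
      by (auto simp: q_def b_def intro!: sum.cong arg_cong2[where f = scale] monom_val_cong)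
    finally show "eval a p = eval a q" .
  qed
  then have "Poly_Mapping.lookup q t \<noteq> 0"
    using t by (simp add: in_keys_iff)
  then show "Poly_Mapping.keys t \<subseteq> J"
    by (auto simp: q_def lookup_sum lookup_single when_def split: if_splits)
qed

end

section \<open>Coefficients of polynomial functions\<close>

context vector_space_char_0
begin

text \<open>
  \<open>u k x\<close> is the coefficient of \<open>c\<^sup>k\<close> in the polynomial function \<open>c \<mapsto> F c x\<close>. The degree bound is
  uniform in the parameter \<open>x\<close>, which will be the point at which a polynomial in further variables
  is evaluated.
\<close>

definition power_coeffs :: "(nat \<Rightarrow> 'p \<Rightarrow> 'v) \<Rightarrow> ('k \<Rightarrow> 'p \<Rightarrow> 'v) \<Rightarrow> bool" where
  "power_coeffs u F \<longleftrightarrow>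
     (\<exists>N. (\<forall>k>N. \<forall>x. u k x = 0) \<and> (\<forall>c x. (\<Sum>k\<le>N. c ^ k *s u k x) = F c x))"

lemma power_coeffsE:
  assumes "power_coeffs u F"
  obtains N where "\<And>M k x. N \<le> M \<Longrightarrow> M < k \<Longrightarrow> u k x = 0"
    and "\<And>M c x. N \<le> M \<Longrightarrow> (\<Sum>k\<le>M. c ^ k *s u k x) = F c x"
proof -
  obtain N where N: "\<And>k x. N < k \<Longrightarrow> u k x = 0" "\<And>c x. (\<Sum>k\<le>N. c ^ k *s u k x) = F c x"
    using assms unfolding power_coeffs_def by blast
  have "(\<Sum>k\<le>M. c ^ k *s u k x) = F c x" if "N \<le> M" for M c x
    unfolding N(2)[symmetric] using that N(1) by (intro sum.mono_neutral_right) auto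
  with N(1) show thesis
    by (intro that[of N]) auto
qed

text \<open>
  The coefficients of a polynomial function lie in any subspace that contains its values, by the
  independence of monomials applied to the single variable with index \<open>0\<close>.
\<close>

lemma power_coeffs_in_subspace:
  assumes "power_coeffs u F" "subspace S" "\<And>c. F c x \<in> S"
  shows "u k x \<in> S"
proof -
  obtain N where N: "\<And>M k x. N \<le> M \<Longrightarrow> M < k \<Longrightarrow> u k x = 0"
    "\<And>M c x. N \<le> M \<Longrightarrow> (\<Sum>k\<le>M. c ^ k *s u k x) = F c x"
    using power_coeffsE[OF assms(1)] by blast
  define p where "p = (\<Sum>k\<le>N. Poly_Mapping.single (Poly_Mapping.single (0::nat) k) (u k x))"
  have "eval a p \<in> S" for a
    using N(2)[of N "a 0" x] assms(3) by (simp add: p_def)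
  then have "Poly_Mapping.lookup p (Poly_Mapping.single 0 k) \<in> S"
    by (rule lookup_in_subspace[OF assms(2)])
  then show ?thesis
    using N(1)[of N k x] subspace_0[OF assms(2)]
    by (cases "k \<le> N")
       (auto simp: p_def lookup_sum lookup_single when_def inj_eq[OF inj_single])
qed

lemma power_coeffs_add:
  assumes "power_coeffs u F" "power_coeffs u' F'"
  shows "power_coeffs (\<lambda>k x. u k x + u' k x) (\<lambda>c x. F c x + F' c x)"
proof -
  obtain N where N: "\<And>M k x. N \<le> M \<Longrightarrow> M < k \<Longrightarrow> u k x = 0"
    "\<And>M c x. N \<le> M \<Longrightarrow> (\<Sum>k\<le>M. c ^ k *s u k x) = F c x"
    using power_coeffsE[OF assms(1)] by blast
  obtain N' where N': "\<And>M k x. N' \<le> M \<Longrightarrow> M < k \<Longrightarrow> u' k x = 0"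
    "\<And>M c x. N' \<le> M \<Longrightarrow> (\<Sum>k\<le>M. c ^ k *s u' k x) = F' c x"
    using power_coeffsE[OF assms(2)] by blast
  show ?thesis
    unfolding power_coeffs_def
    by (rule exI[of _ "max N N'"])
       (auto simp: scale_right_distrib sum.distrib N(2) N'(2) N(1)[of "max N N'"] N'(1)[of "max N N'"])
qed

lemma power_coeffs_linear:
  assumes "power_coeffs u F"
    and add: "\<And>p x y. h p (x + y) = h p x + h p y" and scale: "\<And>p c x. h p (c *s x) = c *s h p x"
  shows "power_coeffs (\<lambda>k p. h p (u k p)) (\<lambda>c p. h p (F c p))"
proof -
  have h0: "h p 0 = 0" for p using add[of p 0 0] by simp
  have hsum: "h p (\<Sum>t\<in>I. y t) = (\<Sum>t\<in>I. h p (y t))" for I p and y :: "nat \<Rightarrow> 'v"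
    by (induction I rule: infinite_finite_induct) (auto simp: h0 add)
  show ?thesis
    using assms(1) unfolding power_coeffs_def
    by (elim ex_forward conj_forward all_forward) (simp_all add: h0 flip: hsum scale)
qed

lemma power_coeffs_scale:
  "power_coeffs u F \<Longrightarrow> power_coeffs (\<lambda>k x. c *s u k x) (\<lambda>d x. c *s F d x)"
  by (rule power_coeffs_linear[where h = "\<lambda>_. scale c"]) (auto simp: scale_right_distrib mult.commute)

lemma power_coeffs_0: "power_coeffs (\<lambda>k x. 0) (\<lambda>c x. 0)"
  by (auto simp: power_coeffs_def)

lemma power_coeffs_sum:
  "(\<And>i. i \<in> I \<Longrightarrow> power_coeffs (u i) (F i)) \<Longrightarrow>
    power_coeffs (\<lambda>k x. \<Sum>i\<in>I. u i k x) (\<lambda>c x. \<Sum>i\<in>I. F i c x)"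
  by (induction I rule: infinite_finite_induct) (auto intro: power_coeffs_add power_coeffs_0)

lemma power_coeffs_reparam:
  "power_coeffs u F \<Longrightarrow> power_coeffs (\<lambda>k x. u k (\<phi> x)) (\<lambda>c x. F c (\<phi> x))"
  unfolding power_coeffs_def by blast

lemma power_coeffs_shift:
  assumes "power_coeffs u F"
  shows "power_coeffs (\<lambda>k x. if k = 0 then 0 else u (k - 1) x) (\<lambda>c x. c *s F c x)"
proof -
  obtain N where N: "\<And>k x. N < k \<Longrightarrow> u k x = 0" "\<And>c x. (\<Sum>k\<le>N. c ^ k *s u k x) = F c x"
    using assms unfolding power_coeffs_def by blast
  have "(\<Sum>k\<le>Suc N. c ^ k *s (if k = 0 then 0 else u (k - 1) x)) = c *s F c x" for c x
    unfolding N(2)[symmetric] by (subst sum.atMost_Suc_shift) (simp add: scale_sum_right)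
  then show ?thesis
    unfolding power_coeffs_def using N(1) by (intro exI[of _ "Suc N"]) auto
qed

lemma power_coeffs_unique:
  assumes "power_coeffs u F" "power_coeffs u' F"
  shows "u k x = u' k x"
proof -
  have "power_coeffs (\<lambda>k x. u k x + (- 1) *s u' k x) (\<lambda>c x. F c x + (- 1) *s F c x)"
    by (intro power_coeffs_add power_coeffs_scale assms)
  then have "u k x + (- 1) *s u' k x \<in> {0}"
    by (rule power_coeffs_in_subspace) auto
  then show ?thesis by simp
qed

text \<open>
  The distinguished variable is the one with index \<open>0\<close>: changing the coordinate \<open>a\<^sub>0\<close> of the point
  runs through the values of the power series variable.
\<close>

lemma power_coeffs_var0_coeff:
  "power_coeffs (\<lambda>k a. eval a (var0_coeff k p)) (\<lambda>c a. eval (a(0 := c)) p)"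
proof -
  define K where "K k = {t \<in> Poly_Mapping.keys p. Poly_Mapping.lookup t 0 = k}" for k
  obtain N where N: "\<And>t. t \<in> Poly_Mapping.keys p \<Longrightarrow> Poly_Mapping.lookup t 0 \<le> N"
    using finite_imageI[OF finite_keys, of "\<lambda>t. Poly_Mapping.lookup t 0" p]
    by (metis finite_nat_set_iff_bounded_le imageI)
  have split: "monom_val (a(0 := c)) t =
      c ^ k * monom_val a (t - Poly_Mapping.single 0 k)" if "Poly_Mapping.lookup t 0 = k" for a c t k
  proof -
    have "t = Poly_Mapping.single 0 k + (t - Poly_Mapping.single 0 k)"
      using that by (intro poly_mapping_eqI) (auto simp: lookup_add lookup_minus lookup_single when_def)
    moreover have "monom_val (a(0 := c)) (t - Poly_Mapping.single 0 k) =
        monom_val a (t - Poly_Mapping.single 0 k)"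
      using that by (intro monom_val_cong) (auto simp: in_keys_iff lookup_minus lookup_single when_def)
    ultimately show ?thesis
      by (metis monom_val_add monom_val_single fun_upd_same)
  qed
  have "eval (a(0 := c)) p = (\<Sum>k\<le>N. c ^ k *s eval a (var0_coeff k p))" for a c
  proof -
    have "eval (a(0 := c)) p =
        (\<Sum>k\<le>N. \<Sum>t\<in>K k. monom_val (a(0 := c)) t *s Poly_Mapping.lookup p t)"
      unfolding eval_def K_def by (rule sum.group[symmetric]) (use N in auto)
    also have "\<dots> = (\<Sum>k\<le>N. c ^ k *s eval a (var0_coeff k p))"
      by (intro sum.cong refl)
         (auto simp: K_def var0_coeff_def split scale_sum_right intro!: sum.cong)
    finally show ?thesis .
  qed
  moreover have "var0_coeff k p = 0" if "N < k" for k
  proof -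
    have "K k = {}" using N that by (force simp: K_def)
    then show ?thesis by (simp add: var0_coeff_def flip: K_def)
  qed
  ultimately show ?thesis
    unfolding power_coeffs_def by (intro exI[of _ N]) auto
qed

text \<open>
  The analogue for two variables, needed for the associativity laws. The bound is the same for both
  indices, which makes the notion symmetric (\<open>double_coeffs_swap\<close>).
\<close>

definition double_coeffs :: "(nat \<Rightarrow> nat \<Rightarrow> 'v) \<Rightarrow> ('k \<Rightarrow> 'k \<Rightarrow> 'v) \<Rightarrow> bool" where
  "double_coeffs u G \<longleftrightarrow>
     (\<exists>N. (\<forall>a b. N < a \<or> N < b \<longrightarrow> u a b = 0) \<and>
          (\<forall>c d. (\<Sum>a\<le>N. \<Sum>b\<le>N. (c ^ a * d ^ b) *s u a b) = G c d))"

lemma double_coeffsE: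
  assumes "double_coeffs u G"
  obtains N where "\<And>a b. N < a \<or> N < b \<Longrightarrow> u a b = 0"
    and "\<And>c d. (\<Sum>a\<le>N. \<Sum>b\<le>N. (c ^ a * d ^ b) *s u a b) = G c d"
proof -
  obtain N where "\<forall>a b. N < a \<or> N < b \<longrightarrow> u a b = 0"
    "\<forall>c d. (\<Sum>a\<le>N. \<Sum>b\<le>N. (c ^ a * d ^ b) *s u a b) = G c d"
    using assms by (auto simp: double_coeffs_def)
  then show thesis
    by (intro that[of N]) auto
qed

text \<open>
  Since the outer coefficients \<open>U\<close> have one degree bound for all values of the inner variable, only
  finitely many inner sequences are nonzero, and these have a common bound.
\<close>

lemma double_coeffsI:
  assumes U: "power_coeffs U G"
    and u: "\<And>a. power_coeffs (\<lambda>b (_::unit). u a b) (\<lambda>d _. U a d)"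
  shows "double_coeffs u G"
proof -
  obtain N where N: "\<And>a d. N < a \<Longrightarrow> U a d = 0" "\<And>c d. (\<Sum>a\<le>N. c ^ a *s U a d) = G c d"
    using U unfolding power_coeffs_def by blast
  have "\<forall>a. \<exists>M. \<forall>M'\<ge>M. (\<forall>b>M'. u a b = 0) \<and> (\<forall>d. (\<Sum>b\<le>M'. d ^ b *s u a b) = U a d)"
  proof
    fix a
    obtain M where "\<And>M' b x. M \<le> M' \<Longrightarrow> M' < b \<Longrightarrow> u a b = 0"
      "\<And>M' c (x::unit). M \<le> M' \<Longrightarrow> (\<Sum>b\<le>M'. c ^ b *s u a b) = U a c"
      using power_coeffsE[OF u[of a]] by auto
    then show "\<exists>M. \<forall>M'\<ge>M. (\<forall>b>M'. u a b = 0) \<and> (\<forall>d. (\<Sum>b\<le>M'. d ^ b *s u a b) = U a d)"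
      by (intro exI[of _ M]) auto
  qed
  then obtain M where M: "\<And>a M' b. M a \<le> M' \<Longrightarrow> M' < b \<Longrightarrow> u a b = 0"
    "\<And>a M' d. M a \<le> M' \<Longrightarrow> (\<Sum>b\<le>M'. d ^ b *s u a b) = U a d"
    by metis
  have big: "u a b = 0" if "N < a" for a b
  proof (rule power_coeffs_unique[of "\<lambda>b (_::unit). u a b" "\<lambda>d _. 0" "\<lambda>b _. 0"])
    show "power_coeffs (\<lambda>b (_::unit). u a b) (\<lambda>d _. 0)"
      using u[of a] N(1)[OF that] by simp
  qed (rule power_coeffs_0)
  define L where "L = max N (Max (M ` {..N}))"
  have L: "N \<le> L" "M a \<le> L" if "a \<le> N" for a
    using that by (auto simp: L_def le_max_iff_disj intro!: disjI2 Max_ge)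
  have "u a b = 0" if "L < a \<or> L < b" for a b
    using that big[of a b] M(1)[of a L b] L[of a] L(1)[of 0] by (cases "a \<le> N") auto
  moreover have "(\<Sum>a\<le>L. \<Sum>b\<le>L. (c ^ a * d ^ b) *s u a b) = G c d" for c d
  proof -
    have "(\<Sum>a\<le>L. \<Sum>b\<le>L. (c ^ a * d ^ b) *s u a b) = (\<Sum>a\<le>N. \<Sum>b\<le>L. (c ^ a * d ^ b) *s u a b)"
      using L(1)[of 0] big by (intro sum.mono_neutral_right) auto
    also have "\<dots> = (\<Sum>a\<le>N. c ^ a *s (\<Sum>b\<le>L. d ^ b *s u a b))"
      by (simp add: scale_sum_right)
    also have "\<dots> = G c d"
      using L M(2) N(2) by simp
    finally show ?thesis .
  qed
  ultimately show ?thesis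
    unfolding double_coeffs_def by blast
qed

lemma double_coeffs_unique:
  assumes "double_coeffs u G" "double_coeffs u' G"
  shows "u a b = u' a b"
proof -
  have *: "\<exists>U. power_coeffs U G \<and> (\<forall>a. power_coeffs (\<lambda>b (_::unit). w a b) (\<lambda>d _. U a d))"
    if w: "double_coeffs w G" for w
  proof -
    obtain N where N: "\<And>a b. N < a \<or> N < b \<Longrightarrow> w a b = 0"
      "\<And>c d. (\<Sum>a\<le>N. \<Sum>b\<le>N. (c ^ a * d ^ b) *s w a b) = G c d"
      by (rule double_coeffsE[OF w]) (rule that)
    show ?thesis
      by (rule exI[of _ "\<lambda>a d. \<Sum>b\<le>N. d ^ b *s w a b"])
         (use N in \<open>auto simp: power_coeffs_def scale_sum_right intro!: exI[of _ N]\<close>)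
  qed
  obtain U U' where "power_coeffs U G" "power_coeffs U' G"
    and u: "power_coeffs (\<lambda>b (_::unit). u a b) (\<lambda>d _. U a d)"
      "power_coeffs (\<lambda>b (_::unit). u' a b) (\<lambda>d _. U' a d)"
    using *[OF assms(1)] *[OF assms(2)] by blast
  then have "U a d = U' a d" for d
    by (intro power_coeffs_unique)
  with u have "power_coeffs (\<lambda>b (_::unit). u' a b) (\<lambda>d _. U a d)" by simp
  with u(1) show ?thesis
    by (rule power_coeffs_unique)
qed

lemma double_coeffs_swap:
  assumes "double_coeffs u G"
  shows "double_coeffs (\<lambda>a b. u b a) (\<lambda>c d. G d c)"
proof -
  obtain N where N: "\<And>a b. N < a \<or> N < b \<Longrightarrow> u a b = 0"
    "\<And>c d. (\<Sum>a\<le>N. \<Sum>b\<le>N. (c ^ a * d ^ b) *s u a b) = G c d"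
    by (rule double_coeffsE[OF assms]) (rule that)
  have "(\<Sum>a\<le>N. \<Sum>b\<le>N. (c ^ a * d ^ b) *s u b a) = G d c" for c d
    by (subst sum.swap) (simp add: N(2)[symmetric] mult.commute)
  with N(1) show ?thesis
    unfolding double_coeffs_def by blast
qed

lemma double_coeffs_scale:
  assumes "double_coeffs u G"
  shows "double_coeffs (\<lambda>a b. e *s u a b) (\<lambda>c d. e *s G c d)"
proof -
  obtain N where N: "\<And>a b. N < a \<or> N < b \<Longrightarrow> u a b = 0"
    "\<And>c d. (\<Sum>a\<le>N. \<Sum>b\<le>N. (c ^ a * d ^ b) *s u a b) = G c d"
    by (rule double_coeffsE[OF assms]) (rule that)
  have "(\<Sum>a\<le>N. \<Sum>b\<le>N. (c ^ a * d ^ b) *s e *s u a b) = e *s G c d" for c d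
    by (simp add: N(2)[symmetric] scale_sum_right mult_ac)
  with N(1) show ?thesis
    unfolding double_coeffs_def by (intro exI[of _ N]) auto
qed

text \<open>The binomial theorem, read off on coefficients.\<close>

lemma double_coeffs_add_vars:
  assumes "double_coeffs u G"
  shows "double_coeffs (\<lambda>a b. \<Sum>s\<le>b. of_nat ((a + b - s) choose a) *s u (a + b - s) s)
           (\<lambda>c d. G (c + d) d)"
proof -
  obtain N where N: "\<And>a b. N < a \<or> N < b \<Longrightarrow> u a b = 0"
    "\<And>c d. (\<Sum>a\<le>N. \<Sum>b\<le>N. (c ^ a * d ^ b) *s u a b) = G c d"
    by (rule double_coeffsE[OF assms]) (rule that)
  let ?w = "\<lambda>a b. \<Sum>s\<le>b. of_nat ((a + b - s) choose a) *s u (a + b - s) s"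
  have "?w a b = 0" if "2 * N < a \<or> 2 * N < b" for a b
  proof (rule sum.neutral, intro ballI)
    fix s assume "s \<in> {..b}"
    then have "N < a + b - s \<or> N < s" using that by auto
    then show "of_nat ((a + b - s) choose a) *s u (a + b - s) s = 0"
      using N(1) by simp
  qed
  moreover have "(\<Sum>a\<le>2*N. \<Sum>b\<le>2*N. (c ^ a * d ^ b) *s ?w a b) = G (c + d) d" for c d
  proof -
    let ?f = "\<lambda>(a, b, s). (c ^ a * d ^ b * of_nat ((a + b - s) choose a)) *s u (a + b - s) s"
    let ?g = "\<lambda>(r, s, a). (of_nat (r choose a) * c ^ a * d ^ (r - a) * d ^ s) *s u r s"
    have "(\<Sum>a\<le>2*N. \<Sum>b\<le>2*N. (c ^ a * d ^ b) *s ?w a b) =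
        (\<Sum>a\<le>2*N. \<Sum>b\<le>2*N. \<Sum>s\<le>b. ?f (a, b, s))"
      by (simp add: scale_sum_right)
    also have "\<dots> = sum ?f (SIGMA a:{..2*N}. SIGMA b:{..2*N}. {..b})"
      by (simp add: sum.Sigma)
    also have "\<dots> = sum ?g (SIGMA r:{..N}. SIGMA s:{..N}. {..r})"
    proof (rule sum.reindex_bij_witness_not_neutral[where
          S' = "{(a, b, s). (a, b, s) \<in> (SIGMA a:{..2*N}. SIGMA b:{..2*N}. {..b}) \<and> (N < a + b - s \<or> N < s)}"
          and T' = "{}" and i = "\<lambda>(r, s, a). (a, r - a + s, s)" and j = "\<lambda>(a, b, s). (a + b - s, s, a)"])
      show "finite {(a, b, s). (a, b, s) \<in> (SIGMA a:{..2*N}. SIGMA b:{..2*N}. {..b}) \<and> (N < a + b - s \<or> N < s)}"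
        by (rule finite_subset[of _ "{..2*N} \<times> {..2*N} \<times> {..2*N}"]) auto
    qed (use N(1) in \<open>auto simp: mult.assoc mult.commute simp flip: power_add\<close>)
    also have "\<dots> = (\<Sum>r\<le>N. \<Sum>s\<le>N. \<Sum>a\<le>r. ?g (r, s, a))"
      by (simp add: sum.Sigma)
    also have "\<dots> = (\<Sum>r\<le>N. \<Sum>s\<le>N. ((c + d) ^ r * d ^ s) *s u r s)"
      by (simp add: scale_sum_left[symmetric] binomial_ring sum_distrib_left sum_distrib_right mult_ac)
    finally show ?thesis
      by (simp add: N(2))
  qed
  ultimately show ?thesis
    unfolding double_coeffs_def by blast
qed

end

section \<open>Homogeneous components\<close>

lemma bit_cases [case_names 0 1]: "(a = 0 \<Longrightarrow> P) \<Longrightarrow> (a = 1 \<Longrightarrow> P) \<Longrightarrow> P" for a :: bit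
  using bit_not_zero_iff by blast

lemma superspace_part_subspace:
  "superspace X \<Longrightarrow> module.subspace (smult X) (part X a)"
  by (simp add: superspace_def)

lemma superspace_module: "superspace X \<Longrightarrow> Modules.module (smult X)"
  by (simp add: superspace_def module_iff_vector_space)

lemma superspace_vector_space: "superspace X \<Longrightarrow> vector_space (smult X)"
  by (simp add: superspace_def)

lemma superspace_part_disjoint:
  assumes "superspace X" "x \<in> part X a" "x \<in> part X (1 - a)"
  shows "x = 0"
  using assms by (cases a rule: bit_cases) (auto simp: superspace_def)

lemma superspace_part_carr:
  assumes "superspace X" "x \<in> part X a"
  shows "x \<in> carr X"
proof -
  have "0 \<in> part X b" for b
    using module.subspace_0[OF superspace_module superspace_part_subspace] assms(1) by blast
  then have "\<exists>y z. x = y + z \<and> y \<in> part X 0 \<and> z \<in> part X 1"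
    using assms(2)
    by (cases a rule: bit_cases) (auto intro: exI[of _ x] exI[of _ 0])
  then show ?thesis
    using assms(1) unfolding superspace_def by blast
qed

lemma hcomp_eqI:
  assumes X: "superspace X" and "y \<in> part X a" "x - y \<in> part X (1 - a)"
  shows "hcomp X a x = y"
  unfolding hcomp_def
proof (rule the_equality)
  fix z assume z: "z \<in> part X a \<and> x - z \<in> part X (1 - a)"
  note diff = module.subspace_diff[OF superspace_module[OF X] superspace_part_subspace[OF X]]
  have "z - y \<in> part X a"
    using z assms by (simp add: diff)
  moreover have "(x - y) - (x - z) \<in> part X (1 - a)"
    using z assms diff by blast
  ultimately have "z - y = 0"
    by (intro superspace_part_disjoint[OF X]) simp_all
  then show "z = y" by simp
qed (use assms in auto)

lemma hcomp_split:
  assumes X: "superspace X" and "x \<in> carr X"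
  shows "hcomp X a x \<in> part X a" "x - hcomp X a x \<in> part X (1 - a)"
    "hcomp X 0 x + hcomp X 1 x = x"
proof -
  obtain y z where yz: "x = y + z" "y \<in> part X 0" "z \<in> part X 1"
    using assms unfolding superspace_def by blast
  have "hcomp X 0 x = y" "hcomp X 1 x = z"
    using yz by (auto intro!: hcomp_eqI[OF X])
  then show "hcomp X a x \<in> part X a" "x - hcomp X a x \<in> part X (1 - a)"
    "hcomp X 0 x + hcomp X 1 x = x"
    using yz by (cases a rule: bit_cases; simp)+
qed

lemma hcomp_homogeneous:
  assumes X: "superspace X" and "x \<in> part X b"
  shows "hcomp X a x = (if a = b then x else 0)"
proof -
  have 0: "0 \<in> part X c" for c
    using module.subspace_0[OF superspace_module[OF X] superspace_part_subspace[OF X]] .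
  have "a = b \<or> b = 1 - a"
    by (cases a rule: bit_cases; cases b rule: bit_cases) auto
  then show ?thesis
    using assms 0 by (auto intro!: hcomp_eqI[OF X])
qed

lemma hcomp_add:
  assumes X: "superspace X" and "x \<in> carr X" "y \<in> carr X"
  shows "hcomp X a (x + y) = hcomp X a x + hcomp X a y"
proof (rule hcomp_eqI[OF X])
  note add = module.subspace_add[OF superspace_module[OF X] superspace_part_subspace[OF X]]
  note x = hcomp_split(1,2)[OF X assms(2)] and y = hcomp_split(1,2)[OF X assms(3)]
  show "hcomp X a x + hcomp X a y \<in> part X a"
    using add[OF x(1) y(1)] .
  show "x + y - (hcomp X a x + hcomp X a y) \<in> part X (1 - a)"
    using add[OF x(2) y(2)] by (simp only: add_diff_add)
qed

lemma hcomp_smult: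
  assumes X: "superspace X" and "x \<in> carr X"
  shows "hcomp X a (smult X c x) = smult X c (hcomp X a x)"
proof (rule hcomp_eqI[OF X])
  note scale = module.subspace_scale[OF superspace_module[OF X] superspace_part_subspace[OF X]]
  note x = hcomp_split(1,2)[OF X assms(2)]
  show "smult X c (hcomp X a x) \<in> part X a"
    using scale[OF x(1)] .
  show "smult X c x - smult X c (hcomp X a x) \<in> part X (1 - a)"
    using scale[OF x(2), of c] superspace_module[OF X]
    by (simp add: module.scale_right_diff_distrib)
qed

lemma hcomp_even:
  assumes X: "superspace X" and h: "even_linear X X h" and "x \<in> carr X"
  shows "hcomp X a (h x) = h (hcomp X a x)"
proof (rule hcomp_eqI[OF X])
  note x = hcomp_split(1,2)[OF X assms(3)]
  show "h (hcomp X a x) \<in> part X a"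
    using h x(1) unfolding even_linear_def by blast
  have "h x = h (hcomp X a x + (x - hcomp X a x))"
    by simp
  also have "\<dots> = h (hcomp X a x) + h (x - hcomp X a x)"
    using h superspace_part_carr[OF X x(1)] superspace_part_carr[OF X x(2)]
    unfolding even_linear_def linear_between_def by blast
  finally have "h x - h (hcomp X a x) = h (x - hcomp X a x)"
    by (simp add: algebra_simps)
  then show "h x - h (hcomp X a x) \<in> part X (1 - a)"
    using h x(2) unfolding even_linear_def by auto
qed

section \<open>Sesquilinear maps at a point\<close>

locale even_superspace =
  fixes A :: "('k::field_char_0, 'v::ab_group_add) d_space"
  assumes d_superspace_A: "d_superspace A" and carr_A: "carr A = UNIV"
begin

abbreviation scale :: "'k \<Rightarrow> 'v \<Rightarrow> 'v" (infixr \<open>*s\<close> 75) where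
  "scale \<equiv> smult A"

lemma superspace_A: "superspace A"
  using d_superspace_A by (simp add: d_superspace_def)

sublocale vector_space_char_0 "smult A"
  using superspace_vector_space[OF superspace_A] by (simp add: vector_space_char_0_def)

lemma part_subspace: "subspace (part A a)"
  by (rule superspace_part_subspace[OF superspace_A])

lemma der_add: "der A (x + y) = der A x + der A y"
  and der_scale: "der A (c *s x) = c *s der A x"
  and der_part: "x \<in> part A a \<Longrightarrow> der A x \<in> part A a"
  using d_superspace_A
  by (auto simp: d_superspace_def even_linear_def linear_between_def carr_A)

lemma part_hcomp: "hcomp A a x \<in> part A a"
  and sum_hcomp: "hcomp A 0 x + hcomp A 1 x = x"
  using hcomp_split[OF superspace_A] by (auto simp: carr_A)

lemma hcomp_part: "x \<in> part A b \<Longrightarrow> hcomp A a x = (if a = b then x else 0)"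
  by (rule hcomp_homogeneous[OF superspace_A])

lemma hcomp_same: "x \<in> part A a \<Longrightarrow> hcomp A a x = x"
  by (simp add: hcomp_part)

lemma hcomp_A_add: "hcomp A a (x + y) = hcomp A a x + hcomp A a y"
  and hcomp_A_scale: "hcomp A a (c *s x) = c *s hcomp A a x"
  and hcomp_A_der: "hcomp A a (der A x) = der A (hcomp A a x)"
  using hcomp_add[OF superspace_A] hcomp_smult[OF superspace_A] hcomp_even[OF superspace_A]
    d_superspace_A by (auto simp: carr_A d_superspace_def)

definition graded_submodule :: "'v set \<Rightarrow> bool" where
  "graded_submodule U \<longleftrightarrow>
     subspace U \<and> (\<forall>x\<in>U. der A x \<in> U) \<and> (\<forall>a. \<forall>x\<in>U. hcomp A a x \<in> U)"

lemma graded_submodule_UNIV: "graded_submodule UNIV"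
  by (simp add: graded_submodule_def)

definition homog :: "'v set \<Rightarrow> nat \<Rightarrow> (nat \<Rightarrow> bit) \<Rightarrow> (nat \<Rightarrow> 'v) \<Rightarrow> bool" where
  "homog U n d v \<longleftrightarrow> (\<forall>j\<in>{1..n}. v j \<in> U \<inter> part A (d j))"

text \<open>
  The defining conditions of \<open>Chom(n)\<close> for the values of a map at one point \<open>a\<close>: multilinearity, and
  \<open>\<partial>\<close> in the \<open>i\<close>-th argument acts as the scalar \<open>- a\<^sub>i\<close>. As in the definition of the spaces, arguments
  outside \<open>U\<close> give the value \<open>0\<close>.
\<close>

definition sesqui :: "'v set \<Rightarrow> nat \<Rightarrow> (nat \<Rightarrow> 'k) \<Rightarrow> ((nat \<Rightarrow> 'v) \<Rightarrow> 'v) \<Rightarrow> bool" where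
  "sesqui U n a \<Phi> \<longleftrightarrow>
     (\<forall>u v. (\<forall>j\<in>{1..n}. u j = v j) \<longrightarrow> \<Phi> u = \<Phi> v) \<and>
     (\<forall>v. \<not> args_in U n v \<longrightarrow> \<Phi> v = 0) \<and>
     (\<forall>v. args_in U n v \<longrightarrow> (\<forall>i\<in>{1..n}.
        (\<forall>x\<in>U. \<forall>y\<in>U. \<Phi> (v(i := x + y)) = \<Phi> (v(i := x)) + \<Phi> (v(i := y))) \<and>
        (\<forall>c. \<forall>x\<in>U. \<Phi> (v(i := c *s x)) = c *s \<Phi> (v(i := x))) \<and>
        \<Phi> (v(i := der A (v i))) = - (a i *s \<Phi> v)))"

lemma sesquiI:
  assumes "\<And>u v. (\<And>j. j \<in> {1..n} \<Longrightarrow> u j = v j) \<Longrightarrow> \<Phi> u = \<Phi> v"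
    and "\<And>v. \<not> args_in U n v \<Longrightarrow> \<Phi> v = 0"
    and "\<And>v i x y. args_in U n v \<Longrightarrow> i \<in> {1..n} \<Longrightarrow> x \<in> U \<Longrightarrow> y \<in> U \<Longrightarrow>
      \<Phi> (v(i := x + y)) = \<Phi> (v(i := x)) + \<Phi> (v(i := y))"
    and "\<And>v i c x. args_in U n v \<Longrightarrow> i \<in> {1..n} \<Longrightarrow> x \<in> U \<Longrightarrow>
      \<Phi> (v(i := c *s x)) = c *s \<Phi> (v(i := x))"
    and "\<And>v i. args_in U n v \<Longrightarrow> i \<in> {1..n} \<Longrightarrow> \<Phi> (v(i := der A (v i))) = - (a i *s \<Phi> v)"
  shows "sesqui U n a \<Phi>"
  unfolding sesqui_def
  by (intro conjI allI impI ballI, rule assms(1), blast) (rule assms; assumption)+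

lemma sesqui_cong:
  "sesqui U n a \<Phi> \<Longrightarrow> (\<And>j. j \<in> {1..n} \<Longrightarrow> u j = v j) \<Longrightarrow> \<Phi> u = \<Phi> v"
  by (simp add: sesqui_def)

lemma sesqui_outside: "sesqui U n a \<Phi> \<Longrightarrow> \<not> args_in U n v \<Longrightarrow> \<Phi> v = 0"
  by (simp add: sesqui_def)

lemma sesqui_add_arg:
  "sesqui U n a \<Phi> \<Longrightarrow> args_in U n v \<Longrightarrow> i \<in> {1..n} \<Longrightarrow> x \<in> U \<Longrightarrow> y \<in> U \<Longrightarrow>
    \<Phi> (v(i := x + y)) = \<Phi> (v(i := x)) + \<Phi> (v(i := y))"
  by (simp add: sesqui_def)

lemma sesqui_scale_arg:
  "sesqui U n a \<Phi> \<Longrightarrow> args_in U n v \<Longrightarrow> i \<in> {1..n} \<Longrightarrow> x \<in> U \<Longrightarrow>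
    \<Phi> (v(i := c *s x)) = c *s \<Phi> (v(i := x))"
  by (simp add: sesqui_def)

lemma sesqui_der_arg:
  "sesqui U n a \<Phi> \<Longrightarrow> args_in U n v \<Longrightarrow> i \<in> {1..n} \<Longrightarrow>
    \<Phi> (v(i := der A (v i))) = - (a i *s \<Phi> v)"
  by (simp add: sesqui_def)

lemma sesqui_zero_arg:
  assumes "sesqui U n a \<Phi>" "i \<in> {1..n}" "v i = 0"
  shows "\<Phi> v = 0"
proof (cases "args_in U n v")
  case True
  then have "v i \<in> U"
    using assms(2) by (simp add: args_in_def)
  then have "0 \<in> U" using assms(3) by simp
  then have "\<Phi> (v(i := 0 *s 0)) = 0 *s \<Phi> (v(i := 0))"
    using sesqui_scale_arg[OF assms(1) True assms(2)] by blast
  then show ?thesis using assms(3) by (simp add: fun_upd_idem)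
qed (use sesqui_outside[OF assms(1)] in blast)

lemma sesqui_linear:
  assumes \<Phi>: "sesqui U n a \<Phi>"
    and add: "\<And>x y. h (x + y) = h x + h y" and scale: "\<And>c x. h (c *s x) = c *s h x"
  shows "sesqui U n a (\<lambda>v. h (\<Phi> v))"
proof -
  have h0: "h 0 = 0" using add[of 0 0] by simp
  have hm: "h (- x) = - h x" for x
    using add[of x "- x"] h0 by (simp add: eq_neg_iff_add_eq_0 add.commute)
  show ?thesis
  proof (rule sesquiI)
    fix u v :: "nat \<Rightarrow> 'v" assume "\<And>j. j \<in> {1..n} \<Longrightarrow> u j = v j"
    then show "h (\<Phi> u) = h (\<Phi> v)" using sesqui_cong[OF \<Phi>, of u v] by simp
  qed (simp_all add: sesqui_outside[OF \<Phi>] sesqui_add_arg[OF \<Phi>] sesqui_scale_arg[OF \<Phi>]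
      sesqui_der_arg[OF \<Phi>] h0 hm add scale del: atLeastAtMost_iff)
qed

lemma sesqui_scale: "sesqui U n a \<Phi> \<Longrightarrow> sesqui U n a (\<lambda>v. c *s \<Phi> v)"
  by (rule sesqui_linear) (auto simp: scale_right_distrib)

lemma sesqui_add:
  assumes \<Phi>: "sesqui U n a \<Phi>" and \<Psi>: "sesqui U n a \<Psi>"
  shows "sesqui U n a (\<lambda>v. \<Phi> v + \<Psi> v)"
proof (rule sesquiI)
  fix u v :: "nat \<Rightarrow> 'v" assume "\<And>j. j \<in> {1..n} \<Longrightarrow> u j = v j"
  then show "\<Phi> u + \<Psi> u = \<Phi> v + \<Psi> v"
    using sesqui_cong[OF \<Phi>, of u v] sesqui_cong[OF \<Psi>, of u v] by simp
qed (simp_all add: sesqui_outside[OF \<Phi>] sesqui_add_arg[OF \<Phi>] sesqui_scale_arg[OF \<Phi>]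
      sesqui_der_arg[OF \<Phi>] sesqui_outside[OF \<Psi>] sesqui_add_arg[OF \<Psi>] sesqui_scale_arg[OF \<Psi>]
      sesqui_der_arg[OF \<Psi>] scale_right_distrib del: atLeastAtMost_iff)

lemma sesqui_0: "sesqui U n a (\<lambda>v. 0)"
  by (rule sesquiI) auto

lemma sesqui_sum:
  "(\<And>i. i \<in> I \<Longrightarrow> sesqui U n a (\<Phi> i)) \<Longrightarrow> sesqui U n a (\<lambda>v. \<Sum>i\<in>I. \<Phi> i v)"
  by (induction I rule: infinite_finite_induct) (auto intro: sesqui_add sesqui_0)

lemma args_in_upd: "args_in U n v \<Longrightarrow> x \<in> U \<Longrightarrow> args_in U n (v(i := x))"
  by (simp add: args_in_def)

lemma sesqui_permute:
  assumes \<Phi>: "sesqui U n (\<lambda>j. a (inv \<sigma> j)) \<Phi>" and \<sigma>: "\<sigma> permutes {1..n}"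
  shows "sesqui U n a (\<lambda>v. \<Phi> (\<lambda>j. v (inv \<sigma> j)))"
proof -
  have mem: "inv \<sigma> j \<in> {1..n} \<longleftrightarrow> j \<in> {1..n}" "\<sigma> j \<in> {1..n} \<longleftrightarrow> j \<in> {1..n}" for j
    using permutes_in_image[OF \<sigma>] permutes_in_image[OF permutes_inv[OF \<sigma>]] by blast+
  have inv: "inv \<sigma> (\<sigma> j) = j" "\<sigma> (inv \<sigma> j) = j" for j
    using permutes_inverses[OF \<sigma>] by auto
  have args: "args_in U n (\<lambda>j. v (inv \<sigma> j)) \<longleftrightarrow> args_in U n v" for v
    unfolding args_in_def using mem inv by metis
  have upd: "(\<lambda>j. (v(i := x)) (inv \<sigma> j)) = (\<lambda>j. v (inv \<sigma> j))(\<sigma> i := x)" for v i x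
    using inv by (auto simp: fun_eq_iff)
  show ?thesis
  proof (rule sesquiI)
    fix u v :: "nat \<Rightarrow> 'v" assume "\<And>j. j \<in> {1..n} \<Longrightarrow> u j = v j"
    then show "\<Phi> (\<lambda>j. u (inv \<sigma> j)) = \<Phi> (\<lambda>j. v (inv \<sigma> j))"
      using mem by (intro sesqui_cong[OF \<Phi>]) blast
  next
    fix v :: "nat \<Rightarrow> 'v" and i assume *: "args_in U n v" "i \<in> {1..n}"
    show "\<Phi> (\<lambda>j. (v(i := der A (v i))) (inv \<sigma> j)) = - (a i *s \<Phi> (\<lambda>j. v (inv \<sigma> j)))"
      using sesqui_der_arg[OF \<Phi>, of "\<lambda>j. v (inv \<sigma> j)" "\<sigma> i"] * mem
      by (simp add: upd args inv del: atLeastAtMost_iff fun_upd_apply)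
  qed (simp_all add: upd args mem sesqui_outside[OF \<Phi>] sesqui_add_arg[OF \<Phi>] sesqui_scale_arg[OF \<Phi>]
      del: atLeastAtMost_iff fun_upd_apply One_nat_def)
qed

abbreviation degrees :: "nat \<Rightarrow> (nat \<Rightarrow> bit) set" where
  "degrees n \<equiv> {1..n} \<rightarrow>\<^sub>E {0, 1}"

lemma finite_degrees: "finite (degrees n)"
  by (intro finite_PiE) auto

text \<open>
  A formula that is prescribed on homogeneous arguments, separately for each choice \<open>d\<close> of degrees, and
  extended multilinearly is again sesquilinear, because the projections to the homogeneous components
  are linear and commute with \<open>\<partial>\<close>.
\<close>

lemma sesqui_polarize:
  assumes U: "graded_submodule U"
    and T: "\<And>d. d \<in> degrees n \<Longrightarrow> sesqui U n a (T d)"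
  shows "sesqui U n a
    (\<lambda>v. if args_in U n v then \<Sum>d\<in>degrees n. T d (\<lambda>j. hcomp A (d j) (v j)) else 0)"
proof -
  have "sesqui U n a (\<lambda>v. if args_in U n v then T d (\<lambda>j. hcomp A (d j) (v j)) else 0)"
    if "d \<in> degrees n" for d
  proof -
    note Td = T[OF that]
    have upd: "(\<lambda>j. hcomp A (d j) ((v(i := x)) j)) = (\<lambda>j. hcomp A (d j) (v j))(i := hcomp A (d i) x)"
      for v i x by (auto simp: fun_eq_iff)
    have args: "args_in U n (\<lambda>j. hcomp A (d j) (v j))" if "args_in U n v" for v
      using that U by (simp add: args_in_def graded_submodule_def)
    have closed: "der A x \<in> U" "hcomp A e x \<in> U" "c *s x \<in> U" if "x \<in> U" for x c e
      using U that by (auto simp: graded_submodule_def subspace_scale)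
    have closed_add: "x + y \<in> U" if "x \<in> U" "y \<in> U" for x y
      using U that by (auto simp: graded_submodule_def subspace_add)
    have vi: "v i \<in> U" if "args_in U n v" "i \<in> {1..n}" for v i
      using that by (simp add: args_in_def)
    show ?thesis
    proof (rule sesquiI)
      fix u v :: "nat \<Rightarrow> 'v" assume *: "\<And>j. j \<in> {1..n} \<Longrightarrow> u j = v j"
      then have "T d (\<lambda>j. hcomp A (d j) (u j)) = T d (\<lambda>j. hcomp A (d j) (v j))"
        by (intro sesqui_cong[OF Td]) simp
      moreover have "args_in U n u \<longleftrightarrow> args_in U n v"
        using * by (simp add: args_in_def)
      ultimately show "(if args_in U n u then T d (\<lambda>j. hcomp A (d j) (u j)) else 0) =
          (if args_in U n v then T d (\<lambda>j. hcomp A (d j) (v j)) else 0)"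
        by simp
    next
      fix v :: "nat \<Rightarrow> 'v" and i assume *: "args_in U n v" "i \<in> {1..n}"
      then show "(if args_in U n (v(i := der A (v i)))
            then T d (\<lambda>j. hcomp A (d j) ((v(i := der A (v i))) j)) else 0) =
          - (a i *s (if args_in U n v then T d (\<lambda>j. hcomp A (d j) (v j)) else 0))"
        using sesqui_der_arg[OF Td args[OF *(1)] *(2)]
        by (simp only: upd args_in_upd closed(1)[OF vi[OF *]] hcomp_A_der if_True)
    qed (simp_all add: upd args args_in_upd closed closed_add hcomp_A_add hcomp_A_scale
        sesqui_add_arg[OF Td] sesqui_scale_arg[OF Td] del: atLeastAtMost_iff fun_upd_apply)
  qed
  then have "sesqui U n a (\<lambda>v. \<Sum>d\<in>degrees n.
      if args_in U n v then T d (\<lambda>j. hcomp A (d j) (v j)) else 0)"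
    by (rule sesqui_sum)
  also have "(\<lambda>v. \<Sum>d\<in>degrees n. if args_in U n v then T d (\<lambda>j. hcomp A (d j) (v j)) else 0) =
      (\<lambda>v. if args_in U n v then \<Sum>d\<in>degrees n. T d (\<lambda>j. hcomp A (d j) (v j)) else 0)"
    by (auto simp: fun_eq_iff)
  finally show ?thesis .
qed

text \<open>On homogeneous arguments only the term of their own degrees survives: any other term has a zero argument.\<close>

lemma polarize_homog:
  assumes T: "\<And>d. d \<in> degrees n \<Longrightarrow> sesqui U n a (T d)" and v: "homog U n \<delta> v"
  shows "(\<Sum>d\<in>degrees n. T d (\<lambda>j. hcomp A (d j) (v j))) = T (restrict \<delta> {1..n}) v"
proof -
  let ?\<delta> = "restrict \<delta> {1..n}"
  have UNIV_bit: "b \<in> {0, 1}" for b :: bit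
    by (cases b rule: bit_cases) auto
  have \<delta>: "?\<delta> \<in> degrees n"
    using UNIV_bit by (auto simp: PiE_def extensional_def)
  have "T d (\<lambda>j. hcomp A (d j) (v j)) = 0" if d: "d \<in> degrees n" "d \<noteq> ?\<delta>" for d
  proof -
    have "\<exists>j\<in>{1..n}. d j \<noteq> \<delta> j"
      using d(2) PiE_ext[OF d(1) \<delta>] by force
    then obtain j where j: "j \<in> {1..n}" "d j \<noteq> \<delta> j" by blast
    have "v j \<in> part A (\<delta> j)"
      using v j(1) by (simp add: homog_def)
    then have "hcomp A (d j) (v j) = 0"
      using j(2) by (simp add: hcomp_part)
    then show ?thesis
      using sesqui_zero_arg[OF T[OF d(1)] j(1)] by simp
  qed
  then have "(\<Sum>d\<in>degrees n. T d (\<lambda>j. hcomp A (d j) (v j))) =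
      (\<Sum>d\<in>{?\<delta>}. T d (\<lambda>j. hcomp A (d j) (v j)))"
    using \<delta> finite_degrees by (intro sum.mono_neutral_right) auto
  also have "\<dots> = T ?\<delta> (\<lambda>j. hcomp A (?\<delta> j) (v j))"
    by simp
  also have "\<dots> = T ?\<delta> v"
    using v by (intro sesqui_cong[OF T[OF \<delta>]]) (simp add: homog_def hcomp_same)
  finally show ?thesis .
qed

text \<open>Splitting the arguments one after the other into homogeneous components.\<close>

lemma sesqui_expand:
  assumes \<Phi>: "sesqui U n a \<Phi>" and U: "graded_submodule U" and v: "args_in U n v"
  shows "(\<Sum>d\<in>degrees n. \<Phi> (\<lambda>j. hcomp A (d j) (v j))) = \<Phi> v"
proof -
  have "(\<Sum>d\<in>K \<rightarrow>\<^sub>E {0, 1}. \<Phi> (\<lambda>j. if j \<in> K then hcomp A (d j) (v j) else v j)) = \<Phi> v"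
    if "finite K" "K \<subseteq> {1..n}" for K
    using that
  proof (induction K rule: finite_induct)
    case empty
    then show ?case by simp
  next
    case (insert i K)
    let ?w = "\<lambda>d j. if j \<in> K then hcomp A (d j) (v j) else v j"
    let ?w' = "\<lambda>d j. if j \<in> insert i K then hcomp A (d j) (v j) else v j"
    have args: "args_in U n (?w d)" for d
      using v U by (auto simp: args_in_def graded_submodule_def)
    have step: "\<Phi> ((?w d)(i := hcomp A 0 (v i))) + \<Phi> ((?w d)(i := hcomp A 1 (v i))) = \<Phi> (?w d)" for d
    proof -
      have "v i \<in> U" using v insert.prems by (auto simp: args_in_def)
      then have "hcomp A e (v i) \<in> U" for e
        using U by (simp add: graded_submodule_def)
      then have "\<Phi> ((?w d)(i := hcomp A 0 (v i) + hcomp A 1 (v i))) =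
          \<Phi> ((?w d)(i := hcomp A 0 (v i))) + \<Phi> ((?w d)(i := hcomp A 1 (v i)))"
        using insert.prems by (intro sesqui_add_arg[OF \<Phi> args]) auto
      then show ?thesis
        using insert.hyps by (simp add: sum_hcomp fun_upd_idem)
    qed
    have "(\<Sum>d\<in>insert i K \<rightarrow>\<^sub>E {0, 1}. \<Phi> (?w' d)) =
        (\<Sum>(e, d)\<in>{0, 1} \<times> (K \<rightarrow>\<^sub>E {0, 1}). \<Phi> (?w' (d(i := e))))"
      unfolding PiE_insert_eq
      by (subst sum.reindex[OF inj_combinator[OF insert.hyps(2)]]) (simp add: case_prod_unfold)
    also have "\<dots> = (\<Sum>(e, d)\<in>{0, 1} \<times> (K \<rightarrow>\<^sub>E {0, 1}). \<Phi> ((?w d)(i := hcomp A e (v i))))"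
      using insert.hyps by (intro sum.cong refl) (auto intro!: arg_cong[of _ _ \<Phi>])
    also have "\<dots> = (\<Sum>d\<in>K \<rightarrow>\<^sub>E {0, 1}. \<Phi> ((?w d)(i := hcomp A 0 (v i))) + \<Phi> ((?w d)(i := hcomp A 1 (v i))))"
      by (simp add: sum.cartesian_product[symmetric] sum.distrib)
    also have "\<dots> = \<Phi> v"
      unfolding step using insert by simp
    finally show ?case .
  qed
  from this[of "{1..n}"]
  have "(\<Sum>d\<in>degrees n. \<Phi> (\<lambda>j. if j \<in> {1..n} then hcomp A (d j) (v j) else v j)) = \<Phi> v"
    by simp
  moreover have "\<Phi> (\<lambda>j. if j \<in> {1..n} then hcomp A (d j) (v j) else v j) =
      \<Phi> (\<lambda>j. hcomp A (d j) (v j))" for d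
    by (intro sesqui_cong[OF \<Phi>]) simp
  ultimately show ?thesis by simp
qed

lemma sesqui_eqI:
  assumes \<Phi>: "sesqui U n a \<Phi>" and \<Psi>: "sesqui U n b \<Psi>" and U: "graded_submodule U"
    and eq: "\<And>d v. homog U n d v \<Longrightarrow> \<Phi> v = \<Psi> v"
  shows "\<Phi> v = \<Psi> v"
proof (cases "args_in U n v")
  case True
  have "homog U n d (\<lambda>j. hcomp A (d j) (v j))" for d
    using True U by (simp add: homog_def args_in_def graded_submodule_def part_hcomp)
  then have "\<Phi> (\<lambda>j. hcomp A (d j) (v j)) = \<Psi> (\<lambda>j. hcomp A (d j) (v j))" for d
    by (rule eq)
  then show ?thesis
    using sesqui_expand[OF \<Phi> U True] sesqui_expand[OF \<Psi> U True] by simp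
qed (use sesqui_outside[OF \<Phi>] sesqui_outside[OF \<Psi>] in simp)

end

section \<open>Koszul signs and composition of permutations\<close>

lemma bit_add_self [simp]: "a + a = 0" for a :: bit
  by (cases a rule: bit_cases) auto

lemma parity_sign_add: "parity_sign (a + b) = parity_sign a * parity_sign b"
  by (cases a rule: bit_cases; cases b rule: bit_cases) (auto simp: parity_sign_def)

lemma parity_sign_0 [simp]: "parity_sign 0 = 1"
  by (simp add: parity_sign_def)

lemma parity_sign_sum: "parity_sign (\<Sum>i\<in>I. a i) = (\<Prod>i\<in>I. parity_sign (a i))"
  by (induction I rule: infinite_finite_induct) (auto simp: parity_sign_add)

definition index_pairs :: "nat \<Rightarrow> (nat \<times> nat) set" where
  "index_pairs n = {(i, j). 1 \<le> i \<and> i < j \<and> j \<le> n}"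

lemma index_pairs_iff: "(i, j) \<in> index_pairs n \<longleftrightarrow> 1 \<le> i \<and> i < j \<and> j \<le> n"
  by (simp add: index_pairs_def)

lemma finite_index_pairs [simp]: "finite (index_pairs n)"
  by (rule finite_subset[of _ "{1..n} \<times> {1..n}"]) (auto simp: index_pairs_def)

text \<open>
  The exponent of the Koszul sign, as an element of \<open>\<int>/2\<int>\<close>. Sign identities become identities
  between sums in characteristic 2, where equal terms cancel.
\<close>

definition inversion_sum :: "nat \<Rightarrow> (nat \<Rightarrow> bit) \<Rightarrow> (nat \<Rightarrow> nat) \<Rightarrow> bit" where
  "inversion_sum n d \<sigma> = (\<Sum>(i, j)\<in>index_pairs n. if \<sigma> j < \<sigma> i then d i * d j else 0)"

lemma koszul_sign_inversion_sum: "koszul_sign n d \<sigma> = parity_sign (inversion_sum n d \<sigma>)"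
proof -
  have "koszul_sign n d \<sigma> = (\<Prod>(i, j)\<in>{p\<in>index_pairs n. \<sigma> (snd p) < \<sigma> (fst p)}. parity_sign (d i * d j))"
    unfolding koszul_sign_def index_pairs_def by (rule prod.cong) auto
  also have "\<dots> = (\<Prod>p\<in>index_pairs n.
      if \<sigma> (snd p) < \<sigma> (fst p) then case p of (i, j) \<Rightarrow> parity_sign (d i * d j) else 1)"
    by (rule prod.inter_filter) simp
  also have "\<dots> = parity_sign (inversion_sum n d \<sigma>)"
    unfolding inversion_sum_def parity_sign_sum by (rule prod.cong) auto
  finally show ?thesis .
qed

lemma inversion_sum_cong:
  "(\<And>j. j \<in> {1..n} \<Longrightarrow> d j = d' j) \<Longrightarrow> inversion_sum n d \<sigma> = inversion_sum n d' \<sigma>"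
  unfolding inversion_sum_def by (rule sum.cong) (auto simp: index_pairs_iff)

lemma koszul_sign_cong:
  "(\<And>j. j \<in> {1..n} \<Longrightarrow> d j = d' j) \<Longrightarrow> koszul_sign n d \<sigma> = koszul_sign n d' \<sigma>"
  using inversion_sum_cong[of n d d' \<sigma>] by (simp add: koszul_sign_inversion_sum)

lemma inversion_sum_id: "inversion_sum n d id = 0"
  unfolding inversion_sum_def by (rule sum.neutral) (auto simp: index_pairs_iff)

text \<open>
  A symmetric function of two positions can be summed over unordered pairs; a permutation
  only renames these.
\<close>

lemma sum_index_pairs_permute:
  assumes \<tau>: "\<tau> permutes {1..n}" and sym: "\<And>i j. i \<noteq> j \<Longrightarrow> h i j = h j i"
  shows "(\<Sum>(i, j)\<in>index_pairs n. h (\<tau> i) (\<tau> j)) = (\<Sum>(i, j)\<in>index_pairs n. h i j)"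
proof -
  have mem: "inv \<tau> j \<in> {1..n} \<longleftrightarrow> j \<in> {1..n}" "\<tau> j \<in> {1..n} \<longleftrightarrow> j \<in> {1..n}" for j
    using permutes_in_image[OF \<tau>] permutes_in_image[OF permutes_inv[OF \<tau>]] by blast+
  have inv [simp]: "inv \<tau> (\<tau> j) = j" "\<tau> (inv \<tau> j) = j" for j
    using permutes_inverses[OF \<tau>] by auto
  have pairs: "(i, j) \<in> index_pairs n \<longleftrightarrow> i \<in> {1..n} \<and> j \<in> {1..n} \<and> i < j" for i j
    by (auto simp: index_pairs_iff)
  have eq_iff: "\<tau> i = \<tau> j \<longleftrightarrow> i = j" "inv \<tau> i = inv \<tau> j \<longleftrightarrow> i = j" for i j
    using inv by metis+
  let ?sort = "\<lambda>i j. if i < j then (i, j) else (j, i)"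
  show ?thesis
  proof (rule sum.reindex_bij_witness[where
        i = "\<lambda>(p, q). ?sort (inv \<tau> p) (inv \<tau> q)" and j = "\<lambda>(i, j). ?sort (\<tau> i) (\<tau> j)"];
      clarsimp simp only: pairs split: prod.splits if_splits)
  qed (use mem sym in \<open>auto simp: pairs eq_iff not_less order.order_iff_strict simp del: atLeastAtMost_iff split: if_splits\<close>)
qed

text \<open>
  For a pair \<open>i < j\<close>, the composite inverts it exactly if one, but not both, of \<open>\<tau>\<close> on \<open>(i, j)\<close> and
  \<open>\<sigma>\<close> on the pair \<open>{\<tau> i, \<tau> j}\<close> causes an inversion. Modulo 2 this is additivity.
\<close>

lemma inversion_sum_comp:
  assumes \<tau>: "\<tau> permutes {1..n}" and \<sigma>: "inj \<sigma>"
  shows "inversion_sum n d (\<sigma> \<circ> \<tau>) = inversion_sum n d \<tau> + inversion_sum n (\<lambda>j. d (inv \<tau> j)) \<sigma>"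
proof -
  have inv [simp]: "inv \<tau> (\<tau> j) = j" for j
    using permutes_inverses[OF \<tau>] by auto
  let ?h = "\<lambda>p q. if (p < q) = (\<sigma> q < \<sigma> p) then d (inv \<tau> p) * d (inv \<tau> q) else 0"
  have "?h p q = ?h q p" if "p \<noteq> q" for p q
    using that injD[OF \<sigma>, of p q] by (auto simp: mult.commute)
  then have "(\<Sum>(i, j)\<in>index_pairs n. ?h (\<tau> i) (\<tau> j)) = (\<Sum>(i, j)\<in>index_pairs n. ?h i j)"
    by (rule sum_index_pairs_permute[OF \<tau>])
  also have "\<dots> = inversion_sum n (\<lambda>j. d (inv \<tau> j)) \<sigma>"
    unfolding inversion_sum_def by (rule sum.cong) (auto simp: index_pairs_iff)
  finally have "inversion_sum n d \<tau> + inversion_sum n (\<lambda>j. d (inv \<tau> j)) \<sigma> =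
      (\<Sum>(i, j)\<in>index_pairs n. (if \<tau> j < \<tau> i then d i * d j else 0) + ?h (\<tau> i) (\<tau> j))"
    by (simp add: inversion_sum_def sum.distrib case_prod_unfold)
  also have "\<dots> = inversion_sum n d (\<sigma> \<circ> \<tau>)"
    unfolding inversion_sum_def
  proof (rule sum.cong, rule refl, clarify)
    fix i j assume "(i, j) \<in> index_pairs n"
    then have "\<tau> i \<noteq> \<tau> j"
      using inv by (metis index_pairs_iff less_irrefl)
    then show "(if \<tau> j < \<tau> i then d i * d j else 0) + ?h (\<tau> i) (\<tau> j) =
        (if (\<sigma> \<circ> \<tau>) j < (\<sigma> \<circ> \<tau>) i then d i * d j else 0)"
      by auto
  qed
  finally show ?thesis by simp
qed

lemma koszul_sign_comp:
  assumes "\<tau> permutes {1..n}" "\<sigma> permutes {1..n}"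
  shows "koszul_sign n d (\<sigma> \<circ> \<tau>) = koszul_sign n d \<tau> * koszul_sign n (\<lambda>j. d (inv \<tau> j)) \<sigma>"
  by (simp add: koszul_sign_inversion_sum inversion_sum_comp[OF assms(1) permutes_inj[OF assms(2)]]
      parity_sign_add)

text \<open>
  \<open>graft i m x w\<close> is \<open>(w\<^sub>1, \<dots>, w\<^sub>i\<^sub>-\<^sub>1, x, w\<^sub>i\<^sub>+\<^sub>m, \<dots>)\<close>: the entries \<open>w\<^sub>i, \<dots>, w\<^sub>i\<^sub>+\<^sub>m\<^sub>-\<^sub>1\<close>, which form
  \<open>block i w\<close>, are replaced by the single entry \<open>x\<close>. The same operation serves for arguments, for
  points and for degrees.
\<close>

definition graft :: "nat \<Rightarrow> nat \<Rightarrow> 'a \<Rightarrow> (nat \<Rightarrow> 'a) \<Rightarrow> nat \<Rightarrow> 'a" where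
  "graft i m x w j = (if j < i then w j else if j = i then x else w (j + m - 1))"

definition block :: "nat \<Rightarrow> (nat \<Rightarrow> 'a) \<Rightarrow> nat \<Rightarrow> 'a" where
  "block i w j = w (j + i - 1)"

lemma sum_block:
  assumes "1 \<le> i"
  shows "(\<Sum>j\<in>{1..m}. block i w j) = (\<Sum>j\<in>{i..<i + m}. w j)"
  by (rule sum.reindex_bij_witness[of _ "\<lambda>j. j + 1 - i" "\<lambda>j. j + i - 1"])
     (use assms in \<open>auto simp: block_def\<close>)

lemma sum_graft:
  fixes w :: "nat \<Rightarrow> 'a::comm_monoid_add"
  assumes "1 \<le> i" "i \<le> n"
  shows "(\<Sum>j\<in>{1..n}. graft i m x w j) + (\<Sum>j\<in>{i..<i + m}. w j) = x + (\<Sum>j\<in>{1..m + n - 1}. w j)"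
proof -
  have union: "(\<Sum>j\<in>B \<union> C. y j) = (\<Sum>j\<in>B. y j) + (\<Sum>j\<in>C. y j)"
    if "finite B" "finite C" "B \<inter> C = {}" for B C and y :: "nat \<Rightarrow> 'a"
    using that by (rule sum.union_disjoint)
  have "{1..n} = ({1..<i} \<union> {i}) \<union> {i<..n}"
    using assms by auto
  then have "(\<Sum>j\<in>{1..n}. graft i m x w j) =
      (\<Sum>j\<in>{1..<i}. graft i m x w j) + graft i m x w i + (\<Sum>j\<in>{i<..n}. graft i m x w j)"
    by (simp only:) (subst union; auto simp: add.commute)
  also have "(\<Sum>j\<in>{1..<i}. graft i m x w j) = (\<Sum>j\<in>{1..<i}. w j)"
    by (rule sum.cong) (auto simp: graft_def)
  also have "(\<Sum>j\<in>{i<..n}. graft i m x w j) = (\<Sum>j\<in>{i + m..m + n - 1}. w j)"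
    by (rule sum.reindex_bij_witness[of _ "\<lambda>j. j + 1 - m" "\<lambda>j. j + m - 1"])
       (use assms in \<open>auto simp: graft_def\<close>)
  finally have *: "(\<Sum>j\<in>{1..n}. graft i m x w j) =
      (\<Sum>j\<in>{1..<i}. w j) + x + (\<Sum>j\<in>{i + m..m + n - 1}. w j)"
    by (simp add: graft_def)
  have "{1..m + n - 1} = ({1..<i} \<union> {i..<i + m}) \<union> {i + m..m + n - 1}"
    using assms by auto
  then have "(\<Sum>j\<in>{1..m + n - 1}. w j) =
      (\<Sum>j\<in>{1..<i}. w j) + (\<Sum>j\<in>{i..<i + m}. w j) + (\<Sum>j\<in>{i + m..m + n - 1}. w j)"
    by (simp only:) (subst union; auto simp: union)
  then show ?thesis
    unfolding * by (simp add: ac_simps)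
qed

lemma permutes_interval_bounds:
  assumes "\<sigma> permutes {1..n::nat}"
  shows "1 \<le> \<sigma> j \<longleftrightarrow> 1 \<le> j" "\<sigma> j \<le> n \<longleftrightarrow> j \<le> n"
proof -
  have "\<sigma> 0 = 0" using permutes_not_in[OF assms, of 0] by simp
  then have 0: "\<sigma> j = 0 \<longleftrightarrow> j = 0"
    using permutes_inj[OF assms] by (metis injD)
  then show "1 \<le> \<sigma> j \<longleftrightarrow> 1 \<le> j" by (metis less_one linorder_not_less)
  then show "\<sigma> j \<le> n \<longleftrightarrow> j \<le> n"
    using permutes_in_image[OF assms, of j] \<open>\<sigma> 0 = 0\<close> by (cases "j = 0") auto
qed

lemma inner_perm_inverse:
  assumes \<tau>: "\<tau> permutes {1..m}" and i: "1 \<le> i"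
  shows "inner_perm m i (inv \<tau>) (inner_perm m i \<tau> k) = k"
proof (cases "i \<le> k \<and> k < i + m")
  case True
  then have "\<tau> (k + 1 - i) \<in> {1..m}"
    using permutes_in_image[OF \<tau>, of "k + 1 - i"] by auto
  then have "inner_perm m i (inv \<tau>) (inner_perm m i \<tau> k) = i + inv \<tau> (\<tau> (k + 1 - i)) - 1"
    using True i by (auto simp: inner_perm_def)
  then show ?thesis
    using True permutes_inverses(2)[OF \<tau>] by simp
qed (auto simp: inner_perm_def)

lemma block_perm_inverse:
  assumes \<sigma>: "\<sigma> permutes {1..n}" and i: "1 \<le> i"
  shows "block_perm m (\<sigma> i) (inv \<sigma>) (block_perm m i \<sigma> k) = k"
proof (cases "i \<le> k \<and> k < i + m")
  case True
  then show ?thesis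
    using permutes_inverses(2)[OF \<sigma>] by (auto simp: block_perm_def)
next
  case False
  define b where "b = (if k < i then k else k + 1 - m)"
  have \<sigma>i: "1 \<le> \<sigma> i"
    using permutes_interval_bounds(1)[OF \<sigma>] i by simp
  have "b \<noteq> i" using False i by (auto simp: b_def)
  then have "\<sigma> b \<noteq> \<sigma> i"
    using permutes_inj[OF \<sigma>] by (metis injD)
  have bk: "block_perm m i \<sigma> k = (if \<sigma> b < \<sigma> i then \<sigma> b else \<sigma> b + m - 1)"
    using False by (auto simp: block_perm_def b_def Let_def)
  have inv: "inv \<sigma> (\<sigma> x) = x" for x
    using permutes_inverses(2)[OF \<sigma>] .
  show ?thesis
  proof (cases "\<sigma> b < \<sigma> i")
    case True
    then have "block_perm m (\<sigma> i) (inv \<sigma>) (block_perm m i \<sigma> k) = (if b < i then b else b + m - 1)"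
      unfolding bk by (simp add: block_perm_def[of m "\<sigma> i"] inv)
    then show ?thesis
      using False i by (auto simp: b_def split: if_splits)
  next
    case ge: False
    then have "\<not> (\<sigma> b + m - 1 < \<sigma> i + m)" "\<not> (\<sigma> b + m - 1 < \<sigma> i)" "\<sigma> b + m - 1 + 1 - m = \<sigma> b"
      using \<open>\<sigma> b \<noteq> \<sigma> i\<close> \<sigma>i by auto
    then have "block_perm m (\<sigma> i) (inv \<sigma>) (block_perm m i \<sigma> k) = (if b < i then b else b + m - 1)"
      using ge unfolding bk by (simp add: block_perm_def[of m "\<sigma> i"] inv Let_def)
    then show ?thesis
      using False i by (auto simp: b_def split: if_splits)
  qed
qed

text \<open>
  With an explicit inverse at hand, bijectivity of the block permutations needs no counting; the same
  inverse gives \<open>inv_perm_comp\<close>.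
\<close>

lemma permutes_if_inverse:
  assumes "\<And>k. k \<notin> S \<Longrightarrow> p k = k" "\<And>k. q (p k) = k" "\<And>k. p (q k) = k"
  shows "p permutes S"
  unfolding permutes_def using assms by metis

lemma inner_perm_inverse':
  assumes "\<tau> permutes {1..m}" "1 \<le> i"
  shows "inner_perm m i \<tau> (inner_perm m i (inv \<tau>) k) = k"
  using inner_perm_inverse[OF permutes_inv[OF assms(1)] assms(2), of k]
  by (simp add: permutes_inv_inv[OF assms(1)])

lemma block_perm_inverse':
  assumes "\<sigma> permutes {1..n}" "1 \<le> i"
  shows "block_perm m i \<sigma> (block_perm m (\<sigma> i) (inv \<sigma>) k) = k"
  using block_perm_inverse[OF permutes_inv[OF assms(1)], of "\<sigma> i" m k] assms(2)
    permutes_interval_bounds(1)[OF assms(1), of i]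
  by (simp add: permutes_inv_inv[OF assms(1)] permutes_inverses(2)[OF assms(1)])

lemma inner_perm_permutes:
  assumes \<tau>: "\<tau> permutes {1..m}" and i: "1 \<le> i" "i \<le> n"
  shows "inner_perm m i \<tau> permutes {1..m + n - 1}"
proof (rule permutes_if_inverse[where q = "inner_perm m i (inv \<tau>)"])
  show "inner_perm m i \<tau> k = k" if "k \<notin> {1..m + n - 1}" for k
    using that i by (auto simp: inner_perm_def)
qed (simp_all add: inner_perm_inverse[OF \<tau> i(1)] inner_perm_inverse'[OF \<tau> i(1)])

lemma block_perm_permutes:
  assumes \<sigma>: "\<sigma> permutes {1..n}" and i: "1 \<le> i" "i \<le> n"
  shows "block_perm m i \<sigma> permutes {1..m + n - 1}"
proof (rule permutes_if_inverse[where q = "block_perm m (\<sigma> i) (inv \<sigma>)"])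
  fix k assume k: "k \<notin> {1..m + n - 1}"
  have \<sigma>i: "1 \<le> \<sigma> i" "\<sigma> i \<le> n"
    using permutes_interval_bounds[OF \<sigma>] i by simp_all
  show "block_perm m i \<sigma> k = k"
  proof (cases "k = 0")
    case True
    moreover have "\<sigma> 0 = 0" using permutes_not_in[OF \<sigma>, of 0] by simp
    ultimately show ?thesis using i \<sigma>i by (simp add: block_perm_def)
  next
    case False
    then have "m + n \<le> k" using k by auto
    moreover from this have "\<sigma> (k + 1 - m) = k + 1 - m"
      by (intro permutes_not_in[OF \<sigma>]) auto
    ultimately show ?thesis using i \<sigma>i by (auto simp: block_perm_def Let_def)
  qed
qed (simp_all add: block_perm_inverse[OF \<sigma> i(1)] block_perm_inverse'[OF \<sigma> i(1)])

lemma perm_comp_permutes: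
  assumes "\<sigma> permutes {1..n}" "\<tau> permutes {1..m}" "1 \<le> i" "i \<le> n"
  shows "perm_comp m i \<sigma> \<tau> permutes {1..m + n - 1}"
  unfolding perm_comp_def
  using inner_perm_permutes[OF assms(2-4)] block_perm_permutes[OF assms(1,3,4)]
  by (rule permutes_compose)

lemma inv_perm_comp:
  assumes "\<sigma> permutes {1..n}" "\<tau> permutes {1..m}" "1 \<le> i" "i \<le> n"
  shows "inv (perm_comp m i \<sigma> \<tau>) k = inner_perm m i (inv \<tau>) (block_perm m (\<sigma> i) (inv \<sigma>) k)"
  by (rule inv_f_eq[OF permutes_inj[OF perm_comp_permutes[OF assms]]])
     (simp add: perm_comp_def inner_perm_inverse'[OF assms(2,3)] block_perm_inverse'[OF assms(1,3)])

text \<open>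
  These two lemmas are the combinatorial content of equivariance: the arguments permuted by
  \<open>\<sigma> \<circ>\<^sub>i \<tau>\<close>, cut at position \<open>\<sigma> i\<close>, are the arguments cut at position \<open>i\<close> and then permuted by \<open>\<tau>\<close>
  inside the block and by \<open>\<sigma>\<close> outside.
\<close>

lemma block_perm_comp:
  assumes "\<sigma> permutes {1..n}" "\<tau> permutes {1..m}" "1 \<le> i" "i \<le> n" and j: "j \<in> {1..m}"
  shows "block (\<sigma> i) (\<lambda>k. x (inv (perm_comp m i \<sigma> \<tau>) k)) j = block i x (inv \<tau> j)"
proof -
  have "1 \<le> \<sigma> i"
    using permutes_interval_bounds[OF assms(1)] assms(3) by simp
  then have "block_perm m (\<sigma> i) (inv \<sigma>) (j + \<sigma> i - 1) = i + j - 1"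
    using j permutes_inverses(2)[OF assms(1)] by (auto simp: block_perm_def)
  moreover have "inner_perm m i (inv \<tau>) (i + j - 1) = inv \<tau> j + i - 1"
    using j assms(3) by (auto simp: inner_perm_def add.commute)
  ultimately show ?thesis
    by (simp add: block_def inv_perm_comp[OF assms(1-4)])
qed

lemma graft_perm_comp:
  assumes "\<sigma> permutes {1..n}" "\<tau> permutes {1..m}" "1 \<le> i" "i \<le> n" and j: "j \<in> {1..n}"
  shows "graft (\<sigma> i) m y (\<lambda>k. x (inv (perm_comp m i \<sigma> \<tau>) k)) j = graft i m y x (inv \<sigma> j)"
proof (cases "j = \<sigma> i")
  case True
  then show ?thesis
    using permutes_inverses(2)[OF assms(1)] by (simp add: graft_def)
next
  case False
  define b where "b = inv \<sigma> j"
  have b: "\<sigma> b = j" "inv \<sigma> (\<sigma> i) = i"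
    using permutes_inverses[OF assms(1)] by (auto simp: b_def)
  then have "b \<noteq> i" using False by auto
  have \<sigma>i: "1 \<le> \<sigma> i"
    using permutes_interval_bounds[OF assms(1)] assms(3) by simp
  have "block_perm m (\<sigma> i) (inv \<sigma>) (if j < \<sigma> i then j else j + m - 1) = (if b < i then b else b + m - 1)"
    using False \<sigma>i b(2) by (auto simp: block_perm_def Let_def simp flip: b_def)
  moreover have "inner_perm m i (inv \<tau>) (if b < i then b else b + m - 1) = (if b < i then b else b + m - 1)"
    using \<open>b \<noteq> i\<close> by (auto simp: inner_perm_def)
  ultimately have "inv (perm_comp m i \<sigma> \<tau>) (if j < \<sigma> i then j else j + m - 1) = (if b < i then b else b + m - 1)"
    by (simp add: inv_perm_comp[OF assms(1-4)])
  then show ?thesis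
    using False \<open>b \<noteq> i\<close> by (auto simp: graft_def simp flip: b_def split: if_splits)
qed

text \<open>The permutation moves nothing outside the block, so all its inversions lie inside.\<close>

lemma inversion_sum_inner_perm:
  assumes \<tau>: "\<tau> permutes {1..m}" and i: "1 \<le> i" "i \<le> n"
  shows "inversion_sum (m + n - 1) d (inner_perm m i \<tau>) = inversion_sum m (block i d) \<tau>"
proof -
  have \<tau>k: "\<tau> (k + 1 - i) \<in> {1..m}" if "i \<le> k" "k < i + m" for k
    using permutes_in_image[OF \<tau>, of "k + 1 - i"] that by auto
  have \<tau>: "1 \<le> \<tau> k \<and> \<tau> k \<le> m" if "1 \<le> k" "k \<le> m" for k
    using permutes_in_image[OF \<tau>, of k] that by auto
  have inside: "i \<le> k \<and> l < i + m" if "inner_perm m i \<tau> l < inner_perm m i \<tau> k" "k < l" for k l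
    using that \<tau>k[of k] \<tau>k[of l] by (auto simp: inner_perm_def split: if_splits)
  have "inversion_sum m (block i d) \<tau> = (\<Sum>(k, l)\<in>{(k, l). i \<le> k \<and> k < l \<and> l < i + m}.
      if inner_perm m i \<tau> l < inner_perm m i \<tau> k then d k * d l else 0)"
    unfolding inversion_sum_def
  proof (rule sum.reindex_bij_witness[of _ "\<lambda>(k, l). (k + 1 - i, l + 1 - i)" "\<lambda>(k, l). (k + i - 1, l + i - 1)"])
    fix p assume "p \<in> index_pairs m"
    then obtain k l where p: "p = (k, l)" "1 \<le> k" "k < l" "l \<le> m"
      by (auto simp: index_pairs_def)
    then have "inner_perm m i \<tau> (k + i - 1) = i + \<tau> k - 1" "inner_perm m i \<tau> (l + i - 1) = i + \<tau> l - 1"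
      using i by (auto simp: inner_perm_def)
    then show "(case case p of (k, l) \<Rightarrow> (k + i - 1, l + i - 1) of
        (k, l) \<Rightarrow> if inner_perm m i \<tau> l < inner_perm m i \<tau> k then d k * d l else 0) =
        (case p of (k, l) \<Rightarrow> if \<tau> l < \<tau> k then block i d k * block i d l else 0)"
      using \<tau>[of k] \<tau>[of l] p i by (auto simp: block_def)
  qed (use i in \<open>auto simp: index_pairs_iff\<close>)
  also have "\<dots> = inversion_sum (m + n - 1) d (inner_perm m i \<tau>)"
    unfolding inversion_sum_def
    by (rule sum.mono_neutral_left) (use i inside in \<open>auto simp: index_pairs_iff split: if_splits\<close>)
  finally show ?thesis by simp
qed

text \<open>
  Blocks keep their inner order, so a pair of positions is inverted exactly if their blocks are.
  Grouping positions by blocks turns \<open>d\<^sub>k d\<^sub>l\<close> into the product of the total degrees of two blocks.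
\<close>

lemma inversion_sum_block_perm:
  assumes \<sigma>: "\<sigma> permutes {1..n}" and i: "1 \<le> i" "i \<le> n"
  shows "inversion_sum (m + n - 1) d (block_perm m i \<sigma>) =
    inversion_sum n (graft i m (\<Sum>j\<in>{i..<i + m}. d j) d) \<sigma>"
proof -
  \<comment> \<open>\<open>\<beta> k\<close> is the number of the block that contains position \<open>k\<close>.\<close>
  define \<beta> where "\<beta> k = (if k < i then k else if k < i + m then i else k + 1 - m)" for k
  let ?K = "{1..m + n - 1}" and ?D = "graft i m (\<Sum>j\<in>{i..<i + m}. d j) d"
  have \<beta>: "\<beta> k \<in> {1..n}" if "k \<in> ?K" for k
    using that i by (auto simp: \<beta>_def)
  have D: "(\<Sum>k\<in>{k\<in>?K. \<beta> k = b}. d k) = ?D b" if b: "b \<in> {1..n}" for b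
  proof -
    have "{k\<in>?K. \<beta> k = b} = (if b < i then {b} else if b = i then {i..<i + m} else {b + m - 1})"
      using b i by (auto simp: \<beta>_def split: if_splits)
    then show ?thesis by (auto simp: graft_def)
  qed
  have \<sigma>i: "1 \<le> \<sigma> i"
    using permutes_interval_bounds[OF \<sigma>] i by simp
  have inv: "(k < l \<and> block_perm m i \<sigma> l < block_perm m i \<sigma> k) \<longleftrightarrow> (\<beta> k < \<beta> l \<and> \<sigma> (\<beta> l) < \<sigma> (\<beta> k))" for k l
  proof -
    have \<rho>: "block_perm m i \<sigma> k =
        (if i \<le> k \<and> k < i + m then \<sigma> i + (k - i) else if \<sigma> (\<beta> k) < \<sigma> i then \<sigma> (\<beta> k) else \<sigma> (\<beta> k) + m - 1)" for k
      by (auto simp: block_perm_def \<beta>_def Let_def)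
    have ne: "\<sigma> (\<beta> k) \<noteq> \<sigma> i" if "\<not> (i \<le> k \<and> k < i + m)" for k
    proof -
      have "\<beta> k \<noteq> i" using that i by (auto simp: \<beta>_def)
      then show ?thesis using permutes_inj[OF \<sigma>] by (metis injD)
    qed
    have \<beta>i: "\<beta> k = i" if "i \<le> k \<and> k < i + m" for k
      using that by (simp add: \<beta>_def)
    have less: "\<beta> k < \<beta> l \<longleftrightarrow> k < l" if "\<not> (i \<le> k \<and> k < i + m \<and> i \<le> l \<and> l < i + m)" for k l
      using that i by (auto simp: \<beta>_def)
    show ?thesis
      using \<beta>i[of k] \<beta>i[of l] ne[of k] ne[of l] less[of k l] \<sigma>i unfolding \<rho>
      by (auto split: if_splits)
  qed
  define h where "h b c = (if b < c \<and> \<sigma> c < \<sigma> b then 1 else 0 :: bit)" for b c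
  have h_\<beta>: "h (\<beta> k) (\<beta> l) = (if k < l \<and> block_perm m i \<sigma> l < block_perm m i \<sigma> k then 1 else 0)" for k l
    by (simp only: h_def inv)
  have "inversion_sum (m + n - 1) d (block_perm m i \<sigma>) =
      (\<Sum>(k, l)\<in>?K \<times> ?K. h (\<beta> k) (\<beta> l) * (d k * d l))"
    unfolding inversion_sum_def
    by (rule sum.mono_neutral_cong_left) (auto simp: index_pairs_iff h_\<beta>)
  also have "\<dots> = (\<Sum>k\<in>?K. \<Sum>l\<in>?K. h (\<beta> k) (\<beta> l) * (d k * d l))"
    by (simp add: sum.cartesian_product)
  also have "\<dots> = (\<Sum>b\<in>{1..n}. \<Sum>k\<in>{k\<in>?K. \<beta> k = b}. \<Sum>c\<in>{1..n}. \<Sum>l\<in>{l\<in>?K. \<beta> l = c}.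
      h (\<beta> k) (\<beta> l) * (d k * d l))"
    using \<beta> by (subst (1 2) sum.group) auto
  also have "\<dots> = (\<Sum>b\<in>{1..n}. \<Sum>k\<in>{k\<in>?K. \<beta> k = b}. \<Sum>c\<in>{1..n}. \<Sum>l\<in>{l\<in>?K. \<beta> l = c}.
      h b c * (d k * d l))"
    by (intro sum.cong refl) auto
  also have "\<dots> = (\<Sum>b\<in>{1..n}. \<Sum>k\<in>{k\<in>?K. \<beta> k = b}. \<Sum>c\<in>{1..n}. h b c * (d k * ?D c))"
    by (intro sum.cong refl) (simp add: D sum_distrib_left[symmetric] del: atLeastAtMost_iff One_nat_def)
  also have "\<dots> = (\<Sum>b\<in>{1..n}. \<Sum>c\<in>{1..n}. h b c * (?D b * ?D c))"
  proof (rule sum.cong[OF refl])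
    fix b assume b: "b \<in> {1..n}"
    have "(\<Sum>k\<in>{k\<in>?K. \<beta> k = b}. \<Sum>c\<in>{1..n}. h b c * (d k * ?D c)) =
        (\<Sum>c\<in>{1..n}. \<Sum>k\<in>{k\<in>?K. \<beta> k = b}. h b c * (d k * ?D c))"
      by (rule sum.swap)
    also have "\<dots> = (\<Sum>c\<in>{1..n}. h b c * ((\<Sum>k\<in>{k\<in>?K. \<beta> k = b}. d k) * ?D c))"
      by (simp only: sum_distrib_left sum_distrib_right)
    finally show "(\<Sum>k\<in>{k\<in>?K. \<beta> k = b}. \<Sum>c\<in>{1..n}. h b c * (d k * ?D c)) =
        (\<Sum>c\<in>{1..n}. h b c * (?D b * ?D c))"
      by (simp only: D[OF b])
  qed
  also have "\<dots> = (\<Sum>(b, c)\<in>{1..n} \<times> {1..n}. h b c * (?D b * ?D c))"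
    by (simp add: sum.cartesian_product)
  also have "\<dots> = inversion_sum n ?D \<sigma>"
    unfolding inversion_sum_def
    by (rule sum.mono_neutral_cong_right) (auto simp: index_pairs_iff h_def)
  finally show ?thesis .
qed

text \<open>
  Both sides are the sign of applying \<open>\<sigma>\<close> and moving an element of parity \<open>e\<close> from the far left to the
  factor in position \<open>i\<close>: it can join this factor before \<open>\<sigma>\<close> acts, or afterwards, when the factor is in
  position \<open>\<sigma> i\<close>.
\<close>

lemma inversion_sum_upd:
  assumes \<sigma>: "\<sigma> permutes {1..n}" and i: "i \<in> {1..n}"
  shows "e * (\<Sum>b\<in>{1..<i}. D b) + inversion_sum n (D(i := e + D i)) \<sigma> =
    inversion_sum n D \<sigma> + e * (\<Sum>b\<in>{b\<in>{1..n}. \<sigma> b < \<sigma> i}. D b)"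
proof -
  let ?L = "{b\<in>{1..<i}. \<sigma> i < \<sigma> b}" and ?R = "{b\<in>{i<..n}. \<sigma> b < \<sigma> i}" and ?S = "{b\<in>{1..<i}. \<sigma> b < \<sigma> i}"
  have ne: "\<sigma> b = \<sigma> i \<longleftrightarrow> b = i" for b
    using permutes_inj[OF \<sigma>] by (metis injD)
  have "inversion_sum n (D(i := e + D i)) \<sigma> = (\<Sum>(b, c)\<in>index_pairs n.
      (if \<sigma> c < \<sigma> b then D b * D c else 0) +
      (if \<sigma> c < \<sigma> b then (if c = i then e * D b else 0) + (if b = i then e * D c else 0) else 0))"
    unfolding inversion_sum_def
    by (rule sum.cong) (auto simp: index_pairs_iff algebra_simps)
  also have "\<dots> = inversion_sum n D \<sigma> +
      (\<Sum>(b, c)\<in>index_pairs n. (if \<sigma> c < \<sigma> b \<and> c = i then e * D b else 0)) +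
      (\<Sum>(b, c)\<in>index_pairs n. (if \<sigma> c < \<sigma> b \<and> b = i then e * D c else 0))"
    unfolding inversion_sum_def sum.distrib[symmetric] by (rule sum.cong) auto
  also have "(\<Sum>(b, c)\<in>index_pairs n. (if \<sigma> c < \<sigma> b \<and> c = i then e * D b else 0)) = (\<Sum>b\<in>?L. e * D b)"
  proof -
    have "(\<Sum>(b, c)\<in>index_pairs n. (if \<sigma> c < \<sigma> b \<and> c = i then e * D b else 0)) =
        (\<Sum>(b, c)\<in>(\<lambda>b. (b, i)) ` ?L. e * D b)"
      by (rule sum.mono_neutral_cong_right) (use i in \<open>auto simp: index_pairs_iff\<close>)
    then show ?thesis by (simp add: sum.reindex inj_on_def)
  qed
  also have "(\<Sum>(b, c)\<in>index_pairs n. (if \<sigma> c < \<sigma> b \<and> b = i then e * D c else 0)) = (\<Sum>c\<in>?R. e * D c)"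
  proof -
    have "(\<Sum>(b, c)\<in>index_pairs n. (if \<sigma> c < \<sigma> b \<and> b = i then e * D c else 0)) =
        (\<Sum>(b, c)\<in>(\<lambda>c. (i, c)) ` ?R. e * D c)"
      by (rule sum.mono_neutral_cong_right) (use i in \<open>auto simp: index_pairs_iff\<close>)
    then show ?thesis by (simp add: sum.reindex inj_on_def)
  qed
  finally have 1: "inversion_sum n (D(i := e + D i)) \<sigma> =
      inversion_sum n D \<sigma> + e * (\<Sum>b\<in>?L. D b) + e * (\<Sum>c\<in>?R. D c)"
    by (simp only: sum_distrib_left)
  have "\<sigma> i < \<sigma> b \<or> \<sigma> b < \<sigma> i" if "b < i" for b
    using ne[of b] that less_linear[of "\<sigma> i" "\<sigma> b"] by simp
  then have LS: "?L \<union> ?S = {1..<i}"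
    by fastforce
  have "(\<Sum>b\<in>?L \<union> ?S. D b) = (\<Sum>b\<in>?L. D b) + (\<Sum>b\<in>?S. D b)"
    by (rule sum.union_disjoint) auto
  then have 2: "(\<Sum>b\<in>{1..<i}. D b) = (\<Sum>b\<in>?L. D b) + (\<Sum>b\<in>?S. D b)"
    by (simp only: LS)
  have "b < i \<or> i < b" if "\<sigma> b < \<sigma> i" for b
    using that less_linear[of i b] by auto
  then have SR: "?S \<union> ?R = {b\<in>{1..n}. \<sigma> b < \<sigma> i}"
    using i by fastforce
  have "(\<Sum>b\<in>?S \<union> ?R. D b) = (\<Sum>b\<in>?S. D b) + (\<Sum>b\<in>?R. D b)"
    by (rule sum.union_disjoint) auto
  then have 3: "(\<Sum>b\<in>{b\<in>{1..n}. \<sigma> b < \<sigma> i}. D b) = (\<Sum>b\<in>?S. D b) + (\<Sum>b\<in>?R. D b)"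
    by (simp only: SR)
  have "e * (l + s) + (t + e * l + e * r) = t + e * (s + r)" for l r s t :: bit
    by (cases e rule: bit_cases; cases l rule: bit_cases; simp add: ac_simps)
  then show ?thesis
    unfolding 1 2 3 .
qed

text \<open>
  The sign identity behind equivariance. On the left: the sign of \<open>g\<close> passing the arguments before it, of
  \<open>\<sigma>\<close> acting on \<open>n\<close> factors of which the \<open>i\<close>-th has the degree of the value of \<open>g\<close>, and of \<open>\<tau>\<close> acting
  on the block. On the right: the sign of \<open>\<sigma> \<circ>\<^sub>i \<tau>\<close>, and of \<open>g\<close> passing the permuted arguments.
\<close>

lemma inversion_sum_perm_comp:
  assumes \<sigma>: "\<sigma> permutes {1..n}" and \<tau>: "\<tau> permutes {1..m}" and i: "1 \<le> i" "i \<le> n"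
  shows "e * (\<Sum>j\<in>{1..<i}. d j) + inversion_sum n (graft i m (e + (\<Sum>j\<in>{i..<i + m}. d j)) d) \<sigma> +
      inversion_sum m (block i d) \<tau> =
    inversion_sum (m + n - 1) d (perm_comp m i \<sigma> \<tau>) +
      e * (\<Sum>j\<in>{1..<\<sigma> i}. d (inv (perm_comp m i \<sigma> \<tau>) j))"
proof -
  let ?s = "\<Sum>j\<in>{i..<i + m}. d j" and ?\<rho> = "perm_comp m i \<sigma> \<tau>"
  let ?D = "graft i m ?s d" and ?d = "\<lambda>j. d (inv (inner_perm m i \<tau>) j)"
  have inv_inner: "inv (inner_perm m i \<tau>) k = inner_perm m i (inv \<tau>) k" for k
    by (rule inv_f_eq[OF permutes_inj[OF inner_perm_permutes[OF \<tau> i]]])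
       (simp add: inner_perm_inverse'[OF \<tau> i(1)])
  have "(\<Sum>j\<in>{i..<i + m}. ?d j) = ?s"
  proof -
    have *: "inner_perm m i \<tau> k \<in> {i..<i + m}" if "\<tau> permutes {1..m}" "k \<in> {i..<i + m}" for k \<tau>
      using permutes_in_image[OF that(1), of "k + 1 - i"] that(2) by (auto simp: inner_perm_def)
    show ?thesis
      unfolding inv_inner
      by (rule sum.reindex_bij_witness[of _ "inner_perm m i \<tau>" "inner_perm m i (inv \<tau>)"])
         (use * \<tau> permutes_inv[OF \<tau>] in \<open>auto simp only: inner_perm_inverse[OF \<tau> i(1)] inner_perm_inverse'[OF \<tau> i(1)]\<close>)
  qed
  then have "graft i m (\<Sum>j\<in>{i..<i + m}. ?d j) ?d j = ?D j" for j
    by (auto simp: graft_def inv_inner inner_perm_def)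
  then have "inversion_sum (m + n - 1) ?d (block_perm m i \<sigma>) = inversion_sum n ?D \<sigma>"
    unfolding inversion_sum_block_perm[OF \<sigma> i] by (intro inversion_sum_cong)
  then have 1: "inversion_sum (m + n - 1) d ?\<rho> = inversion_sum m (block i d) \<tau> + inversion_sum n ?D \<sigma>"
    unfolding perm_comp_def
    using inversion_sum_comp[OF inner_perm_permutes[OF \<tau> i] permutes_inj[OF block_perm_permutes[OF \<sigma> i]]]
      inversion_sum_inner_perm[OF \<tau> i] by simp
  have \<sigma>i: "\<sigma> i \<le> n" "1 \<le> \<sigma> i"
    using permutes_interval_bounds[OF \<sigma>] i by simp_all
  have "d (inv ?\<rho> j) = ?D (inv \<sigma> j)" if "j \<in> {1..<\<sigma> i}" for j
    using graft_perm_comp[OF \<sigma> \<tau> i, of j ?s d] that \<sigma>i by (simp add: graft_def)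
  then have "(\<Sum>j\<in>{1..<\<sigma> i}. d (inv ?\<rho> j)) = (\<Sum>j\<in>{1..<\<sigma> i}. ?D (inv \<sigma> j))"
    by (intro sum.cong) auto
  also have "\<dots> = (\<Sum>b\<in>{b\<in>{1..n}. \<sigma> b < \<sigma> i}. ?D b)"
  proof (rule sum.reindex_bij_witness[of _ \<sigma> "inv \<sigma>"])
    fix j assume j: "j \<in> {1..<\<sigma> i}"
    then have "j \<in> {1..n}" using \<sigma>i by simp
    then show "inv \<sigma> j \<in> {b\<in>{1..n}. \<sigma> b < \<sigma> i}"
      using j permutes_in_image[OF permutes_inv[OF \<sigma>]] permutes_inverses(1)[OF \<sigma>] by simp
  next
    fix b assume b: "b \<in> {b\<in>{1..n}. \<sigma> b < \<sigma> i}"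
    then show "\<sigma> b \<in> {1..<\<sigma> i}"
      using permutes_interval_bounds(1)[OF \<sigma>] by simp
  qed (simp_all add: permutes_inverses[OF \<sigma>])
  finally have 2: "(\<Sum>j\<in>{1..<\<sigma> i}. d (inv ?\<rho> j)) = (\<Sum>b\<in>{b\<in>{1..n}. \<sigma> b < \<sigma> i}. ?D b)" .
  have 3: "graft i m (e + ?s) d = ?D(i := e + ?D i)"
    by (auto simp: graft_def)
  have 4: "(\<Sum>j\<in>{1..<i}. d j) = (\<Sum>j\<in>{1..<i}. ?D j)"
    by (rule sum.cong) (auto simp: graft_def)
  show ?thesis
    using inversion_sum_upd[OF \<sigma>, of i e ?D] i unfolding 1 2 3 4
    by (simp add: ac_simps)
qed

section \<open>The spaces of sesquilinear maps\<close>

lemma superspace_carr_add: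
  assumes X: "superspace X" and "x \<in> carr X" "y \<in> carr X"
  shows "x + y \<in> carr X"
proof -
  note add = module.subspace_add[OF superspace_module[OF X] superspace_part_subspace[OF X]]
  note x = hcomp_split[OF X assms(2)] and y = hcomp_split[OF X assms(3)]
  have "x + y = (hcomp X 0 x + hcomp X 0 y) + (hcomp X 1 x + hcomp X 1 y)"
    using x(3) y(3) by (metis add.assoc add.left_commute)
  with add[OF x(1) y(1)] show ?thesis
    using X unfolding superspace_def by blast
qed

lemma superspace_carr_smult:
  assumes X: "superspace X" and "x \<in> carr X"
  shows "smult X c x \<in> carr X"
proof -
  note scale = module.subspace_scale[OF superspace_module[OF X] superspace_part_subspace[OF X]]
  note x = hcomp_split[OF X assms(2)]
  have "smult X c x = smult X c (hcomp X 0 x) + smult X c (hcomp X 1 x)"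
    using x(3) module.scale_right_distrib[OF superspace_module[OF X]] by metis
  with scale[OF x(1)] show ?thesis
    using X unfolding superspace_def by blast
qed

lemma chom_simps [simp]:
  "carr (chom A U n) = chom_carr A U n"
  "part (chom A U n) = chom_part A U n"
  "der (chom A U n) = chom_der A n"
  "act (chom A U n) = chom_act A U n"
  "smult (chom A U n) = (\<lambda>c f v. Poly_Mapping.map (smult A c) (f v))"
  by (simp_all add: chom_def)

context even_superspace
begin

text \<open>
  Two polynomials with the same values are equal, and the variables that occur in a polynomial are those
  on which its values depend; so the definition of \<open>Chom(n)\<close> can be stated in terms of values.
\<close>

lemma chom_carr_iff:
  "f \<in> chom_carr A U n \<longleftrightarrow>
     (\<forall>a. sesqui U n a (\<lambda>v. eval a (f v))) \<and>
     (\<forall>v a b. (\<forall>j\<in>{1..n}. a j = b j) \<longrightarrow> eval a (f v) = eval b (f v))"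
proof
  assume f: "f \<in> chom_carr A U n"
  have "sesqui U n a (\<lambda>v. eval a (f v))" for a
  proof (rule sesquiI)
    fix u v :: "nat \<Rightarrow> 'v" assume "\<And>j. j \<in> {1..n} \<Longrightarrow> u j = v j"
    then have "f u = f v" using f unfolding chom_carr_def by blast
    then show "eval a (f u) = eval a (f v)" by simp
  qed (use f in \<open>simp_all add: chom_carr_def\<close>)
  moreover have "eval a (f v) = eval b (f v)" if "\<forall>j\<in>{1..n}. a j = b j" for v a b
    using f that keys_subset_iff[of "f v" "{1..n}"] unfolding chom_carr_def by blast
  ultimately show "(\<forall>a. sesqui U n a (\<lambda>v. eval a (f v))) \<and>
     (\<forall>v a b. (\<forall>j\<in>{1..n}. a j = b j) \<longrightarrow> eval a (f v) = eval b (f v))"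
    by blast
next
  assume *: "(\<forall>a. sesqui U n a (\<lambda>v. eval a (f v))) \<and>
     (\<forall>v a b. (\<forall>j\<in>{1..n}. a j = b j) \<longrightarrow> eval a (f v) = eval b (f v))"
  then have f: "sesqui U n a (\<lambda>v. eval a (f v))" for a by blast
  have "f u = f v" if "\<forall>j\<in>{1..n}. u j = v j" for u v
    using that by (intro mpol_eqI sesqui_cong[OF f]) auto
  moreover have "f v = 0" if "\<not> args_in U n v" for v
    using sesqui_outside[OF f that] by (intro mpol_eqI) simp
  moreover have "\<forall>t\<in>Poly_Mapping.keys (f v). Poly_Mapping.keys t \<subseteq> {1..n}" for v
    using * keys_subset_iff by blast
  moreover have "f (v(i := x + y)) = f (v(i := x)) + f (v(i := y))"
    if "args_in U n v" "i \<in> {1..n}" "x \<in> U" "y \<in> U" for v i x y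
    using sesqui_add_arg[OF f that] by (intro mpol_eqI) simp
  moreover have "f (v(i := c *s x)) = Poly_Mapping.map (smult A c) (f (v(i := x)))"
    if "args_in U n v" "i \<in> {1..n}" "x \<in> U" for v i c x
    using sesqui_scale_arg[OF f that] by (intro mpol_eqI) simp
  moreover have "f (v(i := der A (v i))) = - pol_smult (smult A) (var i) (f v)"
    if "args_in U n v" "i \<in> {1..n}" for v i
    using sesqui_der_arg[OF f that] by (intro mpol_eqI) simp
  ultimately show "f \<in> chom_carr A U n"
    unfolding chom_carr_def by blast
qed

lemma chom_carrI:
  assumes "\<And>a. sesqui U n a (\<lambda>v. eval a (f v))"
    and "\<And>v a b. (\<And>j. j \<in> {1..n} \<Longrightarrow> a j = b j) \<Longrightarrow> eval a (f v) = eval b (f v)"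
  shows "f \<in> chom_carr A U n"
  unfolding chom_carr_iff using assms by blast

lemma chom_sesqui: "f \<in> chom_carr A U n \<Longrightarrow> sesqui U n a (\<lambda>v. eval a (f v))"
  by (simp add: chom_carr_iff)

lemma chom_cong:
  assumes f: "f \<in> chom_carr A U n" and "\<And>j. j \<in> {1..n} \<Longrightarrow> a j = b j" "\<And>j. j \<in> {1..n} \<Longrightarrow> u j = v j"
  shows "eval a (f u) = eval b (f v)"
proof -
  have "eval a (f u) = eval b (f u)"
    using f assms(2) unfolding chom_carr_iff by blast
  also have "\<dots> = eval b (f v)"
    by (rule sesqui_cong[OF chom_sesqui[OF f] assms(3)])
  finally show ?thesis .
qed

lemma chom_eqI:
  assumes "graded_submodule U" "f \<in> chom_carr A U n" "g \<in> chom_carr A U n"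
    and "\<And>a d v. homog U n d v \<Longrightarrow> eval a (f v) = eval a (g v)"
  shows "f = g"
proof (rule ext, rule mpol_eqI)
  show "eval a (f v) = eval a (g v)" for v a
    by (rule sesqui_eqI[OF chom_sesqui[OF assms(2)] chom_sesqui[OF assms(3)] assms(1)]) (rule assms(4))
qed

lemma chom_part_iff:
  "f \<in> chom_part A U n e \<longleftrightarrow> f \<in> chom_carr A U n \<and>
     (\<forall>a d v. homog U n d v \<longrightarrow> eval a (f v) \<in> part A (e + (\<Sum>j\<in>{1..n}. d j)))"
  unfolding chom_part_def homog_def
  using lookup_in_subspace[OF part_subspace] eval_in_subspace[OF part_subspace] by blast

lemma chom_part_carr: "f \<in> chom_part A U n e \<Longrightarrow> f \<in> chom_carr A U n"
  by (simp add: chom_part_iff)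

lemma chom_part_eval:
  "f \<in> chom_part A U n e \<Longrightarrow> homog U n d v \<Longrightarrow> eval a (f v) \<in> part A (e + (\<Sum>j\<in>{1..n}. d j))"
  by (simp add: chom_part_iff)

lemma homog_args_in: "homog U n d v \<Longrightarrow> args_in U n v"
  by (simp add: homog_def args_in_def)

lemma chom_carr_add:
  assumes "f \<in> chom_carr A U n" "g \<in> chom_carr A U n"
  shows "f + g \<in> chom_carr A U n"
proof (rule chom_carrI)
  show "sesqui U n a (\<lambda>v. eval a ((f + g) v))" for a
    using sesqui_add[OF chom_sesqui[OF assms(1)] chom_sesqui[OF assms(2)]] by simp
  show "eval a ((f + g) v) = eval b ((f + g) v)" if "\<And>j. j \<in> {1..n} \<Longrightarrow> a j = b j" for v a b
    using chom_cong[OF assms(1) that] chom_cong[OF assms(2) that] by simp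
qed

text \<open>
  A map obtained from \<open>f\<close> by applying a linear operation \<open>h a\<close> to all values at the point \<open>a\<close> is
  again sesquilinear, provided that \<open>h a\<close> only uses the coordinates \<open>a\<^sub>1, \<dots>, a\<^sub>n\<close>. Scalar
  multiplication and \<open>\<partial>\<close> are of this form.
\<close>

lemma chom_carr_linear:
  assumes f: "f \<in> chom_carr A U n"
    and g: "\<And>a v. eval a (g v) = h a (eval a (f v))"
    and h: "\<And>a x y. h a (x + y) = h a x + h a y" "\<And>a c x. h a (c *s x) = c *s h a x"
    and cong: "\<And>a b. (\<And>j. j \<in> {1..n} \<Longrightarrow> a j = b j) \<Longrightarrow> h a = h b"
  shows "g \<in> chom_carr A U n"
proof (rule chom_carrI)
  show "sesqui U n a (\<lambda>v. eval a (g v))" for a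
    unfolding g by (rule sesqui_linear[OF chom_sesqui[OF f]]) (rule h)+
  show "eval a (g v) = eval b (g v)" if "\<And>j. j \<in> {1..n} \<Longrightarrow> a j = b j" for v a b
    unfolding g using chom_cong[OF f that, where u = v and v = v] cong[OF that] by simp
qed

lemma chom_carr_smult:
  "f \<in> chom_carr A U n \<Longrightarrow> (\<lambda>v. Poly_Mapping.map (smult A c) (f v)) \<in> chom_carr A U n"
  by (rule chom_carr_linear[where h = "\<lambda>_. smult A c"]) (auto simp: scale_right_distrib mult.commute)

lemma chom_carr_0: "0 \<in> chom_carr A U n"
  by (rule chom_carrI) (auto intro: sesqui_0)

lemma eval_chom_der:
  "eval a (chom_der A n f v) = der A (eval a (f v)) + (\<Sum>j\<in>{1..n}. a j) *s eval a (f v)"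
  by (simp add: chom_der_def eval_map der_add der_scale scale_sum_left)

lemma chom_carr_der: "f \<in> chom_carr A U n \<Longrightarrow> chom_der A n f \<in> chom_carr A U n"
  by (rule chom_carr_linear[where h = "\<lambda>a x. der A x + (\<Sum>j\<in>{1..n}. a j) *s x"])
     (auto simp: eval_chom_der der_add der_scale scale_right_distrib mult.commute fun_eq_iff)

lemma eval_chom_act:
  "eval a (chom_act A U n f \<sigma> v) = (if args_in U n v then
     \<Sum>d\<in>degrees n. koszul_sign n d \<sigma> *s
       eval (\<lambda>j. a (inv \<sigma> j)) (f (\<lambda>j. hcomp A (d (inv \<sigma> j)) (v (inv \<sigma> j)))) else 0)"
  by (simp add: chom_act_def restrict_to_def)

lemma sesqui_act:
  assumes "f \<in> chom_carr A U n" "\<sigma> permutes {1..n}"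
  shows "sesqui U n a (\<lambda>w. koszul_sign n d \<sigma> *s eval (\<lambda>j. a (inv \<sigma> j)) (f (\<lambda>j. w (inv \<sigma> j))))"
  using sesqui_scale[OF sesqui_permute[OF chom_sesqui[OF assms(1)] assms(2)]] .

lemma chom_carr_act:
  assumes U: "graded_submodule U" and f: "f \<in> chom_carr A U n" and \<sigma>: "\<sigma> permutes {1..n}"
  shows "chom_act A U n f \<sigma> \<in> chom_carr A U n"
proof (rule chom_carrI)
  show "sesqui U n a (\<lambda>v. eval a (chom_act A U n f \<sigma> v))" for a
    unfolding eval_chom_act
    by (rule sesqui_polarize[OF U sesqui_act[OF f \<sigma>]])
  show "eval a (chom_act A U n f \<sigma> v) = eval b (chom_act A U n f \<sigma> v)"
    if "\<And>j. j \<in> {1..n} \<Longrightarrow> a j = b j" for v a b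
  proof -
    have "a (inv \<sigma> j) = b (inv \<sigma> j)" if "j \<in> {1..n}" for j
      using \<open>\<And>j. j \<in> {1..n} \<Longrightarrow> a j = b j\<close> permutes_in_image[OF permutes_inv[OF \<sigma>]] that by blast
    then have "eval (\<lambda>j. a (inv \<sigma> j)) (f w) = eval (\<lambda>j. b (inv \<sigma> j)) (f w)" for w
      by (intro chom_cong[OF f]) auto
    then show ?thesis
      unfolding eval_chom_act by simp
  qed
qed

lemma eval_chom_act_homog:
  assumes f: "f \<in> chom_carr A U n" and \<sigma>: "\<sigma> permutes {1..n}" and v: "homog U n d v"
  shows "eval a (chom_act A U n f \<sigma> v) =
    koszul_sign n d \<sigma> *s eval (\<lambda>j. a (inv \<sigma> j)) (f (\<lambda>j. v (inv \<sigma> j)))"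
proof -
  have "koszul_sign n (restrict d {1..n}) \<sigma> = (koszul_sign n d \<sigma> :: 'k)"
    by (rule koszul_sign_cong) simp
  then show ?thesis
    using polarize_homog[OF sesqui_act[OF f \<sigma>, where a = a] v] homog_args_in[OF v]
    unfolding eval_chom_act by simp
qed

lemma homog_permute:
  assumes "homog U n d v" "\<sigma> permutes {1..n}"
  shows "homog U n (\<lambda>j. d (inv \<sigma> j)) (\<lambda>j. v (inv \<sigma> j))"
  using assms(1) permutes_in_image[OF permutes_inv[OF assms(2)]] unfolding homog_def by blast

lemma sum_inv_permutes:
  assumes "\<sigma> permutes {1..n}"
  shows "(\<Sum>j\<in>{1..n}. w (inv \<sigma> j)) = (\<Sum>j\<in>{1..n}. w j)"
  using sum.permute[OF permutes_inv[OF assms], of w] by (simp add: o_def)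

text \<open>
  The homogeneous component of parity \<open>e\<close> of a map: on arguments of total degree \<open>s\<close>, the component
  of degree \<open>e + s\<close> of the value.
\<close>

definition chom_comp :: "'v set \<Rightarrow> nat \<Rightarrow> bit \<Rightarrow> ((nat \<Rightarrow> 'v) \<Rightarrow> 'v mpol) \<Rightarrow> (nat \<Rightarrow> 'v) \<Rightarrow> 'v mpol" where
  "chom_comp U n e f v = (if args_in U n v then
     \<Sum>d\<in>degrees n. Poly_Mapping.map (hcomp A (e + (\<Sum>j\<in>{1..n}. d j))) (f (\<lambda>j. hcomp A (d j) (v j))) else 0)"

lemma chom_comp_part:
  assumes U: "graded_submodule U" and f: "f \<in> chom_carr A U n"
  shows "chom_comp U n e f \<in> chom_part A U n e"
    and "homog U n d v \<Longrightarrow>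
      eval a (chom_comp U n e f v) = hcomp A (e + (\<Sum>j\<in>{1..n}. d j)) (eval a (f v))"
proof -
  let ?T = "\<lambda>a d w. hcomp A (e + (\<Sum>j\<in>{1..n}. d j)) (eval a (f w))"
  have T: "sesqui U n a (?T a d)" for a d
    by (rule sesqui_linear[OF chom_sesqui[OF f]]) (auto simp: hcomp_A_add hcomp_A_scale)
  have eval: "eval a (chom_comp U n e f v) = (if args_in U n v then
      \<Sum>d\<in>degrees n. ?T a d (\<lambda>j. hcomp A (d j) (v j)) else 0)" for a v
    by (simp add: chom_comp_def eval_map hcomp_A_add hcomp_A_scale)
  have homog: "eval a (chom_comp U n e f v) = ?T a d v" if "homog U n d v" for a d v
    using polarize_homog[OF T that] homog_args_in[OF that] by (simp add: eval)
  show "homog U n d v \<Longrightarrow>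
      eval a (chom_comp U n e f v) = hcomp A (e + (\<Sum>j\<in>{1..n}. d j)) (eval a (f v))"
    by (rule homog)
  have "chom_comp U n e f \<in> chom_carr A U n"
  proof (rule chom_carrI)
    show "sesqui U n a (\<lambda>v. eval a (chom_comp U n e f v))" for a
      unfolding eval by (rule sesqui_polarize[OF U T])
    show "eval a (chom_comp U n e f v) = eval b (chom_comp U n e f v)"
      if "\<And>j. j \<in> {1..n} \<Longrightarrow> a j = b j" for v a b
      unfolding eval using chom_cong[OF f that] by simp
  qed
  then show "chom_comp U n e f \<in> chom_part A U n e"
    by (simp add: chom_part_iff homog part_hcomp)
qed

lemma superspace_chom:
  assumes U: "graded_submodule U"
  shows "superspace (chom A U n)"
proof -
  have vs: "vector_space (\<lambda>c (f :: (nat \<Rightarrow> 'v) \<Rightarrow> 'v mpol) v. Poly_Mapping.map (smult A c) (f v))"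
    unfolding vector_space_def
    by (intro conjI allI ext; rule mpol_eqI)
       (auto simp: scale_right_distrib scale_left_distrib)
  have "module.subspace (\<lambda>c f v. Poly_Mapping.map (smult A c) (f v)) (chom_part A U n e)" for e
    unfolding module.subspace_def[OF vs[folded module_iff_vector_space]]
    using subspace_0[OF part_subspace] subspace_add[OF part_subspace] subspace_scale[OF part_subspace]
    by (auto simp: chom_part_iff chom_carr_0 chom_carr_add chom_carr_smult)
  moreover have "f = 0" if f: "f \<in> chom_part A U n 0" "f \<in> chom_part A U n 1" for f
  proof (rule chom_eqI[OF U chom_part_carr[OF f(1)] chom_carr_0])
    fix a d v assume v: "homog U n d v"
    show "eval a (f v) = eval a (0 v)"
      using superspace_part_disjoint[OF superspace_A, of "eval a (f v)" "\<Sum>j\<in>{1..n}. d j"]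
        chom_part_eval[OF f(1) v, of a] chom_part_eval[OF f(2) v, of a] by simp
  qed
  moreover have "0 \<in> chom_part A U n e" for e
    using subspace_0[OF part_subspace] by (simp add: chom_part_iff chom_carr_0)
  moreover have "f \<in> {g + h |g h. g \<in> chom_part A U n 0 \<and> h \<in> chom_part A U n 1}"
    if f: "f \<in> chom_carr A U n" for f
  proof -
    note comp = chom_comp_part[OF U f]
    have "f = chom_comp U n 0 f + chom_comp U n 1 f"
    proof (rule chom_eqI[OF U f])
      show "chom_comp U n 0 f + chom_comp U n 1 f \<in> chom_carr A U n"
        using comp(1) by (intro chom_carr_add chom_part_carr)
      fix a d v assume v: "homog U n d v"
      show "eval a (f v) = eval a ((chom_comp U n 0 f + chom_comp U n 1 f) v)"
        using sum_hcomp[of "eval a (f v)"]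
        by (cases "\<Sum>j\<in>{1..n}. d j" rule: bit_cases) (simp_all add: comp(2)[OF v] add.commute)
    qed
    then show ?thesis using comp(1) by blast
  qed
  ultimately show ?thesis
    unfolding superspace_def using vs by (auto intro: chom_carr_add chom_part_carr)
qed

lemma dS_superspace_chom:
  assumes U: "graded_submodule U"
  shows "dS_superspace n (chom A U n)"
proof -
  have "even_linear (chom A U n) (chom A U n) (chom_der A n)"
    unfolding even_linear_def linear_between_def chom_simps
  proof (intro conjI ballI allI)
    show "chom_der A n (f + g) = chom_der A n f + chom_der A n g" for f g
      by (intro ext mpol_eqI) (simp add: eval_chom_der der_add scale_right_distrib)
    show "chom_der A n (\<lambda>v. Poly_Mapping.map (smult A c) (f v)) =
        (\<lambda>v. Poly_Mapping.map (smult A c) (chom_der A n f v))" for c f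
      by (intro ext mpol_eqI) (simp add: eval_chom_der der_scale scale_right_distrib mult.commute)
    show "chom_der A n f \<in> chom_part A U n e" if "f \<in> chom_part A U n e" for e f
      using that by (auto simp: chom_part_iff chom_carr_der eval_chom_der der_part
        intro!: subspace_add subspace_scale part_subspace)
  qed (rule chom_carr_der)
  moreover have "even_linear (chom A U n) (chom A U n) (\<lambda>f. chom_act A U n f \<sigma>)"
    if \<sigma>: "\<sigma> permutes {1..n}" for \<sigma>
    unfolding even_linear_def linear_between_def chom_simps
  proof (intro conjI ballI allI)
    show "chom_act A U n (f + g) \<sigma> = chom_act A U n f \<sigma> + chom_act A U n g \<sigma>" for f g
      by (intro ext mpol_eqI) (simp add: eval_chom_act scale_right_distrib sum.distrib)
    show "chom_act A U n (\<lambda>v. Poly_Mapping.map (smult A c) (f v)) \<sigma> =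
        (\<lambda>v. Poly_Mapping.map (smult A c) (chom_act A U n f \<sigma> v))" for c f
      by (intro ext mpol_eqI) (simp add: eval_chom_act scale_sum_right mult.commute)
    show "chom_act A U n f \<sigma> \<in> chom_part A U n e" if f: "f \<in> chom_part A U n e" for e f
    proof -
      have "eval a (chom_act A U n f \<sigma> v) \<in> part A (e + (\<Sum>j\<in>{1..n}. d j))"
        if v: "homog U n d v" for a d v
        using chom_part_eval[OF f homog_permute[OF v \<sigma>]] sum_inv_permutes[OF \<sigma>, of d]
        by (simp add: eval_chom_act_homog[OF chom_part_carr[OF f] \<sigma> v] subspace_scale[OF part_subspace])
      then show ?thesis
        by (simp add: chom_part_iff chom_carr_act[OF U chom_part_carr[OF f] \<sigma>])
    qed
  qed (rule chom_carr_act[OF U _ \<sigma>])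
  moreover have "chom_act A U n f id = f" if f: "f \<in> chom_carr A U n" for f
  proof (rule chom_eqI[OF U chom_carr_act[OF U f permutes_id] f])
    show "eval a (chom_act A U n f id v) = eval a (f v)" if "homog U n d v" for a d v
      by (simp add: eval_chom_act_homog[OF f permutes_id that] koszul_sign_inversion_sum inversion_sum_id)
  qed
  moreover have "chom_act A U n (chom_act A U n f \<sigma>) \<tau> = chom_act A U n f (\<sigma> \<circ> \<tau>)"
    if f: "f \<in> chom_carr A U n" and \<sigma>: "\<sigma> permutes {1..n}" and \<tau>: "\<tau> permutes {1..n}" for f \<sigma> \<tau>
  proof (rule chom_eqI[OF U])
    note f\<sigma> = chom_carr_act[OF U f \<sigma>] and \<sigma>\<tau> = permutes_compose[OF \<tau> \<sigma>]
    show "chom_act A U n (chom_act A U n f \<sigma>) \<tau> \<in> chom_carr A U n"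
      by (rule chom_carr_act[OF U f\<sigma> \<tau>])
    show "chom_act A U n f (\<sigma> \<circ> \<tau>) \<in> chom_carr A U n"
      by (rule chom_carr_act[OF U f \<sigma>\<tau>])
    show "eval a (chom_act A U n (chom_act A U n f \<sigma>) \<tau> v) = eval a (chom_act A U n f (\<sigma> \<circ> \<tau>) v)"
      if v: "homog U n d v" for a d v
      using o_inv_distrib[OF permutes_bij[OF \<sigma>] permutes_bij[OF \<tau>]]
      by (simp add: eval_chom_act_homog[OF f\<sigma> \<tau> v] eval_chom_act_homog[OF f \<sigma> homog_permute[OF v \<tau>]]
          eval_chom_act_homog[OF f \<sigma>\<tau> v] koszul_sign_comp[OF \<tau> \<sigma>])
  qed
  moreover have "chom_act A U n (chom_der A n f) \<sigma> = chom_der A n (chom_act A U n f \<sigma>)"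
    if f: "f \<in> chom_carr A U n" and \<sigma>: "\<sigma> permutes {1..n}" for f \<sigma>
  proof (rule chom_eqI[OF U])
    show "chom_act A U n (chom_der A n f) \<sigma> \<in> chom_carr A U n"
      by (intro chom_carr_act[OF U] chom_carr_der f \<sigma>)
    show "chom_der A n (chom_act A U n f \<sigma>) \<in> chom_carr A U n"
      by (intro chom_carr_act[OF U] chom_carr_der f \<sigma>)
    show "eval a (chom_act A U n (chom_der A n f) \<sigma> v) = eval a (chom_der A n (chom_act A U n f \<sigma>) v)"
      if v: "homog U n d v" for a d v
      by (simp only: eval_chom_act_homog[OF chom_carr_der[OF f] \<sigma> v] eval_chom_act_homog[OF f \<sigma> v]
          eval_chom_der der_scale scale_right_distrib scale_scale mult.commute sum_inv_permutes[OF \<sigma>])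
  qed
  ultimately show ?thesis
    unfolding dS_superspace_def d_superspace_def using superspace_chom[OF U] by simp
qed

section \<open>Restriction to submodules and projective limits\<close>

lemma eval_restrict_to:
  "eval a (restrict_to U n f v) = (if args_in U n v then eval a (f v) else 0)"
  by (simp add: restrict_to_def)

lemma args_in_mono: "U \<subseteq> U' \<Longrightarrow> args_in U n v \<Longrightarrow> args_in U' n v"
  by (auto simp: args_in_def)

lemma homog_mono: "U \<subseteq> U' \<Longrightarrow> homog U n d v \<Longrightarrow> homog U' n d v"
  by (auto simp: homog_def)

lemma sesqui_restrict:
  assumes \<Phi>: "sesqui U' n a \<Phi>" and U: "graded_submodule U" and sub: "U \<subseteq> U'"
  shows "sesqui U n a (\<lambda>v. if args_in U n v then \<Phi> v else 0)"
proof -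
  have vi: "der A (v i) \<in> U" if "args_in U n v" "i \<in> {1..n}" for v i
    using that U by (simp add: args_in_def graded_submodule_def)
  have closed: "x + y \<in> U" "c *s x \<in> U" if "x \<in> U" "y \<in> U" for x y c
    using U that by (auto simp: graded_submodule_def subspace_add subspace_scale)
  show ?thesis
  proof (rule sesquiI)
    fix u v :: "nat \<Rightarrow> 'v" assume *: "\<And>j. j \<in> {1..n} \<Longrightarrow> u j = v j"
    then have "args_in U n u \<longleftrightarrow> args_in U n v" by (simp add: args_in_def)
    then show "(if args_in U n u then \<Phi> u else 0) = (if args_in U n v then \<Phi> v else 0)"
      using sesqui_cong[OF \<Phi> *] by simp
  next
    fix v i x y assume *: "args_in U n v" "i \<in> {1..n}" "x \<in> U" "y \<in> U"
    then show "(if args_in U n (v(i := x + y)) then \<Phi> (v(i := x + y)) else 0) =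
        (if args_in U n (v(i := x)) then \<Phi> (v(i := x)) else 0) +
        (if args_in U n (v(i := y)) then \<Phi> (v(i := y)) else 0)"
      using sesqui_add_arg[OF \<Phi> args_in_mono[OF sub *(1)] *(2), of x y] sub
      by (simp add: args_in_upd closed subsetD del: fun_upd_apply)
  next
    fix v i c x assume *: "args_in U n v" "i \<in> {1..n}" "x \<in> U"
    then show "(if args_in U n (v(i := c *s x)) then \<Phi> (v(i := c *s x)) else 0) =
        c *s (if args_in U n (v(i := x)) then \<Phi> (v(i := x)) else 0)"
      using sesqui_scale_arg[OF \<Phi> args_in_mono[OF sub *(1)] *(2), of x c] sub closed(2)[of x x c]
      by (simp add: args_in_upd subsetD del: fun_upd_apply)
  next
    fix v i assume *: "args_in U n v" "i \<in> {1..n}"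
    then show "(if args_in U n (v(i := der A (v i))) then \<Phi> (v(i := der A (v i))) else 0) =
        - (a i *s (if args_in U n v then \<Phi> v else 0))"
      using sesqui_der_arg[OF \<Phi> args_in_mono[OF sub *(1)] *(2)]
      by (simp add: args_in_upd vi del: fun_upd_apply)
  qed simp
qed

lemma restrict_to_carr:
  assumes f: "f \<in> chom_carr A U' n" and U: "graded_submodule U" and sub: "U \<subseteq> U'"
  shows "restrict_to U n f \<in> chom_carr A U n"
proof (rule chom_carrI)
  show "sesqui U n a (\<lambda>v. eval a (restrict_to U n f v))" for a
    unfolding eval_restrict_to by (rule sesqui_restrict[OF chom_sesqui[OF f] U sub])
  show "eval a (restrict_to U n f v) = eval b (restrict_to U n f v)"
    if "\<And>j. j \<in> {1..n} \<Longrightarrow> a j = b j" for v a b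
    unfolding eval_restrict_to using chom_cong[OF f that] by simp
qed

lemma dS_morphism_restrict_to:
  assumes U: "graded_submodule U" and sub: "U \<subseteq> U'"
  shows "dS_morphism n (chom A U' n) (chom A U n) (restrict_to U n)"
  unfolding dS_morphism_def even_linear_def linear_between_def chom_simps
proof (intro conjI ballI allI impI)
  show "restrict_to U n (f + g) = restrict_to U n f + restrict_to U n g" for f g
    by (intro ext mpol_eqI) (simp add: eval_restrict_to)
  show "restrict_to U n (\<lambda>v. Poly_Mapping.map (smult A c) (f v)) =
      (\<lambda>v. Poly_Mapping.map (smult A c) (restrict_to U n f v))" for c f
    by (intro ext mpol_eqI) (simp add: eval_restrict_to)
  show "restrict_to U n f \<in> chom_part A U n e" if f: "f \<in> chom_part A U' n e" for e f
    using restrict_to_carr[OF chom_part_carr[OF f] U sub] chom_part_eval[OF f homog_mono[OF sub]]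
    by (auto simp: chom_part_iff eval_restrict_to homog_args_in)
  show "restrict_to U n (chom_der A n f) = chom_der A n (restrict_to U n f)" for f
    by (intro ext mpol_eqI) (simp add: eval_restrict_to eval_chom_der der_scale[of 0 0, simplified])
  fix f \<sigma> assume f: "f \<in> chom_carr A U' n" and \<sigma>: "\<sigma> permutes {1..n}"
  have mem: "inv \<sigma> j \<in> {1..n}" if "j \<in> {1..n}" for j
    using permutes_in_image[OF permutes_inv[OF \<sigma>]] that by blast
  have "args_in U n (\<lambda>j. hcomp A (d (inv \<sigma> j)) (v (inv \<sigma> j)))" if "args_in U n v" for d v
    using that U mem by (simp add: args_in_def graded_submodule_def)
  then show "restrict_to U n (chom_act A U' n f \<sigma>) = chom_act A U n (restrict_to U n f) \<sigma>"
    using args_in_mono[OF sub]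
    by (intro ext mpol_eqI) (simp add: eval_restrict_to eval_chom_act)
qed (rule restrict_to_carr[OF _ U sub])

end

locale exhaustive_filtration = even_superspace A
  for A :: "('k::field_char_0, 'v::ab_group_add) d_space" +
  fixes F :: "nat \<Rightarrow> 'v set"
  assumes graded_F: "graded_submodule (F q)"
    and F_Suc: "F q \<subseteq> F (Suc q)"
    and F_exhaustive: "(\<Union>q. F q) = UNIV"
begin

lemma F_mono: "p \<le> q \<Longrightarrow> F p \<subseteq> F q"
  by (rule lift_Suc_mono_le[of F]) (rule F_Suc)

lemma F_contains:
  assumes "finite X"
  shows "\<exists>q. X \<subseteq> F q"
  using assms
proof (induction X rule: finite_induct)
  case (insert x X)
  then obtain q where q: "X \<subseteq> F q" by blast
  obtain p where "x \<in> F p" using F_exhaustive by blast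
  then have "insert x X \<subseteq> F (max p q)"
    using q F_mono[of p "max p q"] F_mono[of q "max p q"] by auto
  then show ?case by blast
qed simp

lemma args_in_F:
  assumes "finite X"
  obtains q where "args_in (F q) n v" "X \<subseteq> F q"
  using F_contains[of "v ` {1..n} \<union> X"] assms that by (auto simp: args_in_def image_subset_iff)

text \<open>
  Each of the conditions involves finitely many vectors, and these lie in a common step of the
  filtration.
\<close>

lemma sesqui_local:
  assumes "\<And>q. sesqui (F q) n a (\<lambda>v. if args_in (F q) n v then \<Phi> v else 0)"
  shows "sesqui UNIV n a \<Phi>"
proof (rule sesquiI)
  fix u v :: "nat \<Rightarrow> 'v" assume *: "\<And>j. j \<in> {1..n} \<Longrightarrow> u j = v j"
  obtain q where q: "args_in (F q) n u" by (rule args_in_F[of "{}" n u]) auto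
  then have "args_in (F q) n v" using * by (simp add: args_in_def)
  then show "\<Phi> u = \<Phi> v"
    using q sesqui_cong[OF assms[of q], of u v] * by simp
next
  fix v and i :: nat and x y assume i: "i \<in> {1..n}"
  obtain q where "args_in (F q) n v" "{x, y, x + y} \<subseteq> F q" by (rule args_in_F[of "{x, y, x + y}" n v]) auto
  then show "\<Phi> (v(i := x + y)) = \<Phi> (v(i := x)) + \<Phi> (v(i := y))"
    using sesqui_add_arg[OF assms[of q] _ i, of v x y] by (simp add: args_in_upd del: fun_upd_apply)
next
  fix v and i :: nat and c x assume i: "i \<in> {1..n}"
  obtain q where "args_in (F q) n v" "{x, c *s x} \<subseteq> F q" by (rule args_in_F[of "{x, c *s x}" n v]) auto
  then show "\<Phi> (v(i := c *s x)) = c *s \<Phi> (v(i := x))"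
    using sesqui_scale_arg[OF assms[of q] _ i, of v x c] by (simp add: args_in_upd del: fun_upd_apply)
next
  fix v and i :: nat assume i: "i \<in> {1..n}"
  obtain q where "args_in (F q) n v" "{der A (v i)} \<subseteq> F q" by (rule args_in_F[of "{der A (v i)}" n v]) auto
  then show "\<Phi> (v(i := der A (v i))) = - (a i *s \<Phi> v)"
    using sesqui_der_arg[OF assms[of q] _ i, of v] by (simp add: args_in_upd del: fun_upd_apply)
qed (simp add: args_in_def)

text \<open>
  This gives uniqueness in the universal property; it also yields the linearity and equivariance of
  the mediating map, since the restrictions are morphisms.
\<close>

lemma restrictions_jointly_injective:
  assumes "\<And>q. restrict_to (F q) n f = restrict_to (F q) n g"
  shows "f = g"
proof
  fix v
  obtain q where "args_in (F q) n v" by (rule args_in_F[of "{}" n v]) auto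
  then show "f v = g v"
    using fun_cong[OF assms[of q], of v] by (simp add: restrict_to_def)
qed

lemma projective_system_chom:
  "projective_system n (\<lambda>q. chom A (F q) n) (\<lambda>q. restrict_to (F q) n)"
  unfolding projective_system_def
  by (simp add: dS_superspace_chom graded_F dS_morphism_restrict_to F_Suc)

lemma projective_cone_chom:
  "projective_cone n (\<lambda>q. chom A (F q) n) (\<lambda>q. restrict_to (F q) n) (chom A UNIV n) (\<lambda>q. restrict_to (F q) n)"
proof -
  have "restrict_to (F q) n (restrict_to (F (Suc q)) n f) = restrict_to (F q) n f" for q f
    using args_in_mono[OF F_Suc] by (auto simp: restrict_to_def fun_eq_iff)
  then show ?thesis
    unfolding projective_cone_def
    by (simp add: dS_superspace_chom graded_submodule_UNIV dS_morphism_restrict_to graded_F)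
qed

text \<open>
  A compatible family of maps on the steps of the filtration glues: every tuple of arguments lies
  in some step, and the value there does not depend on the step.
\<close>

lemma chom_glue:
  assumes f: "\<And>q. f q \<in> chom_carr A (F q) n" and compat: "\<And>q. restrict_to (F q) n (f (Suc q)) = f q"
  obtains g where "g \<in> chom_carr A UNIV n" "\<And>q. restrict_to (F q) n g = f q"
proof -
  have out: "f q v = 0" if "\<not> args_in (F q) n v" for q v
    using f that unfolding chom_carr_def by blast
  have step: "f (Suc q) v = f q v" if "args_in (F q) n v" for q v
    using fun_cong[OF compat[of q], of v] that by (simp add: restrict_to_def)
  have indep: "f p v = f q v" if "args_in (F q) n v" "q \<le> p" for p q v
    using that(2)
  proof (induction rule: dec_induct)
    case (step p)
    then show ?case
      using \<open>\<And>q v. args_in (F q) n v \<Longrightarrow> f (Suc q) v = f q v\<close>[of p v]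
        args_in_mono[OF F_mono[OF step.hyps(1)] that(1)] by simp
  qed simp
  define g where "g v = f (LEAST q. args_in (F q) n v) v" for v
  have g: "f q v = g v" if "args_in (F q) n v" for q v
    unfolding g_def
    by (rule indep) (use that in \<open>auto intro: LeastI Least_le\<close>)
  have res: "restrict_to (F q) n g = f q" for q
    using g[of q] out[of q] by (auto simp: restrict_to_def fun_eq_iff)
  have "g \<in> chom_carr A UNIV n"
  proof (rule chom_carrI)
    show "sesqui UNIV n a (\<lambda>v. eval a (g v))" for a
    proof (rule sesqui_local)
      show "sesqui (F q) n a (\<lambda>v. if args_in (F q) n v then eval a (g v) else 0)" for q
        using chom_sesqui[OF f[of q], of a] by (simp add: eval_restrict_to flip: res)
    qed
    fix v and a b :: "nat \<Rightarrow> 'k" assume *: "\<And>j. j \<in> {1..n} \<Longrightarrow> a j = b j"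
    obtain q where "args_in (F q) n v" by (rule args_in_F[of "{}" n v]) auto
    then show "eval a (g v) = eval b (g v)"
      using chom_cong[OF f[of q] *, where u = v and v = v] g[of q v] by simp
  qed
  with res show thesis by (intro that)
qed

lemma is_projective_limit_chom:
  "is_projective_limit TYPE('w::ab_group_add) n (\<lambda>q. chom A (F q) n) (\<lambda>q. restrict_to (F q) n)
     (chom A UNIV n) (\<lambda>q. restrict_to (F q) n)"
  unfolding is_projective_limit_def
proof (intro conjI allI impI)
  show "projective_cone n (\<lambda>q. chom A (F q) n) (\<lambda>q. restrict_to (F q) n) (chom A UNIV n) (\<lambda>q. restrict_to (F q) n)"
    by (rule projective_cone_chom)
next
  fix W :: "('k, 'w) dS_space" and \<phi>
  assume "projective_cone n (\<lambda>q. chom A (F q) n) (\<lambda>q. restrict_to (F q) n) W \<phi>"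
  then have W: "dS_superspace n W" and \<phi>: "dS_morphism n W (chom A (F q) n) (\<phi> q)"
    and compat: "\<And>x. x \<in> carr W \<Longrightarrow> restrict_to (F q) n (\<phi> (Suc q) x) = \<phi> q x" for q
    unfolding projective_cone_def by blast+
  have sW: "superspace W"
    using W by (simp add: dS_superspace_def d_superspace_def)
  have clW: "der W x \<in> carr W" "\<sigma> permutes {1..n} \<Longrightarrow> act W x \<sigma> \<in> carr W" if "x \<in> carr W" for x \<sigma>
    using W that unfolding dS_superspace_def d_superspace_def even_linear_def linear_between_def by blast+
  note R = dS_morphism_restrict_to[OF graded_F subset_UNIV, unfolded dS_morphism_def even_linear_def
      linear_between_def chom_simps]
  note \<phi>' = \<phi>[unfolded dS_morphism_def even_linear_def linear_between_def chom_simps]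
  have "\<forall>x\<in>carr W. \<exists>g. g \<in> chom_carr A UNIV n \<and> (\<forall>q. restrict_to (F q) n g = \<phi> q x)"
  proof
    fix x assume x: "x \<in> carr W"
    then have "\<phi> q x \<in> chom_carr A (F q) n" for q
      using \<phi>' by blast
    then show "\<exists>g. g \<in> chom_carr A UNIV n \<and> (\<forall>q. restrict_to (F q) n g = \<phi> q x)"
      using chom_glue[of "\<lambda>q. \<phi> q x", OF _ compat[OF x]] by blast
  qed
  then obtain h where h: "\<And>x. x \<in> carr W \<Longrightarrow> h x \<in> chom_carr A UNIV n"
    "\<And>x q. x \<in> carr W \<Longrightarrow> restrict_to (F q) n (h x) = \<phi> q x"
    by metis
  have h_eqI: "h x = g" if "x \<in> carr W" "\<And>q. \<phi> q x = restrict_to (F q) n g" for x g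
    by (rule restrictions_jointly_injective[of n]) (simp only: h(2)[OF that(1)] that(2))
  have "dS_morphism n W (chom A UNIV n) h"
    unfolding dS_morphism_def even_linear_def linear_between_def chom_simps
  proof (intro conjI ballI allI impI)
    fix x y assume xy: "x \<in> carr W" "y \<in> carr W"
    then show "h (x + y) = h x + h y"
      using R \<phi>' h by (intro h_eqI superspace_carr_add[OF sW]) simp_all
  next
    fix c x assume x: "x \<in> carr W"
    then show "h (smult W c x) = (\<lambda>v. Poly_Mapping.map (smult A c) (h x v))"
      using R \<phi>' h by (intro h_eqI superspace_carr_smult[OF sW]) simp_all
  next
    fix x assume x: "x \<in> carr W"
    then show "h (der W x) = chom_der A n (h x)"
      using R \<phi>' h by (intro h_eqI clW(1)) simp_all
  next
    fix x \<sigma> assume x: "x \<in> carr W" and \<sigma>: "\<sigma> permutes {1..n}"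
    then show "h (act W x \<sigma>) = chom_act A UNIV n (h x) \<sigma>"
      using R \<phi>' h by (intro h_eqI clW(2)) simp_all
  next
    fix e x assume x: "x \<in> part W e"
    then have xW: "x \<in> carr W" by (rule superspace_part_carr[OF sW])
    have "eval a (h x v) \<in> part A (e + (\<Sum>j\<in>{1..n}. d j))" if v: "homog UNIV n d v" for a d v
    proof -
      obtain q where q: "args_in (F q) n v" by (rule args_in_F[of "{}" n v]) auto
      then have "homog (F q) n d v" using v by (simp add: homog_def args_in_def)
      moreover have "\<phi> q x \<in> chom_part A (F q) n e" using \<phi>' x by blast
      ultimately have "eval a (\<phi> q x v) \<in> part A (e + (\<Sum>j\<in>{1..n}. d j))"
        by (intro chom_part_eval)
      then show ?thesis
        using q by (simp add: eval_restrict_to flip: h(2)[OF xW])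
    qed
    then show "h x \<in> chom_part A UNIV n e"
      using h(1)[OF xW] by (simp add: chom_part_iff)
  qed (rule h(1))
  moreover have "h' x = h x" if "\<forall>q. \<forall>x\<in>carr W. restrict_to (F q) n (h' x) = \<phi> q x" "x \<in> carr W" for h' x
    by (rule restrictions_jointly_injective[of n])
       (simp add: that(1)[rule_format, OF that(2)] h(2)[OF that(2)])
  ultimately show "\<exists>h. dS_morphism n W (chom A UNIV n) h \<and>
      (\<forall>q. \<forall>x\<in>carr W. restrict_to (F q) n (h x) = \<phi> q x) \<and>
      (\<forall>h'. dS_morphism n W (chom A UNIV n) h' \<and>
        (\<forall>q. \<forall>x\<in>carr W. restrict_to (F q) n (h' x) = \<phi> q x) \<longrightarrow> (\<forall>x\<in>carr W. h' x = h x))"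
    using h(2) by (intro exI[of _ h] conjI allI ballI impI) blast+
qed

end

section \<open>The products\<close>

lemma graft_cong:
  assumes "1 \<le> i" "\<And>j. 1 \<le> j \<Longrightarrow> j \<le> m + n - 1 \<Longrightarrow> w j = w' j" "t \<in> {1..n}" "i \<le> n"
  shows "graft i m x w t = graft i m x w' t"
  unfolding graft_def by (auto intro!: assms(2)) (use assms in auto)

lemma block_cong:
  assumes "1 \<le> i" "i \<le> n" "\<And>j. 1 \<le> j \<Longrightarrow> j \<le> m + n - 1 \<Longrightarrow> w j = w' j" "t \<in> {1..m}"
  shows "block i w t = block i w' t"
  unfolding block_def by (rule assms(3)) (use assms in auto)

context even_superspace
begin

text \<open>
  The point \<open>(a\<^sub>1, \<dots>, a\<^sub>i\<^sub>-\<^sub>1, c + a\<^sub>i + \<dots> + a\<^sub>i\<^sub>+\<^sub>m\<^sub>-\<^sub>1, a\<^sub>i\<^sub>+\<^sub>m, \<dots>)\<close> at which \<open>f\<close> is evaluated in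
  \<open>f \<circ>\<^sup>i\<^sub>c g\<close>; \<open>insert_eval\<close> is the value of this composite at \<open>a\<close>, without sign.
\<close>

definition insert_point :: "nat \<Rightarrow> nat \<Rightarrow> 'k \<Rightarrow> (nat \<Rightarrow> 'k) \<Rightarrow> nat \<Rightarrow> 'k" where
  "insert_point i m c a = graft i m (c + (\<Sum>s\<in>{i..<i + m}. a s)) a"

definition insert_eval ::
  "nat \<Rightarrow> nat \<Rightarrow> ((nat \<Rightarrow> 'v) \<Rightarrow> 'v mpol) \<Rightarrow> ((nat \<Rightarrow> 'v) \<Rightarrow> 'v mpol) \<Rightarrow> 'k \<Rightarrow> (nat \<Rightarrow> 'k) \<Rightarrow> (nat \<Rightarrow> 'v) \<Rightarrow> 'v" where
  "insert_eval i m f g c a w =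
     eval (insert_point i m c a) (f (graft i m (eval (block i a) (g (block i w))) w))"

lemma graft_upd: "graft i m x w = (graft i m 0 w)(i := x)"
  by (auto simp: graft_def fun_eq_iff)

lemma args_in_UNIV [simp]: "args_in UNIV n v"
  by (simp add: args_in_def)

lemma chom_graft_add:
  assumes "f \<in> chom_carr A UNIV n" "i \<in> {1..n}"
  shows "eval a (f (graft i m (x + y) w)) = eval a (f (graft i m x w)) + eval a (f (graft i m y w))"
  unfolding graft_upd[of i m "x + y"] graft_upd[of i m x] graft_upd[of i m y]
  by (rule sesqui_add_arg[OF chom_sesqui[OF assms(1)] _ assms(2)]) simp_all

lemma chom_graft_scale:
  assumes "f \<in> chom_carr A UNIV n" "i \<in> {1..n}"
  shows "eval a (f (graft i m (c *s x) w)) = c *s eval a (f (graft i m x w))"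
  unfolding graft_upd[of i m "c *s x"] graft_upd[of i m x]
  by (rule sesqui_scale_arg[OF chom_sesqui[OF assms(1)] _ assms(2)]) simp_all

lemma chom_graft_uminus:
  assumes "f \<in> chom_carr A UNIV n" "i \<in> {1..n}"
  shows "eval a (f (graft i m (- x) w)) = - eval a (f (graft i m x w))"
  using chom_graft_scale[OF assms, of a m "- 1" x w] by simp

lemma chom_graft_der:
  assumes "f \<in> chom_carr A UNIV n" "i \<in> {1..n}"
  shows "eval a (f (graft i m (der A x) w)) = - (a i *s eval a (f (graft i m x w)))"
proof -
  have "graft i m (der A x) w = (graft i m x w)(i := der A (graft i m x w i))"
    by (auto simp: graft_def fun_eq_iff)
  then show ?thesis
    using sesqui_der_arg[OF chom_sesqui[OF assms(1)] _ assms(2)] by simp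
qed

lemma chom_graft_0:
  assumes "f \<in> chom_carr A UNIV n" "i \<in> {1..n}"
  shows "eval a (f (graft i m 0 w)) = 0"
  using chom_graft_scale[OF assms, of a m 0 0] by simp

lemma insert_eval_cong:
  assumes f: "f \<in> chom_carr A UNIV n" and g: "g \<in> chom_carr A UNIV m" and i: "1 \<le> i" "i \<le> n"
    and a: "\<And>j. 1 \<le> j \<Longrightarrow> j \<le> m + n - 1 \<Longrightarrow> a j = b j"
    and v: "\<And>j. 1 \<le> j \<Longrightarrow> j \<le> m + n - 1 \<Longrightarrow> v j = w j"
  shows "insert_eval i m f g c a v = insert_eval i m f g c b w"
proof -
  have "(\<Sum>s\<in>{i..<i + m}. a s) = (\<Sum>s\<in>{i..<i + m}. b s)"
    by (rule sum.cong) (use a i in auto)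
  moreover have "eval (block i a) (g (block i v)) = eval (block i b) (g (block i w))"
    by (rule chom_cong[OF g]) (use block_cong[OF i] a v in blast)+
  ultimately show ?thesis
    unfolding insert_eval_def insert_point_def
    by (intro chom_cong[OF f]) (simp_all only: graft_cong[OF i(1) a _ i(2)] graft_cong[OF i(1) v _ i(2)])
qed

lemma eval_chom_insert:
  assumes f: "f \<in> chom_carr A UNIV n" and g: "g \<in> chom_carr A UNIV m" and i: "1 \<le> i" "i \<le> n"
  shows "eval (a(0 := c)) (chom_insert A i m f g w) = insert_eval i m f g c a w"
proof -
  let ?a = "a(0 := c)"
  have "(\<lambda>j. pol_val ?a (if j < i then var j else if j = i then var 0 + (\<Sum>s\<in>{i..<i + m}. var s)
      else var (j + m - 1))) = insert_point i m c ?a"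
    by (auto simp: insert_point_def graft_def fun_eq_iff)
  moreover have "(\<lambda>j. if j < i then w j else if j = i then x else w (j + m - 1)) = graft i m x w" for x
    by (auto simp: graft_def fun_eq_iff)
  moreover have "(\<lambda>j. w (j + i - 1)) = block i w" "(\<lambda>j. ?a (j + i - 1)) = block i ?a"
    by (auto simp: block_def fun_eq_iff)
  ultimately have "eval ?a (chom_insert A i m f g w) = insert_eval i m f g c ?a w"
    unfolding chom_insert_def insert_eval_def using f i
    by (subst eval_pol_extend) (simp_all add: chom_graft_add[where n = n] chom_graft_scale[where n = n] del: fun_upd_apply)
  also have "\<dots> = insert_eval i m f g c a w"
    by (rule insert_eval_cong[OF f g i]) auto
  finally show ?thesis .
qed

lemma sesqui_insert_eval:
  assumes f: "f \<in> chom_carr A UNIV n" and g: "g \<in> chom_carr A UNIV m" and i: "1 \<le> i" "i \<le> n"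
  shows "sesqui UNIV (m + n - 1) a (insert_eval i m f g c a)"
proof (rule sesquiI)
  fix u v :: "nat \<Rightarrow> 'v" assume "\<And>j. j \<in> {1..m + n - 1} \<Longrightarrow> u j = v j"
  then show "insert_eval i m f g c a u = insert_eval i m f g c a v"
    by (intro insert_eval_cong[OF f g i]) auto
next
  fix v :: "nat \<Rightarrow> 'v" assume "\<not> args_in UNIV (m + n - 1) v"
  then show "insert_eval i m f g c a v = 0" by (simp add: args_in_def)
next
  let ?N = "m + n - 1"
  let ?\<Phi> = "insert_eval i m f g c a"
  let ?p = "insert_point i m c a"
  let ?y = "\<lambda>v. eval (block i a) (g (block i v))"
  have args: "args_in UNIV k w" for k and w :: "nat \<Rightarrow> 'v"
    by (simp add: args_in_def)
  have i': "i \<in> {1..n}" using i by simp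
  \<comment> \<open>Argument \<open>s\<close> of the composite is argument \<open>t\<close> of \<open>f\<close> or argument \<open>t\<close> of \<open>g\<close>.\<close>
  have cases: "(\<exists>t\<in>{1..n}. ?p t = a s \<and> (\<forall>v. graft i m (?y v) v t = v s) \<and>
        (\<forall>v x. ?\<Phi> (v(s := x)) = eval ?p (f ((graft i m (?y v) v)(t := x))))) \<or>
      (\<exists>t\<in>{1..m}. block i a t = a s \<and> (\<forall>v::nat \<Rightarrow> 'v. block i v t = v s) \<and>
        (\<forall>v x. ?\<Phi> (v(s := x)) = eval ?p (f (graft i m (eval (block i a) (g ((block i v)(t := x)))) v))))"
    if s: "s \<in> {1..?N}" for s
  proof (cases "i \<le> s \<and> s < i + m")
    case True
    let ?t = "s + 1 - i"
    have "?\<Phi> (v(s := x)) = eval ?p (f (graft i m (eval (block i a) (g ((block i v)(?t := x)))) v))" for v x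
    proof -
      have "block i (v(s := x)) = (block i v)(?t := x)"
        using True i by (auto simp: block_def fun_eq_iff)
      moreover have "graft i m y (v(s := x)) = graft i m y v" for y
        using True i by (auto simp: graft_def fun_eq_iff)
      ultimately show ?thesis by (simp add: insert_eval_def)
    qed
    moreover have "block i a ?t = a s" "block i v ?t = v s" for v :: "nat \<Rightarrow> 'v"
      using True by (simp_all add: block_def)
    moreover have "?t \<in> {1..m}" using True i by auto
    ultimately show ?thesis by blast
  next
    case False
    define t where "t = (if s < i then s else s + 1 - m)"
    have t: "t \<in> {1..n}" using False s i by (auto simp: t_def)
    have graft_t: "graft i m y w t = w s" for y :: 'b and w
      using False i by (auto simp: graft_def t_def)
    have "?\<Phi> (v(s := x)) = eval ?p (f ((graft i m (?y v) v)(t := x)))" for v x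
    proof -
      have "?y (v(s := x)) = ?y v"
        using False i by (intro chom_cong[OF g]) (auto simp: block_def)
      moreover have "graft i m y (v(s := x)) j = ((graft i m y v)(t := x)) j" for y j
        using False i s by (auto simp: graft_def t_def split: if_splits)
      then have "graft i m y (v(s := x)) = (graft i m y v)(t := x)" for y
        by (rule ext)
      ultimately show ?thesis by (simp add: insert_eval_def)
    qed
    moreover have "?p t = a s" "graft i m (?y v) v t = v s" for v
      using graft_t by (simp_all add: insert_point_def)
    ultimately show ?thesis using t by blast
  qed
  show "?\<Phi> (v(s := x + y)) = ?\<Phi> (v(s := x)) + ?\<Phi> (v(s := y))" if "s \<in> {1..?N}" for v s x y
    using cases[OF that] sesqui_add_arg[OF chom_sesqui[OF f] args _ UNIV_I UNIV_I]
      sesqui_add_arg[OF chom_sesqui[OF g] args _ UNIV_I UNIV_I] chom_graft_add[OF f i']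
    by (elim disjE bexE conjE) (simp_all del: fun_upd_apply)
  show "?\<Phi> (v(s := e *s x)) = e *s ?\<Phi> (v(s := x))" if "s \<in> {1..?N}" for v s x e
    using cases[OF that] sesqui_scale_arg[OF chom_sesqui[OF f] args _ UNIV_I]
      sesqui_scale_arg[OF chom_sesqui[OF g] args _ UNIV_I] chom_graft_scale[OF f i']
    by (elim disjE bexE conjE) (simp_all del: fun_upd_apply)
  show "?\<Phi> (v(s := der A (v s))) = - (a s *s ?\<Phi> v)" if "s \<in> {1..?N}" for v s
    using cases[OF that]
  proof (elim disjE bexE conjE)
    fix t assume t: "t \<in> {1..n}" "?p t = a s" "\<forall>v. graft i m (?y v) v t = v s"
      and upd: "\<forall>v x. ?\<Phi> (v(s := x)) = eval ?p (f ((graft i m (?y v) v)(t := x)))"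
    show ?thesis
      using sesqui_der_arg[OF chom_sesqui[OF f] args t(1), of ?p "graft i m (?y v) v"] t(2,3)
        upd[rule_format, of v "der A (v s)"] by (simp add: insert_eval_def)
  next
    fix t assume t: "t \<in> {1..m}" "block i a t = a s" "\<forall>v::nat \<Rightarrow> 'v. block i v t = v s"
      and upd: "\<forall>v x. ?\<Phi> (v(s := x)) = eval ?p (f (graft i m (eval (block i a) (g ((block i v)(t := x)))) v))"
    have "eval (block i a) (g ((block i v)(t := der A (v s)))) = - (a s *s ?y v)"
      using sesqui_der_arg[OF chom_sesqui[OF g] args t(1), of "block i a" "block i v"] t(2,3) by simp
    then show ?thesis
      using upd[rule_format, of v "der A (v s)"] by (simp add: chom_graft_uminus[OF f i'] chom_graft_scale[OF f i'] insert_eval_def)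
  qed
qed

lemma chom_hcomp:
  assumes "g \<in> chom_carr A UNIV m"
  shows "hcomp (chom A UNIV m) e g \<in> chom_carr A UNIV m"
  using hcomp_split(1)[OF superspace_chom[OF graded_submodule_UNIV], of g m e] assms
  by (auto intro: chom_part_carr)

definition prod_val ::
  "nat \<Rightarrow> nat \<Rightarrow> nat \<Rightarrow> ((nat \<Rightarrow> 'v) \<Rightarrow> 'v mpol) \<Rightarrow> ((nat \<Rightarrow> 'v) \<Rightarrow> 'v mpol) \<Rightarrow>
   'k \<Rightarrow> (nat \<Rightarrow> 'k) \<Rightarrow> (nat \<Rightarrow> 'v) \<Rightarrow> 'v" where
  "prod_val n m i f g c a v =
     (\<Sum>e\<in>{0, 1}. \<Sum>d\<in>degrees (m + n - 1). parity_sign (e * (\<Sum>j\<in>{1..<i}. d j)) *s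
        insert_eval i m f (hcomp (chom A UNIV m) e g) c a (\<lambda>j. hcomp A (d j) (v j)))"

text \<open>
  All coefficients of the product are known through one polynomial function of the power series
  variable, whatever the parities of \<open>g\<close> and of the arguments.
\<close>

lemma prod_coeffs:
  assumes f: "f \<in> chom_carr A UNIV n" and g: "g \<in> chom_carr A UNIV m" and i: "1 \<le> i" "i \<le> n"
  shows "power_coeffs (\<lambda>k a. eval a (chom_prod A n m i f g k v)) (\<lambda>c a. prod_val n m i f g c a v)"
  unfolding chom_prod_def prod_val_def eval_sum eval_scale eval_chom_insert[OF f chom_hcomp[OF g] i, symmetric]
  by (intro power_coeffs_sum power_coeffs_scale power_coeffs_var0_coeff)

text \<open>
  The coefficients inherit sesquilinearity from the polynomial function, by uniqueness of
  coefficients.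
\<close>

lemma power_coeffs_sesqui:
  assumes u: "\<And>v. power_coeffs (\<lambda>k a. u k a v) (\<lambda>c a. \<Phi> c a v)"
    and \<Phi>: "\<And>c a. sesqui U n a (\<Phi> c a)"
  shows "sesqui U n a (u k a)"
proof (rule sesquiI)
  fix v w :: "nat \<Rightarrow> 'v" assume "\<And>j. j \<in> {1..n} \<Longrightarrow> v j = w j"
  then have "\<Phi> c a v = \<Phi> c a w" for c a
    by (rule sesqui_cong[OF \<Phi>])
  then show "u k a v = u k a w"
    using power_coeffs_unique[OF u[of v], of "\<lambda>k a. u k a w" k a] u[of w] by simp
next
  fix v assume "\<not> args_in U n v"
  then have "\<Phi> c a v = 0" for c a by (rule sesqui_outside[OF \<Phi>])
  then show "u k a v = 0"
    using power_coeffs_unique[OF u[of v], of "\<lambda>k a. 0" k a] power_coeffs_0 by simp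
next
  fix v i x y assume *: "args_in U n v" "i \<in> {1..n}" "x \<in> U" "y \<in> U"
  show "u k a (v(i := x + y)) = u k a (v(i := x)) + u k a (v(i := y))"
    using u[of "v(i := x + y)"] power_coeffs_add[OF u[of "v(i := x)"] u[of "v(i := y)"]]
    unfolding sesqui_add_arg[OF \<Phi> *] by (rule power_coeffs_unique)
next
  fix v i c x assume *: "args_in U n v" "i \<in> {1..n}" "x \<in> U"
  show "u k a (v(i := c *s x)) = c *s u k a (v(i := x))"
    using u[of "v(i := c *s x)"] power_coeffs_scale[OF u[of "v(i := x)"], of c]
    unfolding sesqui_scale_arg[OF \<Phi> *] by (rule power_coeffs_unique)
next
  fix v i assume *: "args_in U n v" "i \<in> {1..n}"
  have "power_coeffs (\<lambda>k a. - (a i *s u k a v)) (\<lambda>c a. - (a i *s \<Phi> c a v))"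
    by (rule power_coeffs_linear[OF u, where h = "\<lambda>a x. - (a i *s x)"])
       (auto simp: scale_right_distrib mult.commute)
  then show "u k a (v(i := der A (v i))) = - (a i *s u k a v)"
    using u[of "v(i := der A (v i))"] unfolding sesqui_der_arg[OF \<Phi> *]
    by (intro power_coeffs_unique[of "\<lambda>k a. u k a (v(i := der A (v i)))"])
qed

lemma chom_prod_carr:
  assumes f: "f \<in> chom_carr A UNIV n" and g: "g \<in> chom_carr A UNIV m" and i: "1 \<le> i" "i \<le> n"
  shows "chom_prod A n m i f g k \<in> chom_carr A UNIV (m + n - 1)"
proof (rule chom_carrI)
  let ?ins = "\<lambda>e c a w. insert_eval i m f (hcomp (chom A UNIV m) e g) c a w"
  have "sesqui UNIV (m + n - 1) a (\<lambda>w. parity_sign (e * (\<Sum>j\<in>{1..<i}. d j)) *s ?ins e c a w)" for e d c a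
    by (intro sesqui_scale sesqui_insert_eval[OF f chom_hcomp[OF g] i])
  from sesqui_polarize[OF graded_submodule_UNIV this]
  have "sesqui UNIV (m + n - 1) a (\<lambda>v. \<Sum>d\<in>degrees (m + n - 1).
      parity_sign (e * (\<Sum>j\<in>{1..<i}. d j)) *s ?ins e c a (\<lambda>j. hcomp A (d j) (v j)))" for e c a
    by (simp add: args_in_def)
  then show "sesqui UNIV (m + n - 1) a (\<lambda>v. eval a (chom_prod A n m i f g k v))" for a
    unfolding prod_val_def[abs_def]
    by (intro power_coeffs_sesqui[OF prod_coeffs[OF f g i, unfolded prod_val_def]] sesqui_sum[where I = "{0, 1}"])
next
  fix v and a b :: "nat \<Rightarrow> 'k" assume ab: "\<And>j. j \<in> {1..m + n - 1} \<Longrightarrow> a j = b j"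
  have "insert_eval i m f (hcomp (chom A UNIV m) e g) c a w = insert_eval i m f (hcomp (chom A UNIV m) e g) c b w" for e c w
    by (rule insert_eval_cong[OF f chom_hcomp[OF g] i]) (use ab in auto)
  then show "eval a (chom_prod A n m i f g k v) = eval b (chom_prod A n m i f g k v)"
    using power_coeffs_reparam[OF prod_coeffs[OF f g i, of v], of "\<lambda>_::unit. a"]
      power_coeffs_reparam[OF prod_coeffs[OF f g i, of v], of "\<lambda>_::unit. b"]
    by (intro power_coeffs_unique[of "\<lambda>k (_::unit). eval a (chom_prod A n m i f g k v)" _
          "\<lambda>k (_::unit). eval b (chom_prod A n m i f g k v)"]) (simp_all add: prod_val_def)
qed

text \<open>
  The formula that defines the products: for homogeneous \<open>g\<close> and homogeneous arguments a single term
  remains.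
\<close>

lemma prod_coeffs_homog:
  assumes f: "f \<in> chom_carr A UNIV n" and g: "g \<in> chom_part A UNIV m e" and i: "1 \<le> i" "i \<le> n"
    and v: "homog UNIV (m + n - 1) d v"
  shows "power_coeffs (\<lambda>k a. eval a (chom_prod A n m i f g k v))
    (\<lambda>c a. parity_sign (e * (\<Sum>j\<in>{1..<i}. d j)) *s insert_eval i m f g c a v)"
proof -
  have g': "g \<in> chom_carr A UNIV m" by (rule chom_part_carr[OF g])
  let ?N = "m + n - 1"
  let ?T = "\<lambda>e' c a d w. parity_sign (e' * (\<Sum>j\<in>{1..<i}. d j)) *s
       insert_eval i m f (hcomp (chom A UNIV m) e' g) c a w"
  have T: "sesqui UNIV ?N a (?T e' c a d)" for e' c a d
    by (intro sesqui_scale sesqui_insert_eval[OF f chom_hcomp[OF g'] i])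
  have hcomp: "hcomp (chom A UNIV m) e' g = (if e' = e then g else 0)" for e'
    using hcomp_homogeneous[OF superspace_chom[OF graded_submodule_UNIV], of g m e e'] g by simp
  have "insert_eval i m f 0 c a w = 0" for c a w
    using chom_graft_0[OF f, of i] i by (simp add: insert_eval_def)
  moreover have "(\<Sum>j\<in>{1..<i}. restrict d {1..?N} j) = (\<Sum>j\<in>{1..<i}. d j)"
    by (rule sum.cong) (use i in auto)
  ultimately have "(\<Sum>d\<in>degrees ?N. ?T e' c a d (\<lambda>j. hcomp A (d j) (v j))) =
      (if e' = e then parity_sign (e * (\<Sum>j\<in>{1..<i}. d j)) *s insert_eval i m f g c a v else 0)" for e' c a
    unfolding polarize_homog[OF T v] by (simp add: hcomp)
  then show ?thesis
    using prod_coeffs[OF f g' i, of v] unfolding prod_val_def by (cases e rule: bit_cases) simp_all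
qed

lemma homog_block:
  assumes v: "homog UNIV (m + n - 1) d v" and i: "1 \<le> i" "i \<le> n"
  shows "homog UNIV m (block i d) (block i v)"
proof -
  have v': "v j \<in> part A (d j)" if "1 \<le> j" "j \<le> m + n - 1" for j
    using v that by (simp add: homog_def)
  have "v (j + i - 1) \<in> part A (d (j + i - 1))" if "j \<in> {1..m}" for j
    using i that by (intro v') auto
  then show ?thesis by (simp add: homog_def block_def)
qed

lemma homog_graft:
  assumes v: "homog UNIV (m + n - 1) d v" and i: "1 \<le> i" "i \<le> n" and x: "x \<in> part A e"
  shows "homog UNIV n (graft i m e d) (graft i m x v)"
proof -
  have v: "v j \<in> part A (d j)" if "1 \<le> j" "j \<le> m + n - 1" for j
    using v that by (simp add: homog_def)
  have "v (j + m - 1) \<in> part A (d (j + m - 1))" if "i < j" "j \<le> n" for j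
    using i that by (intro v) auto
  then show ?thesis
    using i x v by (auto simp: homog_def graft_def)
qed

lemma eval_block_part:
  assumes g: "g \<in> chom_part A UNIV m e" and i: "1 \<le> i" "i \<le> n"
    and v: "homog UNIV (m + n - 1) d v"
  shows "eval a (g (block i v)) \<in> part A (e + (\<Sum>j\<in>{i..<i + m}. d j))"
  using chom_part_eval[OF g homog_block[OF v i]] sum_block[OF i(1), where m = m and w = d] by simp

lemma chom_prod_part:
  assumes f: "f \<in> chom_part A UNIV n e" and g: "g \<in> chom_part A UNIV m e'" and i: "1 \<le> i" "i \<le> n"
  shows "chom_prod A n m i f g k \<in> chom_part A UNIV (m + n - 1) (e + e')"
proof -
  note f' = chom_part_carr[OF f] and g' = chom_part_carr[OF g]
  have "eval a (chom_prod A n m i f g k v) \<in> part A (e + e' + (\<Sum>j\<in>{1..m + n - 1}. d j))"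
    if v: "homog UNIV (m + n - 1) d v" for a d v
  proof (rule power_coeffs_in_subspace[OF prod_coeffs_homog[OF f' g i v] part_subspace])
    let ?s = "\<Sum>j\<in>{i..<i + m}. d j"
    have cancel: "x = e' + y" if "x + s = (e' + s) + y" for x y s :: bit
      using that by (simp add: ac_simps)
    have "(\<Sum>j\<in>{1..n}. graft i m (e' + ?s) d j) = e' + (\<Sum>j\<in>{1..m + n - 1}. d j)"
      by (rule cancel[OF sum_graft[OF i]])
    then have "insert_eval i m f g c a v \<in> part A (e + e' + (\<Sum>j\<in>{1..m + n - 1}. d j))" for c
      using chom_part_eval[OF f homog_graft[OF v i eval_block_part[OF g i v]], of "insert_point i m c a"]
      by (simp add: insert_eval_def add.assoc)
    then show "parity_sign (e' * (\<Sum>j\<in>{1..<i}. d j)) *s insert_eval i m f g c a v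
        \<in> part A (e + e' + (\<Sum>j\<in>{1..m + n - 1}. d j))" for c
      by (rule subspace_scale[OF part_subspace])
  qed
  then show ?thesis
    unfolding chom_part_iff using chom_prod_carr[OF f' g' i] by blast
qed

lemma chom_prod_eqI:
  assumes "f \<in> chom_carr A UNIV n" "g \<in> chom_carr A UNIV m" "1 \<le> i" "i \<le> n"
    and "\<And>v. power_coeffs (\<lambda>k a. eval a (u k v)) (\<lambda>c a. prod_val n m i f g c a v)"
  shows "chom_prod A n m i f g k = u k"
  by (intro ext mpol_eqI) (rule power_coeffs_unique[OF prod_coeffs[OF assms(1-4)] assms(5)])

lemma chom_prod_add_left:
  assumes "f \<in> chom_carr A UNIV n" "f' \<in> chom_carr A UNIV n" "g \<in> chom_carr A UNIV m" "1 \<le> i" "i \<le> n"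
  shows "chom_prod A n m i (f + f') g k = chom_prod A n m i f g k + chom_prod A n m i f' g k"
proof (rule chom_prod_eqI[OF chom_carr_add[OF assms(1,2)] assms(3-5)])
  have "prod_val n m i (f + f') g c a v = prod_val n m i f g c a v + prod_val n m i f' g c a v" for c a v
    by (simp add: prod_val_def insert_eval_def scale_right_distrib sum.distrib add_ac)
  then show "power_coeffs (\<lambda>k a. eval a ((chom_prod A n m i f g k + chom_prod A n m i f' g k) v))
      (\<lambda>c a. prod_val n m i (f + f') g c a v)" for v
    using power_coeffs_add[OF prod_coeffs[OF assms(1,3-5)] prod_coeffs[OF assms(2-5)]] by simp
qed

lemma chom_prod_smult_left:
  assumes "f \<in> chom_carr A UNIV n" "g \<in> chom_carr A UNIV m" "1 \<le> i" "i \<le> n"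
  shows "chom_prod A n m i (\<lambda>v. Poly_Mapping.map (smult A e) (f v)) g k =
    (\<lambda>v. Poly_Mapping.map (smult A e) (chom_prod A n m i f g k v))"
proof (rule chom_prod_eqI[OF chom_carr_smult[OF assms(1)] assms(2-4)])
  have "prod_val n m i (\<lambda>v. Poly_Mapping.map (smult A e) (f v)) g c a v = e *s prod_val n m i f g c a v" for c a v
    by (simp add: prod_val_def insert_eval_def scale_right_distrib scale_sum_right mult.commute)
  then show "power_coeffs (\<lambda>k a. eval a (Poly_Mapping.map (smult A e) (chom_prod A n m i f g k v)))
      (\<lambda>c a. prod_val n m i (\<lambda>v. Poly_Mapping.map (smult A e) (f v)) g c a v)" for v
    using power_coeffs_scale[OF prod_coeffs[OF assms], of e] by simp
qed

lemma chom_prod_add_right: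
  assumes "f \<in> chom_carr A UNIV n" "g \<in> chom_carr A UNIV m" "g' \<in> chom_carr A UNIV m" "1 \<le> i" "i \<le> n"
  shows "chom_prod A n m i f (g + g') k = chom_prod A n m i f g k + chom_prod A n m i f g' k"
proof (rule chom_prod_eqI[OF assms(1) chom_carr_add[OF assms(2,3)] assms(4,5)])
  have i: "i \<in> {1..n}" using assms by simp
  have "hcomp (chom A UNIV m) e (g + g') = hcomp (chom A UNIV m) e g + hcomp (chom A UNIV m) e g'" for e
    using assms by (intro hcomp_add[OF superspace_chom[OF graded_submodule_UNIV]]) auto
  then have "prod_val n m i f (g + g') c a v = prod_val n m i f g c a v + prod_val n m i f g' c a v" for c a v
    by (simp add: prod_val_def insert_eval_def chom_graft_add[OF assms(1) i] scale_right_distrib sum.distrib add_ac)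
  then show "power_coeffs (\<lambda>k a. eval a ((chom_prod A n m i f g k + chom_prod A n m i f g' k) v))
      (\<lambda>c a. prod_val n m i f (g + g') c a v)" for v
    using power_coeffs_add[OF prod_coeffs[OF assms(1,2,4,5)] prod_coeffs[OF assms(1,3-5)]] by simp
qed

lemma chom_prod_smult_right:
  assumes "f \<in> chom_carr A UNIV n" "g \<in> chom_carr A UNIV m" "1 \<le> i" "i \<le> n"
  shows "chom_prod A n m i f (\<lambda>v. Poly_Mapping.map (smult A e) (g v)) k =
    (\<lambda>v. Poly_Mapping.map (smult A e) (chom_prod A n m i f g k v))"
proof (rule chom_prod_eqI[OF assms(1) chom_carr_smult[OF assms(2)] assms(3,4)])
  have i: "i \<in> {1..n}" using assms by simp
  have "hcomp (chom A UNIV m) b (\<lambda>v. Poly_Mapping.map (smult A e) (g v)) =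
      (\<lambda>v. Poly_Mapping.map (smult A e) (hcomp (chom A UNIV m) b g v))" for b
    using hcomp_smult[OF superspace_chom[OF graded_submodule_UNIV], of g m b e] assms by simp
  then have "prod_val n m i f (\<lambda>v. Poly_Mapping.map (smult A e) (g v)) c a v = e *s prod_val n m i f g c a v" for c a v
    by (simp add: prod_val_def insert_eval_def chom_graft_scale[OF assms(1) i] scale_right_distrib scale_sum_right mult.commute)
  then show "power_coeffs (\<lambda>k a. eval a (Poly_Mapping.map (smult A e) (chom_prod A n m i f g k v)))
      (\<lambda>c a. prod_val n m i f (\<lambda>v. Poly_Mapping.map (smult A e) (g v)) c a v)" for v
    using power_coeffs_scale[OF prod_coeffs[OF assms], of e] by simp
qed

end

lemma sum_fun_apply: "(\<Sum>i\<in>I. q i) v = (\<Sum>i\<in>I. q i v)"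
  for q :: "'i \<Rightarrow> 'x \<Rightarrow> 'y::comm_monoid_add"
  by (induction I rule: infinite_finite_induct) auto

context even_superspace
begin

text \<open>
  The sign in the products is explicit for homogeneous \<open>g\<close> only; additivity extends identities to all
  \<open>g\<close>.
\<close>

lemma chom_induct_homog [consumes 1, case_names homog add]:
  assumes g: "g \<in> chom_carr A UNIV m"
    and homog: "\<And>e g. g \<in> chom_part A UNIV m e \<Longrightarrow> P g"
    and add: "\<And>g g'. g \<in> chom_carr A UNIV m \<Longrightarrow> g' \<in> chom_carr A UNIV m \<Longrightarrow> P g \<Longrightarrow> P g' \<Longrightarrow> P (g + g')"
  shows "P g"
proof -
  note split = hcomp_split[OF superspace_chom[OF graded_submodule_UNIV], of g m, simplified, OF g]
  have "P (hcomp (chom A UNIV m) 0 g + hcomp (chom A UNIV m) 1 g)"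
    using split(1) by (intro add homog) (auto intro: chom_part_carr)
  then show ?thesis by (simp add: split(3))
qed

lemma chom_family_eqI:
  assumes "\<And>k. u k \<in> chom_carr A UNIV n" "\<And>k. u' k \<in> chom_carr A UNIV n"
    and "\<And>d v. homog UNIV n d v \<Longrightarrow> power_coeffs (\<lambda>k a. eval a (u k v)) (F d v)"
    and "\<And>d v. homog UNIV n d v \<Longrightarrow> power_coeffs (\<lambda>k a. eval a (u' k v)) (F d v)"
  shows "u k = u' k"
proof (rule chom_eqI[OF graded_submodule_UNIV assms(1,2)])
  show "eval a (u k v) = eval a (u' k v)" if "homog UNIV n d v" for a d v
    using power_coeffs_unique[OF assms(3,4)[OF that], where k = k and x = a] .
qed

text \<open>
  The form in which all identities between coefficients are proved: it suffices that, on homogeneous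
  arguments, both sides are the coefficients of the same polynomial function. There is one version
  for one power series variable and one for two.
\<close>

lemma chom_double_family_eqI:
  assumes "\<And>a b. u a b \<in> chom_carr A UNIV n" "\<And>a b. u' a b \<in> chom_carr A UNIV n"
    and "\<And>d v \<alpha>. homog UNIV n d v \<Longrightarrow> double_coeffs (\<lambda>a b. eval \<alpha> (u a b v)) (G d v \<alpha>)"
    and "\<And>d v \<alpha>. homog UNIV n d v \<Longrightarrow> double_coeffs (\<lambda>a b. eval \<alpha> (u' a b v)) (G d v \<alpha>)"
  shows "u a b = u' a b"
proof (rule chom_eqI[OF graded_submodule_UNIV assms(1,2)])
  show "eval \<alpha> (u a b v) = eval \<alpha> (u' a b v)" if "homog UNIV n d v" for \<alpha> d v
    using double_coeffs_unique[OF assms(3,4)[OF that]] .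
qed

lemma chom_carr_sum:
  assumes "\<And>s. q s \<in> chom_carr A U n"
  shows "(\<Sum>s\<in>I. q s) \<in> chom_carr A U n"
proof (induction I rule: infinite_finite_induct)
  case (insert s I)
  then show ?case
    by (simp only: sum.insert[OF insert.hyps] chom_carr_add assms)
next
  case (infinite I)
  then have "sum q I = 0" by (rule sum.infinite)
  then show ?case by (simp only: chom_carr_0)
qed (simp only: sum.empty chom_carr_0)

section \<open>Sesquilinearity of the products\<close>

lemma sum_insert_point:
  assumes "1 \<le> i" "i \<le> n"
  shows "(\<Sum>j\<in>{1..n}. insert_point i m c a j) = c + (\<Sum>j\<in>{1..m + n - 1}. a j)"
  using sum_graft[OF assms, of m "c + (\<Sum>s\<in>{i..<i + m}. a s)" a]
  by (simp add: insert_point_def algebra_simps)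

lemma series_times_var_add:
  "series_times_var (\<lambda>k. u k + w k) k = series_times_var u k + series_times_var w k"
  for u w :: "nat \<Rightarrow> 'x::monoid_add"
  by (simp add: series_times_var_def)

lemma chom_prod_add_right':
  assumes "f \<in> chom_carr A UNIV n" "g \<in> chom_carr A UNIV m" "g' \<in> chom_carr A UNIV m" "1 \<le> i" "i \<le> n"
  shows "chom_prod A n m i f (g + g') = (\<lambda>k. chom_prod A n m i f g k + chom_prod A n m i f g' k)"
  by (rule ext) (rule chom_prod_add_right[OF assms])

lemma chom_carr_series_times_var:
  assumes "\<And>k. u k \<in> chom_carr A U n"
  shows "series_times_var u k \<in> chom_carr A U n"
  using assms by (simp add: series_times_var_def chom_carr_0)

lemma power_coeffs_series_times_var:
  assumes "power_coeffs (\<lambda>k a. eval a (u k v)) F"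
  shows "power_coeffs (\<lambda>k a. eval a (series_times_var u k v)) (\<lambda>c a. c *s F c a)"
proof -
  have "eval a (series_times_var u k v) = (if k = 0 then 0 else eval a (u (k - 1) v))" for a k
    by (simp add: series_times_var_def)
  then show ?thesis
    using power_coeffs_shift[OF assms] by simp
qed

text \<open>
  The coordinates of the point at which \<open>f\<close> is evaluated add up to \<open>\<lambda> + \<mu>\<^sub>1 + \<dots> + \<mu>\<^sub>m\<^sub>+\<^sub>n\<^sub>-\<^sub>1\<close>
  (\<open>sum_insert_point\<close>); so \<open>\<partial>\<close> acting on \<open>f\<close> and \<open>\<partial>\<close> acting on the product differ by \<open>\<lambda>\<close>.
\<close>

lemma chom_prod_der_left:
  assumes f: "f \<in> chom_carr A UNIV n" and g: "g \<in> chom_carr A UNIV m" and i: "1 \<le> i" "i \<le> n"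
  shows "chom_prod A n m i (chom_der A n f) g k =
    series_times_var (chom_prod A n m i f g) k + chom_der A (m + n - 1) (chom_prod A n m i f g k)"
  using g
proof (induction rule: chom_induct_homog)
  case (homog e g)
  let ?N = "m + n - 1"
  note g = chom_part_carr[OF homog]
  show ?case
  proof (rule chom_family_eqI[where u = "chom_prod A n m i (chom_der A n f) g"])
    show "chom_prod A n m i (chom_der A n f) g k \<in> chom_carr A UNIV ?N" for k
      by (intro chom_prod_carr chom_carr_der f g i)
    show "series_times_var (chom_prod A n m i f g) k + chom_der A ?N (chom_prod A n m i f g k) \<in> chom_carr A UNIV ?N" for k
      by (intro chom_carr_add chom_carr_series_times_var chom_carr_der chom_prod_carr f g i)
    fix d v assume v: "homog UNIV ?N d v"
    let ?s = "parity_sign (e * (\<Sum>j\<in>{1..<i}. d j)) :: 'k" and ?ins = "\<lambda>c a. insert_eval i m f g c a v"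
    note uf = prod_coeffs_homog[OF f homog i v]
    have "insert_eval i m (chom_der A n f) g c a v =
        der A (?ins c a) + (c + (\<Sum>j\<in>{1..?N}. a j)) *s ?ins c a" for c a
      by (simp only: insert_eval_def eval_chom_der sum_insert_point[OF i])
    then show "power_coeffs (\<lambda>k a. eval a (chom_prod A n m i (chom_der A n f) g k v))
        (\<lambda>c a. ?s *s (der A (?ins c a) + (c + (\<Sum>j\<in>{1..?N}. a j)) *s ?ins c a))"
      using prod_coeffs_homog[OF chom_carr_der[OF f] homog i v] by simp
    have "power_coeffs (\<lambda>k a. der A (eval a (chom_prod A n m i f g k v)) +
          (\<Sum>j\<in>{1..?N}. a j) *s eval a (chom_prod A n m i f g k v))
        (\<lambda>c a. der A (?s *s ?ins c a) + (\<Sum>j\<in>{1..?N}. a j) *s (?s *s ?ins c a))"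
      by (rule power_coeffs_linear[OF uf, where h = "\<lambda>a x. der A x + (\<Sum>j\<in>{1..?N}. a j) *s x"])
         (auto simp: der_add der_scale scale_right_distrib mult.commute)
    from power_coeffs_add[OF power_coeffs_series_times_var[where u = "chom_prod A n m i f g" and v = v, OF uf] this]
    show "power_coeffs (\<lambda>k a. eval a ((series_times_var (chom_prod A n m i f g) k +
          chom_der A ?N (chom_prod A n m i f g k)) v))
        (\<lambda>c a. ?s *s (der A (?ins c a) + (c + (\<Sum>j\<in>{1..?N}. a j)) *s ?ins c a))"
      by (simp add: eval_chom_der der_scale scale_right_distrib scale_left_distrib mult_ac add_ac)
  qed
next
  case (add g g')
  have "chom_der A (m + n - 1) (p + q) = chom_der A (m + n - 1) p + chom_der A (m + n - 1) q" for p q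
    by (intro ext mpol_eqI) (simp add: eval_chom_der der_add scale_right_distrib)
  then show ?case
    by (simp only: chom_prod_add_right'[OF chom_carr_der[OF f] add(1,2) i] chom_prod_add_right'[OF f add(1,2) i]
        series_times_var_add add(3,4)) (simp only: ac_simps)
qed

text \<open>
  The \<open>i\<close>-th argument of \<open>f\<close> becomes \<open>(\<partial> + \<mu>\<^sub>i + \<dots> + \<mu>\<^sub>i\<^sub>+\<^sub>m\<^sub>-\<^sub>1) g\<close>, and \<open>\<partial>\<close> acts there as
  \<open>- (\<lambda> + \<mu>\<^sub>i + \<dots> + \<mu>\<^sub>i\<^sub>+\<^sub>m\<^sub>-\<^sub>1)\<close>, which leaves \<open>- \<lambda>\<close>.
\<close>

lemma chom_prod_der_right:
  assumes f: "f \<in> chom_carr A UNIV n" and g: "g \<in> chom_carr A UNIV m" and i: "1 \<le> i" "i \<le> n"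
  shows "chom_prod A n m i f (chom_der A m g) k = - series_times_var (chom_prod A n m i f g) k"
  using g
proof (induction rule: chom_induct_homog)
  case (homog e g)
  let ?N = "m + n - 1"
  note g = chom_part_carr[OF homog]
  have dg: "chom_der A m g \<in> chom_part A UNIV m e"
    using dS_superspace_chom[OF graded_submodule_UNIV, of m] homog
    by (simp add: dS_superspace_def d_superspace_def even_linear_def)
  have i': "i \<in> {1..n}" using i by simp
  have neg: "- series_times_var u k = (\<lambda>v. Poly_Mapping.map (smult A (- 1)) (series_times_var u k v))"
    for u :: "nat \<Rightarrow> (nat \<Rightarrow> 'v) \<Rightarrow> 'v mpol" and k
    by (intro ext mpol_eqI) simp
  show ?case
    unfolding neg
  proof (rule chom_family_eqI[where u = "chom_prod A n m i f (chom_der A m g)"])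
    show "chom_prod A n m i f (chom_der A m g) k \<in> chom_carr A UNIV ?N" for k
      by (intro chom_prod_carr chom_carr_der f g i)
    show "(\<lambda>v. Poly_Mapping.map (smult A (- 1)) (series_times_var (chom_prod A n m i f g) k v)) \<in> chom_carr A UNIV ?N" for k
      by (intro chom_carr_smult chom_carr_series_times_var chom_prod_carr f g i)
    fix d v assume v: "homog UNIV ?N d v"
    let ?s = "parity_sign (e * (\<Sum>j\<in>{1..<i}. d j)) :: 'k" and ?ins = "\<lambda>c a. insert_eval i m f g c a v"
    have "insert_eval i m f (chom_der A m g) c a v = (- c) *s ?ins c a" for c a
    proof -
      have "(\<Sum>j\<in>{1..m}. block i a j) = (\<Sum>s\<in>{i..<i + m}. a s)"
        by (rule sum_block[OF i(1)])
      moreover have "insert_point i m c a i = c + (\<Sum>s\<in>{i..<i + m}. a s)"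
        by (simp add: insert_point_def graft_def)
      ultimately show ?thesis
        by (simp only: insert_eval_def eval_chom_der chom_graft_add[OF f i'] chom_graft_der[OF f i']
            chom_graft_scale[OF f i']) (simp add: scale_left_distrib)
    qed
    then show "power_coeffs (\<lambda>k a. eval a (chom_prod A n m i f (chom_der A m g) k v))
        (\<lambda>c a. (- 1) *s c *s ?s *s ?ins c a)"
      using prod_coeffs_homog[OF f dg i v] by (simp add: mult.commute)
    show "power_coeffs (\<lambda>k a. eval a (Poly_Mapping.map (smult A (- 1)) (series_times_var (chom_prod A n m i f g) k v)))
        (\<lambda>c a. (- 1) *s c *s ?s *s ?ins c a)"
      unfolding eval_scale
      by (intro power_coeffs_scale power_coeffs_series_times_var prod_coeffs_homog[OF f homog i v])
  qed
next
  case (add g g')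
  have "chom_der A m (g + g') = chom_der A m g + chom_der A m g'"
    by (intro ext mpol_eqI) (simp add: eval_chom_der der_add scale_right_distrib)
  then show ?case
    by (simp only: chom_prod_add_right'[OF f chom_carr_der[OF add(1)] chom_carr_der[OF add(2)] i]
        chom_prod_add_right'[OF f add(1,2) i] series_times_var_add add(3,4) minus_add_distrib)
qed

section \<open>Associativity\<close>

text \<open>
  The iterated product as a polynomial function of both power series variables. The vector that
  the inner map \<open>h\<close> contributes does not involve \<open>c'\<close>, so the degree bound for the coefficients of
  \<open>f \<circ>\<^sup>i g\<close> is uniform in \<open>c'\<close>, as \<open>double_coeffsI\<close> demands.
\<close>

lemma double_prod_coeffs:
  assumes f: "f \<in> chom_carr A UNIV n" and g: "g \<in> chom_part A UNIV m e" and h: "h \<in> chom_part A UNIV l e'"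
    and i: "1 \<le> i" "i \<le> n" and j: "1 \<le> j" "j \<le> m + n - 1"
    and v: "homog UNIV (l + (m + n - 1) - 1) d v"
  shows "double_coeffs
    (\<lambda>a b. eval \<alpha> (chom_prod A (m + n - 1) l j (chom_prod A n m i f g a) h b v))
    (\<lambda>c c'. (parity_sign (e' * (\<Sum>s\<in>{1..<j}. d s)) *
        parity_sign (e * (\<Sum>s\<in>{1..<i}. graft j l (e' + (\<Sum>s\<in>{j..<j + l}. d s)) d s))) *s
      insert_eval i m f g c (insert_point j l c' \<alpha>) (graft j l (eval (block j \<alpha>) (h (block j v))) v))"
proof (rule double_coeffsI)
  note g' = chom_part_carr[OF g]
  let ?s = "parity_sign (e' * (\<Sum>s\<in>{1..<j}. d s)) :: 'k"
  let ?d = "graft j l (e' + (\<Sum>s\<in>{j..<j + l}. d s)) d"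
  let ?v = "graft j l (eval (block j \<alpha>) (h (block j v))) v"
  have v': "homog UNIV (m + n - 1) ?d ?v"
    by (rule homog_graft[OF v j eval_block_part[OF h j v]])
  show "power_coeffs (\<lambda>a c'. ?s *s eval (insert_point j l c' \<alpha>) (chom_prod A n m i f g a ?v))
    (\<lambda>c c'. (?s * parity_sign (e * (\<Sum>s\<in>{1..<i}. ?d s))) *s
      insert_eval i m f g c (insert_point j l c' \<alpha>) ?v)"
    using power_coeffs_scale[OF power_coeffs_reparam[OF prod_coeffs_homog[OF f g i v'], of "\<lambda>c'. insert_point j l c' \<alpha>"], of ?s]
    by simp
  show "power_coeffs (\<lambda>b (_::unit). eval \<alpha> (chom_prod A (m + n - 1) l j (chom_prod A n m i f g a) h b v))
    (\<lambda>c' _. ?s *s eval (insert_point j l c' \<alpha>) (chom_prod A n m i f g a ?v))" for a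
    using power_coeffs_reparam[OF prod_coeffs_homog[OF chom_prod_carr[OF f g' i] h j v], of "\<lambda>_. \<alpha>" a]
    by (simp add: insert_eval_def)
qed

lemma graft_graft_disjoint:
  assumes "1 \<le> j" "j < i" "1 \<le> t"
  shows "graft i m y (graft j l x w) t = graft j l x (graft (l + i - 1) m y w) t"
proof (cases "j < t")
  case True
  then have "t + l - 1 < l + i - 1 \<longleftrightarrow> t < i" "t + l - 1 = l + i - 1 \<longleftrightarrow> t = i"
    "i < t \<Longrightarrow> j < t + m - 1" "t + m - 1 + l - 1 = t + l - 1 + m - 1"
    using assms by auto
  with True assms show ?thesis
    by (cases t i rule: linorder_cases) (simp_all add: graft_def del: One_nat_def)
qed (use assms in \<open>auto simp: graft_def\<close>)

lemma block_graft_before: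
  assumes "1 \<le> j" "j < i" "1 \<le> t"
  shows "block i (graft j l x w) t = block (l + i - 1) w t"
proof -
  have "\<not> t + i - 1 < j" "t + i - 1 \<noteq> j" "t + (l + i - 1) - 1 = t + i - 1 + l - 1"
    using assms by auto
  then show ?thesis
    using assms by (simp add: graft_def block_def del: One_nat_def)
qed

lemma block_graft_after:
  assumes "1 \<le> j" "j < i" "1 \<le> t" "t \<le> l"
  shows "block j (graft (l + i - 1) m y w) t = block j w t"
  using assms by (auto simp: graft_def block_def)

text \<open>
  The two insertions change disjoint parts of the arguments and of the point. While the arguments of
  \<open>h\<close>, \<open>l\<close> in number, are still present, position \<open>i\<close> of \<open>f\<close> is position \<open>l + i - 1\<close> of the composite.
\<close>

lemma insert_eval_commute:
  assumes f: "f \<in> chom_carr A UNIV n" and g: "g \<in> chom_carr A UNIV m" and h: "h \<in> chom_carr A UNIV l"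
    and j: "1 \<le> j" "j < i"
  shows "insert_eval i m f g c (insert_point j l c' \<alpha>) (graft j l (eval (block j \<alpha>) (h (block j v))) v) =
    insert_eval j l f h c' (insert_point (l + i - 1) m c \<alpha>)
      (graft (l + i - 1) m (eval (block (l + i - 1) \<alpha>) (g (block (l + i - 1) v))) v)"
proof -
  let ?i = "l + i - 1"
  define x where "x = eval (block j \<alpha>) (h (block j v))"
  define y where "y = eval (block ?i \<alpha>) (g (block ?i v))"
  have i: "1 \<le> i" "1 \<le> ?i" using j by auto
  have y': "eval (block i (insert_point j l c' \<alpha>)) (g (block i (graft j l x v))) = y"
    unfolding y_def insert_point_def by (rule chom_cong[OF g]; rule block_graft_before[OF j]; simp)
  have x': "eval (block j (insert_point ?i m c \<alpha>)) (h (block j (graft ?i m y v))) = x"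
    unfolding x_def insert_point_def by (rule chom_cong[OF h]; rule block_graft_after[OF j]; simp)
  have sum_i: "(\<Sum>s\<in>{i..<i + m}. insert_point j l c' \<alpha> s) = (\<Sum>s\<in>{?i..<?i + m}. \<alpha> s)"
  proof -
    have "(\<Sum>s\<in>{1..m}. block i (insert_point j l c' \<alpha>) s) = (\<Sum>s\<in>{1..m}. block ?i \<alpha> s)"
      unfolding insert_point_def by (intro sum.cong refl block_graft_before[OF j]) simp
    then show ?thesis
      by (simp only: sum_block[OF i(1)] sum_block[OF i(2)])
  qed
  have sum_j: "(\<Sum>s\<in>{j..<j + l}. insert_point ?i m c \<alpha> s) = (\<Sum>s\<in>{j..<j + l}. \<alpha> s)"
  proof -
    have "(\<Sum>s\<in>{1..l}. block j (insert_point ?i m c \<alpha>) s) = (\<Sum>s\<in>{1..l}. block j \<alpha> s)"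
      unfolding insert_point_def by (intro sum.cong refl block_graft_after[OF j]) simp_all
    then show ?thesis
      by (simp only: sum_block[OF j(1)])
  qed
  have point: "insert_point i m c (insert_point j l c' \<alpha>) t = insert_point j l c' (insert_point ?i m c \<alpha>) t"
    if "1 \<le> t" for t
    using graft_graft_disjoint[OF j that] sum_i sum_j unfolding insert_point_def by simp
  show ?thesis
    unfolding insert_eval_def x_def[symmetric] y_def[symmetric] x' y'
    by (rule chom_cong[OF f]; (rule point | rule graft_graft_disjoint[OF j]); simp)
qed

text \<open>
  The values agree by \<open>insert_eval_commute\<close>. In the signs, \<open>g\<close> passes the value of \<open>h\<close> in one order
  of insertion and only the arguments of \<open>h\<close> in the other, a discrepancy of \<open>e e'\<close>.
\<close>

lemma chom_prod_assoc_disjoint: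
  assumes f: "f \<in> chom_carr A UNIV n" and g: "g \<in> chom_part A UNIV m e" and h: "h \<in> chom_part A UNIV l e'"
    and ij: "1 \<le> j" "j < i" "i \<le> n"
  shows "chom_prod A (m + n - 1) l j (chom_prod A n m i f g a) h b =
    (\<lambda>v. Poly_Mapping.map (smult A (parity_sign (e * e')))
      (chom_prod A (l + n - 1) m (l + i - 1) (chom_prod A n l j f h b) g a v))"
proof (rule chom_double_family_eqI[where
        u = "\<lambda>a b. chom_prod A (m + n - 1) l j (chom_prod A n m i f g a) h b" and
        u' = "\<lambda>a b v. Poly_Mapping.map (smult A (parity_sign (e * e')))
          (chom_prod A (l + n - 1) m (l + i - 1) (chom_prod A n l j f h b) g a v)"])
  let ?N = "l + (m + n - 1) - 1" and ?i = "l + i - 1"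
  note g' = chom_part_carr[OF g] and h' = chom_part_carr[OF h]
  have i: "1 \<le> i" "i \<le> n" and j: "1 \<le> j" "j \<le> n" and j': "1 \<le> j" "j \<le> m + n - 1"
    and i': "1 \<le> ?i" "?i \<le> l + n - 1" and N: "m + (l + n - 1) - 1 = ?N"
    using ij by auto
  show "chom_prod A (m + n - 1) l j (chom_prod A n m i f g a) h b \<in> chom_carr A UNIV ?N" for a b
    by (intro chom_prod_carr f g' h' i j')
  show "(\<lambda>v. Poly_Mapping.map (smult A (parity_sign (e * e')))
      (chom_prod A (l + n - 1) m ?i (chom_prod A n l j f h b) g a v)) \<in> chom_carr A UNIV ?N" for a b
    unfolding N[symmetric] by (intro chom_carr_smult chom_prod_carr f g' h' i' j)
  fix d v \<alpha> assume v: "homog UNIV ?N d v"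
  let ?sh = "\<Sum>s\<in>{j..<j + l}. d s" and ?sg = "\<Sum>s\<in>{?i..<?i + m}. d s"
  let ?ins = "\<lambda>c c'. insert_eval i m f g c (insert_point j l c' \<alpha>) (graft j l (eval (block j \<alpha>) (h (block j v))) v)"
  let ?sign = "parity_sign (e' * (\<Sum>s\<in>{1..<j}. d s)) *
      parity_sign (e * (\<Sum>s\<in>{1..<i}. graft j l (e' + ?sh) d s)) :: 'k"
  show "double_coeffs (\<lambda>a b. eval \<alpha> (chom_prod A (m + n - 1) l j (chom_prod A n m i f g a) h b v))
      (\<lambda>c c'. (parity_sign (e' * (\<Sum>s\<in>{1..<j}. d s)) *
      parity_sign (e * (\<Sum>s\<in>{1..<i}. graft j l (e' + ?sh) d s))) *s ?ins c c')"
    by (rule double_prod_coeffs[OF f g h i j' v])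
  have sum_i: "(\<Sum>s\<in>{1..<i}. graft j l (e' + ?sh) d s) = e' + (\<Sum>s\<in>{1..<?i}. d s)"
  proof -
    have cancel: "x = y + z" if "x + s = (y + s) + z" for x y z s :: bit
      using that by (simp add: ac_simps)
    have *: "j \<le> i - 1" "{1..i - 1} = {1..<i}" "{1..l + (i - 1) - 1} = {1..<?i}"
      using ij by auto
    show ?thesis
      using sum_graft[OF ij(1) *(1), of l "e' + ?sh" d] unfolding *(2,3) by (rule cancel)
  qed
  have sum_j: "(\<Sum>s\<in>{1..<j}. graft ?i m (e + ?sg) d s) = (\<Sum>s\<in>{1..<j}. d s)"
    by (rule sum.cong) (use ij in \<open>auto simp: graft_def\<close>)
  have sign: "?sign = parity_sign (e * e') * (parity_sign (e * (\<Sum>s\<in>{1..<?i}. d s)) *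
      parity_sign (e' * (\<Sum>s\<in>{1..<j}. graft ?i m (e + ?sg) d s)))"
    unfolding sum_i sum_j by (simp add: distrib_left parity_sign_add mult_ac)
  have "double_coeffs (\<lambda>b a. eval \<alpha> (chom_prod A (l + n - 1) m ?i (chom_prod A n l j f h b) g a v))
      (\<lambda>c' c. (parity_sign (e * (\<Sum>s\<in>{1..<?i}. d s)) *
        parity_sign (e' * (\<Sum>s\<in>{1..<j}. graft ?i m (e + ?sg) d s))) *s ?ins c c')"
    unfolding insert_eval_commute[OF f g' h' ij(1,2)]
    by (rule double_prod_coeffs[OF f h g j i']) (use v N in simp)
  from double_coeffs_scale[OF double_coeffs_swap[OF this], of "parity_sign (e * e')"]
  show "double_coeffs (\<lambda>a b. eval \<alpha> (Poly_Mapping.map (smult A (parity_sign (e * e')))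
        (chom_prod A (l + n - 1) m ?i (chom_prod A n l j f h b) g a v)))
      (\<lambda>c c'. (parity_sign (e' * (\<Sum>s\<in>{1..<j}. d s)) *
        parity_sign (e * (\<Sum>s\<in>{1..<i}. graft j l (e' + ?sh) d s))) *s ?ins c c')"
    unfolding sign by simp
qed

lemma block_block:
  assumes "1 \<le> i" "i \<le> j" "1 \<le> t"
  shows "block (j - i + 1) (block i w) t = block j w t"
proof -
  have "t + (j - i + 1) - 1 + i - 1 = t + j - 1" using assms by simp
  then show ?thesis by (simp only: block_def)
qed

lemma block_graft_inside:
  assumes "1 \<le> i" "i \<le> j" "1 \<le> t"
  shows "block i (graft j l x w) t = graft (j - i + 1) l x (block i w) t"
proof -
  have "t + i - 1 < j \<longleftrightarrow> t < j - i + 1" "t + i - 1 = j \<longleftrightarrow> t = j - i + 1"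
    "t + i - 1 + l - 1 = t + l - 1 + i - 1"
    using assms by auto
  then show ?thesis by (simp only: graft_def block_def)
qed

lemma graft_graft_inside:
  assumes "1 \<le> i" "i \<le> j" "j < i + m"
  shows "graft i m y (graft j l x w) t = graft i (l + m - 1) y w t"
proof (cases "i < t")
  case True
  then have "\<not> t + m - 1 < j" "t + m - 1 \<noteq> j" "t + m - 1 + l - 1 = t + (l + m - 1) - 1"
    using assms by auto
  with True show ?thesis by (simp add: graft_def del: One_nat_def)
qed (use assms in \<open>auto simp: graft_def\<close>)

text \<open>
  The block of \<open>g\<close> contains the variable shifted by \<open>c'\<close>, so that \<open>c'\<close> is added to \<open>c\<close> in the coordinate
  of \<open>f\<close>; this is the parameter \<open>\<lambda> + \<mu>\<close> of the nested law.
\<close>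

lemma insert_eval_nested:
  assumes f: "f \<in> chom_carr A UNIV n" and g: "g \<in> chom_carr A UNIV m" and h: "h \<in> chom_carr A UNIV l"
    and ij: "1 \<le> i" "i \<le> j" "j < i + m"
  shows "insert_eval i m f g c (insert_point j l c' \<alpha>) (graft j l (eval (block j \<alpha>) (h (block j v))) v) =
    eval (insert_point i (l + m - 1) (c + c') \<alpha>)
      (f (graft i (l + m - 1) (insert_eval (j - i + 1) l g h c' (block i \<alpha>) (block i v)) v))"
proof -
  let ?j = "j - i + 1"
  define x where "x = eval (block j \<alpha>) (h (block j v))"
  have j: "1 \<le> j" "1 \<le> ?j" "?j \<le> m" using ij by auto
  have x': "eval (block ?j (block i \<alpha>)) (h (block ?j (block i v))) = x"
    unfolding x_def by (rule chom_cong[OF h]; rule block_block[OF ij(1,2)]; simp)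
  have block_sum: "(\<Sum>s\<in>{?j..<?j + l}. block i \<alpha> s) = (\<Sum>s\<in>{j..<j + l}. \<alpha> s)"
  proof -
    have "(\<Sum>s\<in>{1..l}. block ?j (block i \<alpha>) s) = (\<Sum>s\<in>{1..l}. block j \<alpha> s)"
      by (intro sum.cong refl block_block[OF ij(1,2)]) simp
    then show ?thesis by (simp only: sum_block[OF j(1)] sum_block[OF j(2)])
  qed
  have point: "block i (insert_point j l c' \<alpha>) t = insert_point ?j l c' (block i \<alpha>) t" if "1 \<le> t" for t
    unfolding insert_point_def block_sum by (rule block_graft_inside[OF ij(1,2) that])
  have "eval (block i (insert_point j l c' \<alpha>)) (g (block i (graft j l x v))) =
      insert_eval ?j l g h c' (block i \<alpha>) (block i v)"
    unfolding insert_eval_def x'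
    by (rule chom_cong[OF g]; (rule point | rule block_graft_inside[OF ij(1,2)]); simp)
  moreover have "insert_point i m c (insert_point j l c' \<alpha>) t = insert_point i (l + m - 1) (c + c') \<alpha> t" for t
  proof -
    have "(\<Sum>s\<in>{i..<i + m}. insert_point j l c' \<alpha> s) = (\<Sum>s\<in>{1..m}. insert_point ?j l c' (block i \<alpha>) s)"
      unfolding sum_block[OF ij(1), symmetric] by (intro sum.cong refl point) simp
    also have "\<dots> = c' + (\<Sum>s\<in>{1..l + m - 1}. block i \<alpha> s)"
      by (rule sum_insert_point[OF j(2,3)])
    also have "\<dots> = c' + (\<Sum>s\<in>{i..<i + (l + m - 1)}. \<alpha> s)"
      by (simp only: sum_block[OF ij(1)])
    finally show ?thesis
      using graft_graft_inside[OF ij] by (simp add: insert_point_def[of i] insert_point_def[of j] add.assoc)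
  qed
  ultimately show ?thesis
    unfolding insert_eval_def[of i m f] x_def[symmetric]
    by (intro chom_cong[OF f]) (simp_all only: graft_graft_inside[OF ij])
qed

lemma chom_prod_assoc_nested_homog:
  assumes f: "f \<in> chom_carr A UNIV n" and g: "g \<in> chom_part A UNIV m e" and h: "h \<in> chom_part A UNIV l e'"
    and i: "1 \<le> i" "i \<le> n" and ij: "i \<le> j" "j < i + m"
  shows "chom_prod A (m + n - 1) l j (chom_prod A n m i f g a) h b =
    (\<Sum>s\<le>b. (\<lambda>v. Poly_Mapping.map (smult A (of_nat ((a + b - s) choose a)))
      (chom_prod A n (l + m - 1) i f (chom_prod A m l (j - i + 1) g h s) (a + b - s) v)))"
proof (rule chom_double_family_eqI[where
        u = "\<lambda>a b. chom_prod A (m + n - 1) l j (chom_prod A n m i f g a) h b" and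
        u' = "\<lambda>a b. \<Sum>s\<le>b. (\<lambda>v. Poly_Mapping.map (smult A (of_nat ((a + b - s) choose a)))
          (chom_prod A n (l + m - 1) i f (chom_prod A m l (j - i + 1) g h s) (a + b - s) v))"])
  let ?N = "l + (m + n - 1) - 1" and ?j = "j - i + 1" and ?M = "l + m - 1"
  note g' = chom_part_carr[OF g] and h' = chom_part_carr[OF h]
  have j: "1 \<le> j" "j \<le> m + n - 1" and j': "1 \<le> ?j" "?j \<le> m" and N: "?M + n - 1 = ?N" and i': "i \<in> {1..n}"
    using i ij by auto
  let ?gh = "\<lambda>s. chom_prod A m l ?j g h s"
  have gh: "?gh s \<in> chom_part A UNIV ?M (e + e')" for s
    by (rule chom_prod_part[OF g h j'])
  show "chom_prod A (m + n - 1) l j (chom_prod A n m i f g a) h b \<in> chom_carr A UNIV ?N" for a b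
    by (intro chom_prod_carr f g' h' i j)
  show "(\<Sum>s\<le>b. (\<lambda>v. Poly_Mapping.map (smult A (of_nat ((a + b - s) choose a)))
      (chom_prod A n ?M i f (?gh s) (a + b - s) v))) \<in> chom_carr A UNIV ?N" for a b
    unfolding N[symmetric]
    by (intro chom_carr_sum chom_carr_smult chom_prod_carr f chom_part_carr[OF gh] i)
  fix d v \<alpha> assume v: "homog UNIV ?N d v"
  let ?sh = "\<Sum>s\<in>{j..<j + l}. d s"
  let ?K = "\<lambda>c c'. eval (insert_point i ?M c \<alpha>)
      (f (graft i ?M (insert_eval ?j l g h c' (block i \<alpha>) (block i v)) v))"
  let ?sign = "parity_sign (e' * (\<Sum>s\<in>{1..<j}. d s)) *
      parity_sign (e * (\<Sum>s\<in>{1..<i}. graft j l (e' + ?sh) d s)) :: 'k"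
  show "double_coeffs (\<lambda>a b. eval \<alpha> (chom_prod A (m + n - 1) l j (chom_prod A n m i f g a) h b v))
      (\<lambda>c c'. (parity_sign (e' * (\<Sum>s\<in>{1..<j}. d s)) *
        parity_sign (e * (\<Sum>s\<in>{1..<i}. graft j l (e' + ?sh) d s))) *s ?K (c + c') c')"
    using double_prod_coeffs[OF f g h i j v, of \<alpha>]
    unfolding insert_eval_nested[OF f g' h' i(1) ij] .
  have sign: "?sign = parity_sign ((e + e') * (\<Sum>s\<in>{1..<i}. d s)) * parity_sign (e' * (\<Sum>s\<in>{1..<?j}. block i d s))"
  proof -
    have "(\<Sum>s\<in>{1..<i}. graft j l (e' + ?sh) d s) = (\<Sum>s\<in>{1..<i}. d s)"
      by (rule sum.cong) (use ij in \<open>auto simp: graft_def\<close>)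
    moreover have "(\<Sum>s\<in>{1..<j}. d s) = (\<Sum>s\<in>{1..<i}. d s) + (\<Sum>s\<in>{i..<j}. d s)"
      using sum.atLeastLessThan_concat[of 1 i j d] i ij by simp
    moreover have "(\<Sum>s\<in>{i..<j}. d s) = (\<Sum>s\<in>{1..<?j}. block i d s)"
      using sum_block[OF i(1), where m = "j - i" and w = d] ij by (simp add: atLeastLessThanSuc_atLeastAtMost)
    ultimately show ?thesis
      by (simp add: distrib_left distrib_right parity_sign_add mult_ac)
  qed
  have v': "homog UNIV (?M + n - 1) d v"
    using v N by simp
  have bv: "homog UNIV ?M (block i d) (block i v)"
    by (rule homog_block[OF v' i])
  let ?s1 = "parity_sign ((e + e') * (\<Sum>s\<in>{1..<i}. d s)) :: 'k" and ?s2 = "parity_sign (e' * (\<Sum>s\<in>{1..<?j}. block i d s)) :: 'k"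
  have "double_coeffs (\<lambda>s r. eval \<alpha> (chom_prod A n ?M i f (?gh s) r v)) (\<lambda>c' c. (?s1 * ?s2) *s ?K c c')"
  proof (rule double_coeffsI)
    show "power_coeffs (\<lambda>r (_::unit). eval \<alpha> (chom_prod A n ?M i f (?gh s) r v))
        (\<lambda>c _. ?s1 *s eval (insert_point i ?M c \<alpha>) (f (graft i ?M (eval (block i \<alpha>) (?gh s (block i v))) v)))" for s
      using power_coeffs_reparam[OF prod_coeffs_homog[OF f gh i v'], of "\<lambda>_. \<alpha>" s]
      by (simp add: insert_eval_def)
    show "power_coeffs (\<lambda>s c. ?s1 *s eval (insert_point i ?M c \<alpha>) (f (graft i ?M (eval (block i \<alpha>) (?gh s (block i v))) v)))
        (\<lambda>c' c. (?s1 * ?s2) *s ?K c c')"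
      using power_coeffs_linear[OF power_coeffs_reparam[OF prod_coeffs_homog[OF g' h j' bv], of "\<lambda>_. block i \<alpha>"],
          where h = "\<lambda>c x. ?s1 *s eval (insert_point i ?M c \<alpha>) (f (graft i ?M x v))"]
      by (simp add: chom_graft_add[OF f i'] chom_graft_scale[OF f i'] scale_right_distrib mult_ac)
  qed
  from double_coeffs_add_vars[OF double_coeffs_swap[OF this]]
  show "double_coeffs (\<lambda>a b. eval \<alpha> ((\<Sum>s\<le>b. (\<lambda>v. Poly_Mapping.map (smult A (of_nat ((a + b - s) choose a)))
        (chom_prod A n ?M i f (?gh s) (a + b - s) v))) v))
      (\<lambda>c c'. (parity_sign (e' * (\<Sum>s\<in>{1..<j}. d s)) *
        parity_sign (e * (\<Sum>s\<in>{1..<i}. graft j l (e' + ?sh) d s))) *s ?K (c + c') c')"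
    unfolding sign by (simp add: sum_fun_apply)
qed

lemma chom_prod_assoc_nested:
  assumes f: "f \<in> chom_carr A UNIV n" and g: "g \<in> chom_carr A UNIV m" and h: "h \<in> chom_carr A UNIV l"
    and i: "1 \<le> i" "i \<le> n" and ij: "i \<le> j" "j < i + m"
  shows "chom_prod A (m + n - 1) l j (chom_prod A n m i f g a) h b =
    (\<Sum>s\<le>b. (\<lambda>v. Poly_Mapping.map (smult A (of_nat ((a + b - s) choose a)))
      (chom_prod A n (l + m - 1) i f (chom_prod A m l (j - i + 1) g h s) (a + b - s) v)))"
proof -
  have j: "1 \<le> j" "j \<le> m + n - 1" and j': "1 \<le> j - i + 1" "j - i + 1 \<le> m"
    using i ij by auto
  have map_add: "(\<lambda>v. Poly_Mapping.map (smult A c) ((p + q) v)) =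
      (\<lambda>v. Poly_Mapping.map (smult A c) (p v)) + (\<lambda>v. Poly_Mapping.map (smult A c) (q v))" for c and p q :: "(nat \<Rightarrow> 'v) \<Rightarrow> 'v mpol"
    by (intro ext mpol_eqI) (simp add: scale_right_distrib)
  show ?thesis
    using g
  proof (induction rule: chom_induct_homog)
    case (homog e g)
    note g = homog
    from h show ?case
    proof (induction rule: chom_induct_homog)
      case (homog e' h)
      show ?case by (rule chom_prod_assoc_nested_homog[OF f g homog i ij])
    next
      case (add h h')
      note g' = chom_part_carr[OF g]
      show ?case
        by (simp only: chom_prod_add_right[OF chom_prod_carr[OF f g' i] add(1,2) j] add(3,4)
            chom_prod_add_right[OF g' add(1,2) j']
            chom_prod_add_right[OF f chom_prod_carr[OF g' add(1) j'] chom_prod_carr[OF g' add(2) j'] i]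
            map_add sum.distrib)
    qed
  next
    case (add g g')
    show ?case
      by (simp only: chom_prod_add_right[OF f add(1,2) i] add(3,4)
          chom_prod_add_left[OF chom_prod_carr[OF f add(1) i] chom_prod_carr[OF f add(2) i] h j]
          chom_prod_add_left[OF add(1,2) h j']
          chom_prod_add_right[OF f chom_prod_carr[OF add(1) h j'] chom_prod_carr[OF add(2) h j'] i]
          map_add sum.distrib)
  qed
qed

section \<open>Equivariance\<close>

lemma chom_act_part:
  assumes "g \<in> chom_part A UNIV m e" "\<tau> permutes {1..m}"
  shows "chom_act A UNIV m g \<tau> \<in> chom_part A UNIV m e"
  using dS_superspace_chom[OF graded_submodule_UNIV, of m] assms
  by (simp add: dS_superspace_def even_linear_def)

text \<open>
  The value of \<open>f\<^sup>\<sigma> \<circ>\<^sup>i g\<^sup>\<tau>\<close> at \<open>(a, v)\<close> is that of \<open>f \<circ>\<^sup>\<sigma>\<^sup>i g\<close> at the point and the arguments permuted by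
  \<open>\<sigma> \<circ>\<^sub>i \<tau>\<close>, up to the signs of \<open>\<sigma>\<close> and \<open>\<tau>\<close>.
\<close>

lemma insert_eval_act:
  assumes f: "f \<in> chom_carr A UNIV n" and g: "g \<in> chom_part A UNIV m e" and i: "1 \<le> i" "i \<le> n"
    and \<sigma>: "\<sigma> permutes {1..n}" and \<tau>: "\<tau> permutes {1..m}" and v: "homog UNIV (m + n - 1) d v"
  defines "\<rho> \<equiv> perm_comp m i \<sigma> \<tau>"
  shows "insert_eval i m (chom_act A UNIV n f \<sigma>) (chom_act A UNIV m g \<tau>) c a v =
    (koszul_sign n (graft i m (e + (\<Sum>j\<in>{i..<i + m}. d j)) d) \<sigma> * koszul_sign m (block i d) \<tau>) *s
      insert_eval (\<sigma> i) m f g c (\<lambda>j. a (inv \<rho> j)) (\<lambda>j. v (inv \<rho> j))"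
proof -
  note g' = chom_part_carr[OF g]
  have i': "i \<in> {1..n}" using i by simp
  have \<sigma>i: "1 \<le> \<sigma> i" "\<sigma> i \<le> n"
    using permutes_interval_bounds[OF \<sigma>] i by simp_all
  let ?\<kappa> = "koszul_sign m (block i d) \<tau> :: 'k"
  define y where "y = eval (\<lambda>j. block i a (inv \<tau> j)) (g (\<lambda>j. block i v (inv \<tau> j)))"
  have bv: "homog UNIV m (block i d) (block i v)"
    by (rule homog_block[OF v i])
  have inner: "eval (block i a) (chom_act A UNIV m g \<tau> (block i v)) = ?\<kappa> *s y"
    unfolding y_def by (rule eval_chom_act_homog[OF g' \<tau> bv])
  have "?\<kappa> *s y \<in> part A (e + (\<Sum>j\<in>{i..<i + m}. d j))"
    using eval_block_part[OF chom_act_part[OF g \<tau>] i v] unfolding inner[symmetric] .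
  from homog_graft[OF v i this]
  have gv: "homog UNIV n (graft i m (e + (\<Sum>j\<in>{i..<i + m}. d j)) d) (graft i m (?\<kappa> *s y) v)" .
  have y: "eval (block (\<sigma> i) (\<lambda>j. a (inv \<rho> j))) (g (block (\<sigma> i) (\<lambda>j. v (inv \<rho> j)))) = y"
    unfolding y_def \<rho>_def
    by (rule chom_cong[OF g']) (rule block_perm_comp[OF \<sigma> \<tau> i]; assumption)+
  have sum: "(\<Sum>s\<in>{\<sigma> i..<\<sigma> i + m}. a (inv \<rho> s)) = (\<Sum>s\<in>{i..<i + m}. a s)"
  proof -
    have "(\<Sum>s\<in>{1..m}. block (\<sigma> i) (\<lambda>j. a (inv \<rho> j)) s) = (\<Sum>s\<in>{1..m}. block i a (inv \<tau> s))"
      unfolding \<rho>_def by (rule sum.cong) (auto intro!: block_perm_comp[OF \<sigma> \<tau> i])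
    also have "\<dots> = (\<Sum>s\<in>{1..m}. block i a s)"
      by (rule sum_inv_permutes[OF \<tau>])
    finally show ?thesis
      by (simp only: sum_block[OF i(1)] sum_block[OF \<sigma>i(1)])
  qed
  have point: "insert_point i m c a (inv \<sigma> j) = insert_point (\<sigma> i) m c (\<lambda>j. a (inv \<rho> j)) j" if "j \<in> {1..n}" for j
    unfolding insert_point_def sum unfolding \<rho>_def by (rule graft_perm_comp[OF \<sigma> \<tau> i that, symmetric])
  have arg: "graft i m x v (inv \<sigma> j) = graft (\<sigma> i) m x (\<lambda>j. v (inv \<rho> j)) j" if "j \<in> {1..n}" for j x
    unfolding \<rho>_def by (rule graft_perm_comp[OF \<sigma> \<tau> i that, symmetric])
  have "insert_eval i m (chom_act A UNIV n f \<sigma>) (chom_act A UNIV m g \<tau>) c a v =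
      koszul_sign n (graft i m (e + (\<Sum>j\<in>{i..<i + m}. d j)) d) \<sigma> *s
        eval (\<lambda>j. insert_point i m c a (inv \<sigma> j)) (f (\<lambda>j. graft i m (?\<kappa> *s y) v (inv \<sigma> j)))"
    unfolding insert_eval_def inner by (rule eval_chom_act_homog[OF f \<sigma> gv])
  also have "eval (\<lambda>j. insert_point i m c a (inv \<sigma> j)) (f (\<lambda>j. graft i m (?\<kappa> *s y) v (inv \<sigma> j))) =
      eval (insert_point (\<sigma> i) m c (\<lambda>j. a (inv \<rho> j))) (f (graft (\<sigma> i) m (?\<kappa> *s y) (\<lambda>j. v (inv \<rho> j))))"
    by (rule chom_cong[OF f]) (simp_all only: point arg)
  also have "\<dots> = ?\<kappa> *s insert_eval (\<sigma> i) m f g c (\<lambda>j. a (inv \<rho> j)) (\<lambda>j. v (inv \<rho> j))"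
    unfolding insert_eval_def y by (rule chom_graft_scale[OF f]) (use \<sigma>i in simp)
  finally show ?thesis by simp
qed

lemma chom_prod_act:
  assumes f: "f \<in> chom_carr A UNIV n" and g: "g \<in> chom_carr A UNIV m" and i: "1 \<le> i" "i \<le> n"
    and \<sigma>: "\<sigma> permutes {1..n}" and \<tau>: "\<tau> permutes {1..m}"
  shows "chom_prod A n m i (chom_act A UNIV n f \<sigma>) (chom_act A UNIV m g \<tau>) k =
    chom_act A UNIV (m + n - 1) (chom_prod A n m (\<sigma> i) f g k) (perm_comp m i \<sigma> \<tau>)"
  using g
proof (induction rule: chom_induct_homog)
  case (homog e g)
  let ?N = "m + n - 1" and ?\<rho> = "perm_comp m i \<sigma> \<tau>"
  note g = homog and g' = chom_part_carr[OF homog]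
  note f\<sigma> = chom_carr_act[OF graded_submodule_UNIV f \<sigma>] and \<rho> = perm_comp_permutes[OF \<sigma> \<tau> i]
  have \<sigma>i: "1 \<le> \<sigma> i" "\<sigma> i \<le> n"
    using permutes_interval_bounds[OF \<sigma>] i by simp_all
  note prod = chom_prod_carr[OF f g' \<sigma>i]
  show ?case
  proof (rule chom_family_eqI[where u = "chom_prod A n m i (chom_act A UNIV n f \<sigma>) (chom_act A UNIV m g \<tau>)"])
    show "chom_prod A n m i (chom_act A UNIV n f \<sigma>) (chom_act A UNIV m g \<tau>) k \<in> chom_carr A UNIV ?N" for k
      by (intro chom_prod_carr f\<sigma> chom_carr_act[OF graded_submodule_UNIV g' \<tau>] i)
    show "chom_act A UNIV ?N (chom_prod A n m (\<sigma> i) f g k) ?\<rho> \<in> chom_carr A UNIV ?N" for k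
      by (rule chom_carr_act[OF graded_submodule_UNIV prod \<rho>])
    fix d v assume v: "homog UNIV ?N d v"
    let ?ins = "\<lambda>c a. insert_eval (\<sigma> i) m f g c (\<lambda>j. a (inv ?\<rho> j)) (\<lambda>j. v (inv ?\<rho> j))"
    let ?s1 = "parity_sign (e * (\<Sum>j\<in>{1..<i}. d j)) :: 'k"
    let ?s2 = "koszul_sign n (graft i m (e + (\<Sum>j\<in>{i..<i + m}. d j)) d) \<sigma> * koszul_sign m (block i d) \<tau> :: 'k"
    let ?s3 = "koszul_sign ?N d ?\<rho> :: 'k" and ?s4 = "parity_sign (e * (\<Sum>j\<in>{1..<\<sigma> i}. d (inv ?\<rho> j))) :: 'k"
    have sign: "?s1 * ?s2 = ?s3 * ?s4"
      using arg_cong[OF inversion_sum_perm_comp[OF \<sigma> \<tau> i, of e d], of "parity_sign :: bit \<Rightarrow> 'k"]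
      by (simp only: koszul_sign_inversion_sum parity_sign_add mult.assoc)
    show "power_coeffs (\<lambda>k a. eval a (chom_prod A n m i (chom_act A UNIV n f \<sigma>) (chom_act A UNIV m g \<tau>) k v))
        (\<lambda>c a. (?s3 * ?s4) *s ?ins c a)"
      using prod_coeffs_homog[OF f\<sigma> chom_act_part[OF g \<tau>] i v]
      by (simp only: insert_eval_act[OF f g i \<sigma> \<tau> v] scale_scale sign)
    have "power_coeffs (\<lambda>k a. eval (\<lambda>j. a (inv ?\<rho> j)) (chom_prod A n m (\<sigma> i) f g k (\<lambda>j. v (inv ?\<rho> j))))
        (\<lambda>c a. ?s4 *s ?ins c a)"
      using power_coeffs_reparam[OF prod_coeffs_homog[OF f g \<sigma>i homog_permute[OF v \<rho>]], of "\<lambda>a j. a (inv ?\<rho> j)"]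
      by simp
    from power_coeffs_scale[OF this, of ?s3]
    show "power_coeffs (\<lambda>k a. eval a (chom_act A UNIV ?N (chom_prod A n m (\<sigma> i) f g k) ?\<rho> v))
        (\<lambda>c a. (?s3 * ?s4) *s ?ins c a)"
      by (simp only: eval_chom_act_homog[OF prod \<rho> v] scale_scale)
  qed
next
  case (add g g')
  have \<sigma>i: "1 \<le> \<sigma> i" "\<sigma> i \<le> n"
    using permutes_interval_bounds[OF \<sigma>] i by simp_all
  have act_add: "chom_act A UNIV N (p + q) \<rho> = chom_act A UNIV N p \<rho> + chom_act A UNIV N q \<rho>" for N p q \<rho>
    by (intro ext mpol_eqI) (simp add: eval_chom_act scale_right_distrib sum.distrib)
  show ?case
    by (simp only: act_add chom_prod_add_right[OF f add(1,2) \<sigma>i] add(3,4)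
        chom_prod_add_right[OF chom_carr_act[OF graded_submodule_UNIV f \<sigma>]
          chom_carr_act[OF graded_submodule_UNIV add(1) \<tau>] chom_carr_act[OF graded_submodule_UNIV add(2) \<tau>] i])
qed

section \<open>Polynomiality on submodules of finite rank\<close>

text \<open>The arguments for which a sesquilinear map vanishes in a given place form a submodule.\<close>

lemma sesqui_vanish:
  assumes \<Phi>: "sesqui UNIV n a \<Phi>"
    and S: "\<And>v. (\<And>j. j \<in> {1..n} \<Longrightarrow> v j \<in> S) \<Longrightarrow> \<Phi> v = 0"
    and v: "args_in (span {(der A ^^ k) s | k s. s \<in> S}) n v"
  shows "\<Phi> v = 0"
proof -
  let ?U = "span {(der A ^^ k) s | k s. s \<in> S}"
  have "\<Phi> v = 0" if "finite K" "K \<subseteq> {1..n}" "\<And>j. j \<in> K \<Longrightarrow> v j \<in> ?U"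
    "\<And>j. j \<in> {1..n} - K \<Longrightarrow> v j \<in> S" for K v
    using that
  proof (induction K arbitrary: v rule: finite_induct)
    case empty
    then show ?case by (intro S) auto
  next
    case (insert i K)
    have i: "i \<in> {1..n}" using insert.prems by simp
    define Z where "Z = {x. \<Phi> (v(i := x)) = 0}"
    have "subspace Z"
      unfolding subspace_def
    proof (intro conjI ballI allI)
      show "0 \<in> Z"
        using sesqui_zero_arg[OF \<Phi> i, of "v(i := 0)"] by (simp add: Z_def)
      show "x + y \<in> Z" if "x \<in> Z" "y \<in> Z" for x y
        using that sesqui_add_arg[OF \<Phi> args_in_UNIV i UNIV_I UNIV_I, of v x y] by (simp add: Z_def)
      show "c *s x \<in> Z" if "x \<in> Z" for c x
        using that sesqui_scale_arg[OF \<Phi> args_in_UNIV i UNIV_I, of v c x] by (simp add: Z_def)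
    qed
    moreover have "(der A ^^ k) s \<in> Z" if s: "s \<in> S" for k s
    proof (induction k)
      case 0
      have "\<Phi> (v(i := s)) = 0"
        using insert.prems insert.hyps s by (intro insert.IH) auto
      then show ?case by (simp add: Z_def)
    next
      case (Suc k)
      then show ?case
        using sesqui_der_arg[OF \<Phi> args_in_UNIV i, of "v(i := (der A ^^ k) s)"] by (simp add: Z_def)
    qed
    ultimately have "?U \<subseteq> Z"
      by (intro span_minimal) auto
    moreover have "v i \<in> ?U" using insert.prems(2) by simp
    ultimately have "\<Phi> (v(i := v i)) = 0" unfolding Z_def by blast
    then show ?case by simp
  qed
  from this[of "{1..n}" v] v show ?thesis
    by (auto simp: args_in_def)
qed

text \<open>
  Each coefficient of the product is sesquilinear, so it vanishes on \<open>U\<close> as soon as it vanishes on the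
  finitely many tuples of generators; beyond the largest degree that occurs on such tuples all
  coefficients do.
\<close>

lemma finite_restrict_prod:
  assumes f: "f \<in> chom_carr A UNIV n" and g: "g \<in> chom_carr A UNIV m" and i: "1 \<le> i" "i \<le> n"
    and S: "finite S" and U: "U = span {(der A ^^ k) s | k s. s \<in> S}"
  shows "finite {k. restrict_to U (m + n - 1) (chom_prod A n m i f g k) \<noteq> 0}"
proof -
  let ?N = "m + n - 1"
  have "\<exists>M. \<forall>k>M. \<forall>a. eval a (chom_prod A n m i f g k v) = 0" for v
    using prod_coeffs[OF f g i, of v] unfolding power_coeffs_def by blast
  then obtain M where M: "\<And>v k a. k > M v \<Longrightarrow> eval a (chom_prod A n m i f g k v) = 0"
    by metis
  define B where "B = Max (insert 0 (M ` ({1..?N} \<rightarrow>\<^sub>E S)))"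
  have B: "M v \<le> B" if "v \<in> {1..?N} \<rightarrow>\<^sub>E S" for v
    unfolding B_def using that S by (intro Max_ge) (auto intro!: finite_PiE)
  have "restrict_to U ?N (chom_prod A n m i f g k) = 0" if k: "k > B" for k
  proof (intro ext mpol_eqI)
    fix v a
    note prod = chom_sesqui[OF chom_prod_carr[OF f g i, of k]]
    have "eval a (chom_prod A n m i f g k v) = 0" if v: "args_in U ?N v"
    proof (rule sesqui_vanish[OF prod _ v[unfolded U]])
      fix w :: "nat \<Rightarrow> 'v" assume w: "\<And>j. j \<in> {1..?N} \<Longrightarrow> w j \<in> S"
      have "eval a (chom_prod A n m i f g k (restrict w {1..?N})) = 0"
        using w k B[of "restrict w {1..?N}"] by (intro M) (auto simp: restrict_PiE_iff)
      moreover have "eval a (chom_prod A n m i f g k w) = eval a (chom_prod A n m i f g k (restrict w {1..?N}))"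
        by (rule sesqui_cong[OF prod]) simp
      ultimately show "eval a (chom_prod A n m i f g k w) = 0" by simp
    qed
    then show "eval a (restrict_to U ?N (chom_prod A n m i f g k) v) = eval a (0 v)"
      by (simp add: eval_restrict_to)
  qed
  then have "{k. restrict_to U ?N (chom_prod A n m i f g k) \<noteq> 0} \<subseteq> {..B}"
    by (auto simp: not_less[symmetric])
  then show ?thesis
    by (rule finite_subset) simp
qed

end

section \<open>The pseudo operad of a filtered superspace\<close>

lemma d_superspace_parity_reversal:
  assumes "d_superspace V"
  shows "d_superspace (parity_reversal V)"
proof -
  have V: "superspace V" and der: "even_linear V V (der V)"
    using assms by (simp_all add: d_superspace_def)
  have "{x + y |x y. x \<in> part V 0 \<and> y \<in> part V 1} = {x + y |x y. x \<in> part V 1 \<and> y \<in> part V 0}"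
    by (auto simp: add.commute) (metis add.commute)+
  then show ?thesis
    using V der
    by (auto simp: d_superspace_def superspace_def parity_reversal_def even_linear_def linear_between_def)
qed

lemma exhaustive_filtration_parity_reversal:
  fixes V :: "('k::field_char_0, 'v::ab_group_add) d_space"
  assumes V: "d_superspace V" and carr: "carr V = UNIV" and F: "finite_rank_filtration V F"
  shows "exhaustive_filtration (parity_reversal V) F"
proof -
  let ?A = "parity_reversal V"
  have A: "d_superspace ?A"
    by (rule d_superspace_parity_reversal[OF V])
  then have sA: "superspace ?A"
    by (simp add: d_superspace_def)
  interpret even_superspace ?A
    using A carr by unfold_locales (simp_all add: parity_reversal_def)
  have sel: "smult ?A = smult V" "der ?A = der V" "part ?A a = part V (1 - a)" for a
    by (simp_all add: parity_reversal_def)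
  have graded: "graded_submodule (F q)" for q
  proof -
    have Fq: "module.subspace (smult V) (F q)" "\<forall>x\<in>F q. der V x \<in> F q"
      "F q = {x + y | x y. x \<in> F q \<inter> part V 0 \<and> y \<in> F q \<inter> part V 1}"
      using F unfolding finite_rank_filtration_def by blast+
    have "hcomp ?A a x \<in> F q" if x: "x \<in> F q" for a x
    proof -
      obtain y z where yz: "x = y + z" "y \<in> F q" "y \<in> part V 0" "z \<in> F q" "z \<in> part V 1"
        using x Fq(3) by blast
      have "hcomp ?A 1 x = y" "hcomp ?A 0 x = z"
        using yz by (auto intro!: hcomp_eqI[OF sA] simp: sel)
      with yz show ?thesis
        by (cases a rule: bit_cases) simp_all
    qed
    with Fq show ?thesis
      by (simp add: graded_submodule_def sel)
  qed
  show ?thesis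
  proof
    show "graded_submodule (F q)" for q by (rule graded)
    show "F q \<subseteq> F (Suc q)" for q
      using F by (simp add: finite_rank_filtration_def)
    show "(\<Union>q. F q) = UNIV"
      using F carr by (simp add: finite_rank_filtration_def)
  qed
qed

theorem proposition5p2:
  fixes V :: "('k::field_char_0, 'v::ab_group_add) d_space"
    and F :: "nat \<Rightarrow> 'v set"
  assumes "d_superspace V"
    and "carr V = UNIV"
    and "finite_rank_filtration V F"
  shows "pro_conformal_pseudo_operad TYPE('w::ab_group_add)
           (\<lambda>n. chom (parity_reversal V) UNIV n)
           (chom_prod (parity_reversal V))
           (\<lambda>q n. chom (parity_reversal V) (F q) n)
           (\<lambda>q n. restrict_to (F q) n)
           (\<lambda>q n. restrict_to (F q) n)"
proof -
  let ?A = "parity_reversal V"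
  interpret exhaustive_filtration ?A F
    by (rule exhaustive_filtration_parity_reversal[OF assms])
  have finite_rank: "\<exists>S. finite S \<and> F q = span {(der ?A ^^ k) s | k s. s \<in> S}" for q
    using assms(3) by (simp add: finite_rank_filtration_def parity_reversal_def)
  show ?thesis
    unfolding pro_conformal_pseudo_operad_def chom_simps
  proof (intro conjI allI impI ballI; (elim conjE)?)
    show "dS_superspace n (chom ?A UNIV n)" for n
      by (rule dS_superspace_chom[OF graded_submodule_UNIV])
    show "linear_between (chom ?A UNIV m) (chom ?A UNIV (m + n - 1)) (\<lambda>g. chom_prod ?A n m i f g k)"
      if "1 \<le> i" "i \<le> n" "f \<in> chom_carr ?A UNIV n" for n m i k f
      unfolding linear_between_def chom_simps
      using that chom_prod_carr chom_prod_add_right chom_prod_smult_right by blast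
    show "linear_between (chom ?A UNIV n) (chom ?A UNIV (m + n - 1)) (\<lambda>f. chom_prod ?A n m i f g k)"
      if "1 \<le> i" "i \<le> n" "g \<in> chom_carr ?A UNIV m" for n m i k g
      unfolding linear_between_def chom_simps
      using that chom_prod_carr chom_prod_add_left chom_prod_smult_left by blast
    show "projective_system n (\<lambda>q. chom ?A (F q) n) (\<lambda>q. restrict_to (F q) n)" for n
      by (rule projective_system_chom)
    show "is_projective_limit TYPE('w) n (\<lambda>q. chom ?A (F q) n) (\<lambda>q. restrict_to (F q) n)
        (chom ?A UNIV n) (\<lambda>q. restrict_to (F q) n)" for n
      by (rule is_projective_limit_chom)
    show "finite {k. restrict_to (F q) (m + n - 1) (chom_prod ?A n m i f g k) \<noteq> 0}"
      if "1 \<le> i" "i \<le> n" "f \<in> chom_carr ?A UNIV n" "g \<in> chom_carr ?A UNIV m" for n m i q f g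
      using finite_rank[of q] finite_restrict_prod[OF that(3,4,1,2)] by blast
    show "chom_prod ?A (m + n - 1) l j (chom_prod ?A n m i f g a) h b =
        (\<lambda>v. Poly_Mapping.map (smult ?A (parity_sign (c * d)))
          (chom_prod ?A (l + n - 1) m (l + i - 1) (chom_prod ?A n l j f h b) g a v))"
      if "1 \<le> j" "j < i" "i \<le> n" "f \<in> chom_carr ?A UNIV n" "g \<in> chom_part ?A UNIV m c" "h \<in> chom_part ?A UNIV l d"
      for n m l i j a b c d f g h
      using chom_prod_assoc_disjoint[OF that(4-6,1-3)] .
    show "chom_prod ?A (m + n - 1) l j (chom_prod ?A n m i f g a) h b =
        (\<Sum>s\<le>b. (\<lambda>v. Poly_Mapping.map (smult ?A (of_nat ((a + b - s) choose a)))
          (chom_prod ?A n (l + m - 1) i f (chom_prod ?A m l (j - i + 1) g h s) (a + b - s) v)))"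
      if "1 \<le> i" "i \<le> n" "i \<le> j" "j < i + m"
        "f \<in> chom_carr ?A UNIV n" "g \<in> chom_carr ?A UNIV m" "h \<in> chom_carr ?A UNIV l"
      for n m l i j a b f g h
      using chom_prod_assoc_nested[OF that(5-7,1-4)] .
  qed (assumption | rule chom_prod_part chom_prod_der_left chom_prod_der_right chom_prod_act)+
qed

end
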